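(* Let $K\curvearrowright(M,\omega)$ be a Hamiltonian almost effective action of a compact connected semi-simple Lie group on a compact connected symplectic manifold, with moment map $\mu$, and endow $K$ with the bi-invariant metric given by the norm $\|\cdot\|_{\mu(M)}$ on $\mathfrak{k}$; let $R$ be the radius of injectivity of this norm. Let $\gamma:[a,b]\to K$ be piecewise $C^1$, and denote its right logarithmic derivative by $x_t=\dot\gamma_t\gamma_t^{-1}$. If $\gamma$ is a short path in $K$, then $(\mu^{x_t})_{t\in[a,b]}$ is a quasi-autonomous Hamiltonian path; and if $(\mu^{x_t})_{t\in[a,b]}$ is quasi-autonomous, then $\gamma$ is locally short (it is short on each subinterval on which its length is $\le R$).
   Context: $\mathfrak{k}$ is the Lie algebra of $K$, $\langle\cdot,\cdot\rangle$ is minus the Killing form of $\mathfrak{k}$ (an $\operatorname{Ad}$-invariant inner product), used to identify $\mathfrak{k}^*\simeq\mathfrak{k}$. The action is smooth and by symplectomorphisms; almost effective means that the kernel of $K\to\mathrm{Symp}(M,\omega)$ is discrete; Hamiltonian means that there is a moment map $\mu:M\to\mathfrak{k}^*\simeq\mathfrak{k}$, that is, $\mu(g\cdot m)=\operatorname{Ad}_g\mu(m)$ and, for $\mu^x:M\to\mathbb{R}$, $\mu^x(m)=\langle\mu(m),x\rangle$, one has $d\mu^x=-\omega(x_M,\cdot)$, where $x_M(m)=\frac{d}{dt}|_{t=0}\exp(tx)\cdot m$. The generalized Hofer norm is $$\|x\|_{\mu(M)}=\max_{y\in\mu(M)}\langle y,x\rangle-\min_{y\in\mu(M)}\langle y,x\rangle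 .$$ The length of a piecewise $C^1$ path in $K$ is $\int\|\dot\gamma_t\gamma_t^{-1}\|_{\mu(M)}dt$, and a path is short if its length is minimal among piecewise $C^1$ paths in $K$ with the same endpoints. The radius of injectivity $R$ is the maximal $R>0$ such that $\exp$ is a diffeomorphism from $\{v\in\mathfrak{k}:\|v\|_{\mu(M)}<R\}$ onto an open subset of $K$. A family of Hamiltonians $H_t:M\to\mathbb{R}$ is quasi-autonomous if there are two points $x^-,x^+\in M$ with $H_t(x^-)=\min_M H_t$ and $H_t(x^+)=\max_M H_t$ for all $t$ (here: all $t$ at which $x_t$ is defined). *)

theory Defs
  imports "HOL-Analysis.Analysis" "HOL-Algebra.Group_Action"
begin

section \<open>Smooth manifolds\<close>

text \<open>
  \<^term>\<open>smooth_on\<close> is meant for open sets: membership in every class of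
  continuously differentiable functions is expressed through iterated directional derivatives.
\<close>

primrec Ck_on :: "nat \<Rightarrow> ('a::real_normed_vector \<Rightarrow> 'b::real_normed_vector) \<Rightarrow> 'a set \<Rightarrow> bool" where
  "Ck_on 0 f S \<longleftrightarrow> continuous_on S f"
| "Ck_on (Suc k) f S \<longleftrightarrow>
     (\<forall>x\<in>S. f differentiable (at x)) \<and>
     (\<forall>v. Ck_on k (\<lambda>x. frechet_derivative f (at x) v) S)"

definition smooth_on :: "('a::real_normed_vector \<Rightarrow> 'b::real_normed_vector) \<Rightarrow> 'a set \<Rightarrow> bool" where
  "smooth_on f S \<longleftrightarrow> (\<forall>k. Ck_on k f S)"

text \<open>A chart is its domain together with a coordinate map, whose values off the domain are irrelevant.\<close>

type_synonym ('a, 'e) chart = "'a set \<times> ('a \<Rightarrow> 'e)"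

definition chart_inv :: "('a, 'e) chart \<Rightarrow> 'e \<Rightarrow> 'a" where
  "chart_inv c = inv_into (fst c) (snd c)"

record ('a, 'e) mfd =
  Top :: "'a topology"
  Atlas :: "('a, 'e) chart set"

abbreviation pts :: "('a, 'e) mfd \<Rightarrow> 'a set" where
  "pts M \<equiv> topspace (Top M)"

definition is_chart :: "'a topology \<Rightarrow> ('a, 'e::euclidean_space) chart \<Rightarrow> bool" where
  "is_chart X c \<longleftrightarrow>
     openin X (fst c) \<and> open (snd c ` fst c) \<and>
     homeomorphic_map (subtopology X (fst c)) (top_of_set (snd c ` fst c)) (snd c)"

definition smooth_manifold :: "('a, 'e::euclidean_space) mfd \<Rightarrow> bool" where
  "smooth_manifold M \<longleftrightarrow>
     Hausdorff_space (Top M) \<and> second_countable (Top M) \<and>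
     (\<forall>c\<in>Atlas M. is_chart (Top M) c) \<and>
     (\<Union>c\<in>Atlas M. fst c) = pts M \<and>
     (\<forall>c\<in>Atlas M. \<forall>d\<in>Atlas M.
        smooth_on (snd d \<circ> chart_inv c) (snd c ` (fst c \<inter> fst d)))"

definition euclidean_mfd :: "('e::euclidean_space, 'e) mfd" where
  "euclidean_mfd = \<lparr>Top = euclidean, Atlas = {(UNIV, id)}\<rparr>"

definition prod_mfd :: "('a, 'e) mfd \<Rightarrow> ('b, 'f) mfd \<Rightarrow> ('a \<times> 'b, 'e \<times> 'f) mfd" where
  "prod_mfd M N =
     \<lparr>Top = prod_topology (Top M) (Top N),
      Atlas = {(fst c \<times> fst d, map_prod (snd c) (snd d)) | c d. c \<in> Atlas M \<and> d \<in> Atlas N}\<rparr>"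

definition open_submfd :: "('a, 'e) mfd \<Rightarrow> 'a set \<Rightarrow> ('a, 'e) mfd" where
  "open_submfd M W =
     \<lparr>Top = subtopology (Top M) W, Atlas = (\<lambda>c. (fst c \<inter> W, snd c)) ` Atlas M\<rparr>"

definition smooth_map ::
  "('a, 'e::euclidean_space) mfd \<Rightarrow> ('b, 'f::euclidean_space) mfd \<Rightarrow> ('a \<Rightarrow> 'b) \<Rightarrow> bool" where
  "smooth_map M N f \<longleftrightarrow>
     continuous_map (Top M) (Top N) f \<and>
     (\<forall>c\<in>Atlas M. \<forall>d\<in>Atlas N.
        smooth_on (snd d \<circ> f \<circ> chart_inv c) (snd c ` {p \<in> fst c. f p \<in> fst d}))"

definition diffeomorphism ::
  "('a, 'e::euclidean_space) mfd \<Rightarrow> ('b, 'f::euclidean_space) mfd \<Rightarrow> ('a \<Rightarrow> 'b) \<Rightarrow> bool" where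
  "diffeomorphism M N f \<longleftrightarrow>
     bij_betw f (pts M) (pts N) \<and> smooth_map M N f \<and> smooth_map N M (inv_into (pts M) f)"

text \<open>
  The tangent space at a point \<open>p\<close> is represented by the model space \<open>'e\<close>, a vector standing for
  the tangent vector with these coordinates in one chart around \<open>p\<close> chosen once and for all.
\<close>

definition chart_at :: "('a, 'e) mfd \<Rightarrow> 'a \<Rightarrow> ('a, 'e) chart" where
  "chart_at M p = (SOME c. c \<in> Atlas M \<and> p \<in> fst c)"

definition coord :: "('a, 'e) mfd \<Rightarrow> 'a \<Rightarrow> 'a \<Rightarrow> 'e" where
  "coord M p = snd (chart_at M p)"

definition coord_inv :: "('a, 'e) mfd \<Rightarrow> 'a \<Rightarrow> 'e \<Rightarrow> 'a" where
  "coord_inv M p = chart_inv (chart_at M p)"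

text \<open>The differential of \<open>f\<close> at \<open>p\<close>, from the tangent space at \<open>p\<close> to that at \<open>f p\<close>.\<close>

definition differential ::
  "('a, 'e::euclidean_space) mfd \<Rightarrow> ('b, 'f::euclidean_space) mfd \<Rightarrow> ('a \<Rightarrow> 'b) \<Rightarrow> 'a \<Rightarrow> 'e \<Rightarrow> 'f" where
  "differential M N f p =
     frechet_derivative (coord N (f p) \<circ> f \<circ> coord_inv M p) (at (coord M p p))"

text \<open>
  The velocity, at time \<open>t\<close>, of a curve defined on \<open>T\<close>; it is a tangent vector at \<open>\<gamma> t\<close>
  (one-sided if \<open>t\<close> is an end point of the interval \<open>T\<close>).
\<close>

definition curve_differentiable_at ::
  "('a, 'e::euclidean_space) mfd \<Rightarrow> real set \<Rightarrow> (real \<Rightarrow> 'a) \<Rightarrow> real \<Rightarrow> bool" where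
  "curve_differentiable_at M T \<gamma> t \<longleftrightarrow> (coord M (\<gamma> t) \<circ> \<gamma>) differentiable (at t within T)"

definition velocity ::
  "('a, 'e::euclidean_space) mfd \<Rightarrow> real set \<Rightarrow> (real \<Rightarrow> 'a) \<Rightarrow> real \<Rightarrow> 'e" where
  "velocity M T \<gamma> t = vector_derivative (coord M (\<gamma> t) \<circ> \<gamma>) (at t within T)"

definition C1_curve ::
  "('a, 'e::euclidean_space) mfd \<Rightarrow> real \<Rightarrow> real \<Rightarrow> (real \<Rightarrow> 'a) \<Rightarrow> bool" where
  "C1_curve M a b \<gamma> \<longleftrightarrow>
     continuous_map (top_of_set {a..b}) (Top M) \<gamma> \<and>
     (\<forall>c\<in>Atlas M. \<exists>D. continuous_on {t \<in> {a..b}. \<gamma> t \<in> fst c} D \<and>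
        (\<forall>t\<in>{a..b}. \<gamma> t \<in> fst c \<longrightarrow>
           ((snd c \<circ> \<gamma>) has_vector_derivative D t) (at t within {a..b})))"

definition piecewise_C1_curve ::
  "('a, 'e::euclidean_space) mfd \<Rightarrow> real \<Rightarrow> real \<Rightarrow> (real \<Rightarrow> 'a) \<Rightarrow> bool" where
  "piecewise_C1_curve M a b \<gamma> \<longleftrightarrow>
     (\<exists>(n::nat) s. s 0 = a \<and> s n = b \<and>
        (\<forall>i<n. s i < s (Suc i) \<and> C1_curve M (s i) (s (Suc i)) \<gamma>))"


section \<open>Symplectic forms\<close>

text \<open>
  A 2-form assigns to each point a bilinear form on the tangent space there.  Its coefficients in
  an arbitrary chart \<open>c\<close>, at coordinates \<open>y\<close>, are obtained by transporting coordinate vectors of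
  \<open>c\<close> to the chart that represents the tangent space.
\<close>

definition form_in_chart ::
  "('a, 'e::euclidean_space) mfd \<Rightarrow> ('a \<Rightarrow> 'e \<Rightarrow> 'e \<Rightarrow> real) \<Rightarrow> ('a, 'e) chart \<Rightarrow> 'e \<Rightarrow> 'e \<Rightarrow> 'e \<Rightarrow> real" where
  "form_in_chart M \<omega> c y u v =
     (let p = chart_inv c y; T = frechet_derivative (coord M p \<circ> chart_inv c) (at y)
      in \<omega> p (T u) (T v))"

definition smooth_two_form ::
  "('a, 'e::euclidean_space) mfd \<Rightarrow> ('a \<Rightarrow> 'e \<Rightarrow> 'e \<Rightarrow> real) \<Rightarrow> bool" where
  "smooth_two_form M \<omega> \<longleftrightarrow>
     (\<forall>p\<in>pts M. bilinear (\<omega> p) \<and> (\<forall>u. \<omega> p u u = 0)) \<and>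
     (\<forall>c\<in>Atlas M. \<forall>u v. smooth_on (\<lambda>y. form_in_chart M \<omega> c y u v) (snd c ` fst c))"

text \<open>For constant vector fields the exterior derivative reduces to the cyclic sum below.\<close>

definition closed_two_form ::
  "('a, 'e::euclidean_space) mfd \<Rightarrow> ('a \<Rightarrow> 'e \<Rightarrow> 'e \<Rightarrow> real) \<Rightarrow> bool" where
  "closed_two_form M \<omega> \<longleftrightarrow>
     (\<forall>c\<in>Atlas M. \<forall>y\<in>snd c ` fst c. \<forall>u v w.
        frechet_derivative (\<lambda>y. form_in_chart M \<omega> c y v w) (at y) u +
        frechet_derivative (\<lambda>y. form_in_chart M \<omega> c y w u) (at y) v +
        frechet_derivative (\<lambda>y. form_in_chart M \<omega> c y u v) (at y) w = 0)"

definition symplectic_form ::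
  "('a, 'e::euclidean_space) mfd \<Rightarrow> ('a \<Rightarrow> 'e \<Rightarrow> 'e \<Rightarrow> real) \<Rightarrow> bool" where
  "symplectic_form M \<omega> \<longleftrightarrow>
     smooth_two_form M \<omega> \<and> closed_two_form M \<omega> \<and>
     (\<forall>p\<in>pts M. \<forall>u. (\<forall>v. \<omega> p u v = 0) \<longrightarrow> u = 0)"


section \<open>Lie groups\<close>

text \<open>
  A Lie group is a group \<open>G\<close> together with a manifold \<open>K\<close> whose points are the elements of \<open>G\<close>.
  The model space \<open>'g\<close> of \<open>K\<close> represents the Lie algebra, i.e. the tangent space at \<open>\<one>\<close>.
\<close>

definition lie_group :: "('k, 'z) monoid_scheme \<Rightarrow> ('k, 'g::euclidean_space) mfd \<Rightarrow> bool" where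
  "lie_group G K \<longleftrightarrow>
     group G \<and> smooth_manifold K \<and> pts K = carrier G \<and>
     smooth_map (prod_mfd K K) K (\<lambda>(g, h). g \<otimes>\<^bsub>G\<^esub> h) \<and>
     smooth_map K K (\<lambda>g. inv\<^bsub>G\<^esub> g)"

definition Ad ::
  "('k, 'z) monoid_scheme \<Rightarrow> ('k, 'g::euclidean_space) mfd \<Rightarrow> 'k \<Rightarrow> 'g \<Rightarrow> 'g" where
  "Ad G K g = differential K K (\<lambda>h. g \<otimes>\<^bsub>G\<^esub> h \<otimes>\<^bsub>G\<^esub> inv\<^bsub>G\<^esub> g) \<one>\<^bsub>G\<^esub>"

definition lie_bracket ::
  "('k, 'z) monoid_scheme \<Rightarrow> ('k, 'g::euclidean_space) mfd \<Rightarrow> 'g \<Rightarrow> 'g \<Rightarrow> 'g" where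
  "lie_bracket G K x y = differential K euclidean_mfd (\<lambda>g. Ad G K g y) \<one>\<^bsub>G\<^esub> x"

definition killing_form ::
  "('k, 'z) monoid_scheme \<Rightarrow> ('k, 'g::euclidean_space) mfd \<Rightarrow> 'g \<Rightarrow> 'g \<Rightarrow> real" where
  "killing_form G K x y = (\<Sum>b\<in>Basis. lie_bracket G K x (lie_bracket G K y b) \<bullet> b)"

definition lie_inner ::
  "('k, 'z) monoid_scheme \<Rightarrow> ('k, 'g::euclidean_space) mfd \<Rightarrow> 'g \<Rightarrow> 'g \<Rightarrow> real" where
  "lie_inner G K x y = - killing_form G K x y"

definition lie_exp ::
  "('k, 'z) monoid_scheme \<Rightarrow> ('k, 'g::euclidean_space) mfd \<Rightarrow> 'g \<Rightarrow> 'k" where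
  "lie_exp G K x =
     (THE c. smooth_map euclidean_mfd K c \<and> (\<forall>s t. c (s + t) = c s \<otimes>\<^bsub>G\<^esub> c t) \<and>
             velocity K UNIV c 0 = x) (1::real)"

definition lie_ideal ::
  "('k, 'z) monoid_scheme \<Rightarrow> ('k, 'g::euclidean_space) mfd \<Rightarrow> 'g set \<Rightarrow> bool" where
  "lie_ideal G K I \<longleftrightarrow> subspace I \<and> (\<forall>x. \<forall>y\<in>I. lie_bracket G K x y \<in> I)"

primrec derived_series ::
  "('k, 'z) monoid_scheme \<Rightarrow> ('k, 'g::euclidean_space) mfd \<Rightarrow> 'g set \<Rightarrow> nat \<Rightarrow> 'g set" where
  "derived_series G K I 0 = I"
| "derived_series G K I (Suc n) =
     span {lie_bracket G K x y | x y. x \<in> derived_series G K I n \<and> y \<in> derived_series G K I n}"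

text \<open>Semi-simplicity: the radical, i.e. the largest solvable ideal of the Lie algebra, vanishes.\<close>

definition semisimple ::
  "('k, 'z) monoid_scheme \<Rightarrow> ('k, 'g::euclidean_space) mfd \<Rightarrow> bool" where
  "semisimple G K \<longleftrightarrow>
     (\<forall>I. lie_ideal G K I \<and> (\<exists>n. derived_series G K I n = {0}) \<longrightarrow> I = {0})"

text \<open>\<open>\<gamma>' \<gamma>\<inverse>\<close>, the velocity of a curve on \<open>{a..b}\<close> carried to \<open>\<one>\<close> by a right translation.\<close>

definition right_log_deriv ::
  "('k, 'z) monoid_scheme \<Rightarrow> ('k, 'g::euclidean_space) mfd \<Rightarrow> real \<Rightarrow> real \<Rightarrow> (real \<Rightarrow> 'k) \<Rightarrow> real \<Rightarrow> 'g" where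
  "right_log_deriv G K a b \<gamma> t =
     differential K K (\<lambda>g. g \<otimes>\<^bsub>G\<^esub> inv\<^bsub>G\<^esub> (\<gamma> t)) (\<gamma> t) (velocity K {a..b} \<gamma> t)"


section \<open>Hamiltonian actions\<close>

definition smooth_action ::
  "('k, 'z) monoid_scheme \<Rightarrow> ('k, 'g::euclidean_space) mfd \<Rightarrow> ('m, 'e::euclidean_space) mfd \<Rightarrow>
   ('k \<Rightarrow> 'm \<Rightarrow> 'm) \<Rightarrow> bool" where
  "smooth_action G K M act \<longleftrightarrow>
     group_action G (pts M) act \<and> smooth_map (prod_mfd K M) M (\<lambda>(g, m). act g m)"

definition symplectic_action ::
  "('k, 'z) monoid_scheme \<Rightarrow> ('m, 'e::euclidean_space) mfd \<Rightarrow> ('m \<Rightarrow> 'e \<Rightarrow> 'e \<Rightarrow> real) \<Rightarrow>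
   ('k \<Rightarrow> 'm \<Rightarrow> 'm) \<Rightarrow> bool" where
  "symplectic_action G M \<omega> act \<longleftrightarrow>
     (\<forall>g\<in>carrier G. \<forall>m\<in>pts M. \<forall>u v.
        \<omega> (act g m) (differential M M (act g) m u) (differential M M (act g) m v) = \<omega> m u v)"

definition almost_effective ::
  "('k, 'z) monoid_scheme \<Rightarrow> ('k, 'g) mfd \<Rightarrow> ('m, 'e) mfd \<Rightarrow> ('k \<Rightarrow> 'm \<Rightarrow> 'm) \<Rightarrow> bool" where
  "almost_effective G K M act \<longleftrightarrow>
     (let N = kernel G (BijGroup (pts M)) act in subtopology (Top K) N = discrete_topology N)"

text \<open>The vector field \<open>x\<^sub>M\<close>.\<close>

definition fundamental_field ::
  "('k, 'z) monoid_scheme \<Rightarrow> ('k, 'g::euclidean_space) mfd \<Rightarrow> ('m, 'e::euclidean_space) mfd \<Rightarrow>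
   ('k \<Rightarrow> 'm \<Rightarrow> 'm) \<Rightarrow> 'g \<Rightarrow> 'm \<Rightarrow> 'e" where
  "fundamental_field G K M act x m =
     velocity M UNIV (\<lambda>t. act (lie_exp G K (t *\<^sub>R x)) m) 0"

text \<open>The function \<open>\<mu>\<^sup>x\<close>, where \<open>\<mu>\<close> takes values in the Lie algebra.\<close>

definition moment_component ::
  "('k, 'z) monoid_scheme \<Rightarrow> ('k, 'g::euclidean_space) mfd \<Rightarrow> ('m \<Rightarrow> 'g) \<Rightarrow> 'g \<Rightarrow> 'm \<Rightarrow> real" where
  "moment_component G K \<mu> x m = lie_inner G K (\<mu> m) x"

definition moment_map ::
  "('k, 'z) monoid_scheme \<Rightarrow> ('k, 'g::euclidean_space) mfd \<Rightarrow> ('m, 'e::euclidean_space) mfd \<Rightarrow>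
   ('m \<Rightarrow> 'e \<Rightarrow> 'e \<Rightarrow> real) \<Rightarrow> ('k \<Rightarrow> 'm \<Rightarrow> 'm) \<Rightarrow> ('m \<Rightarrow> 'g) \<Rightarrow> bool" where
  "moment_map G K M \<omega> act \<mu> \<longleftrightarrow>
     smooth_map M euclidean_mfd \<mu> \<and>
     (\<forall>g\<in>carrier G. \<forall>m\<in>pts M. \<mu> (act g m) = Ad G K g (\<mu> m)) \<and>
     (\<forall>x. \<forall>m\<in>pts M. \<forall>v.
        differential M euclidean_mfd (moment_component G K \<mu> x) m v
          = - \<omega> m (fundamental_field G K M act x m) v)"

definition quasi_autonomous :: "'m set \<Rightarrow> real set \<Rightarrow> (real \<Rightarrow> 'm \<Rightarrow> real) \<Rightarrow> bool" where
  "quasi_autonomous X T H \<longleftrightarrow>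
     (\<exists>xmin\<in>X. \<exists>xmax\<in>X. \<forall>t\<in>T. \<forall>m\<in>X. H t xmin \<le> H t m \<and> H t m \<le> H t xmax)"


section \<open>The generalized Hofer norm and short paths\<close>

text \<open>\<open>S\<close> is to be the image of the moment map; when \<open>S\<close> is compact the bounds are attained.\<close>

definition hofer_norm ::
  "('k, 'z) monoid_scheme \<Rightarrow> ('k, 'g::euclidean_space) mfd \<Rightarrow> 'g set \<Rightarrow> 'g \<Rightarrow> real" where
  "hofer_norm G K S x = (SUP y\<in>S. lie_inner G K y x) - (INF y\<in>S. lie_inner G K y x)"

text \<open>At the finitely many break points of a path the integrand is irrelevant.\<close>

definition path_length ::
  "('k, 'z) monoid_scheme \<Rightarrow> ('k, 'g::euclidean_space) mfd \<Rightarrow> 'g set \<Rightarrow>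
   real \<Rightarrow> real \<Rightarrow> (real \<Rightarrow> 'k) \<Rightarrow> real" where
  "path_length G K S a b \<gamma> =
     integral {a..b} (\<lambda>t. hofer_norm G K S (right_log_deriv G K a b \<gamma> t))"

definition short_path ::
  "('k, 'z) monoid_scheme \<Rightarrow> ('k, 'g::euclidean_space) mfd \<Rightarrow> 'g set \<Rightarrow>
   real \<Rightarrow> real \<Rightarrow> (real \<Rightarrow> 'k) \<Rightarrow> bool" where
  "short_path G K S a b \<gamma> \<longleftrightarrow>
     (\<forall>c d \<eta>. c < d \<and> piecewise_C1_curve K c d \<eta> \<and> \<eta> c = \<gamma> a \<and> \<eta> d = \<gamma> b \<longrightarrow>
        path_length G K S a b \<gamma> \<le> path_length G K S c d \<eta>)"

definition exp_diffeo_radius ::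
  "('k, 'z) monoid_scheme \<Rightarrow> ('k, 'g::euclidean_space) mfd \<Rightarrow> 'g set \<Rightarrow> real \<Rightarrow> bool" where
  "exp_diffeo_radius G K S r \<longleftrightarrow>
     (let B = {v. hofer_norm G K S v < r}; W = lie_exp G K ` B in
        openin (Top K) W \<and>
        diffeomorphism (open_submfd euclidean_mfd B) (open_submfd K W) (lie_exp G K))"

definition injectivity_radius ::
  "('k, 'z) monoid_scheme \<Rightarrow> ('k, 'g::euclidean_space) mfd \<Rightarrow> 'g set \<Rightarrow> real \<Rightarrow> bool" where
  "injectivity_radius G K S R \<longleftrightarrow>
     R > 0 \<and> exp_diffeo_radius G K S R \<and> (\<forall>r>0. exp_diffeo_radius G K S r \<longrightarrow> r \<le> R)"

text \<open>Shortness on every subinterval on which the length is at most \<open>R\<close>.\<close>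

definition locally_short ::
  "('k, 'z) monoid_scheme \<Rightarrow> ('k, 'g::euclidean_space) mfd \<Rightarrow> 'g set \<Rightarrow> real \<Rightarrow>
   real \<Rightarrow> real \<Rightarrow> (real \<Rightarrow> 'k) \<Rightarrow> bool" where
  "locally_short G K S R a b \<gamma> \<longleftrightarrow>
     (\<forall>c d. a \<le> c \<and> c < d \<and> d \<le> b \<and> path_length G K S c d \<gamma> \<le> R \<longrightarrow> short_path G K S c d \<gamma>)"

end

theory Submission
  imports Defs
begin

text \<open>
  The generalized Hofer norm \<open>N\<close> is an \<open>Ad\<close>-invariant seminorm, and a point \<open>y\<close> of \<open>\<mu>(M)\<close> that is extremal for
  \<open>u\<close> satisfies \<open>\<langle>y, [u, w]\<rangle> = 0\<close> for all \<open>w\<close>.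

  Short implies quasi-autonomous: if \<open>\<gamma>\<close> is short with logarithmic derivative \<open>x\<^sub>t\<close> of mean \<open>m\<close>, its
  length is compared with that of \<open>exp(s w\<^sub>t)\<inverse> \<gamma>\<^sub>t\<close>, where \<open>w\<close> is the primitive of \<open>x\<^sub>t - m\<close> vanishing at
  both ends. To first order in \<open>s\<close> this gives \<open>\<integral> N(x\<^sub>t) dt \<le> N(\<integral> x\<^sub>t dt)\<close>, and then the points of
  \<open>\<mu>(M)\<close> that are extremal for \<open>\<integral> x\<^sub>t dt\<close> are extremal for every \<open>x\<^sub>t\<close>.

  Quasi-autonomous implies locally short: a curve of length \<open>< R\<close> starting at \<open>1\<close> lifts to the Lie
  algebra, and the norm of its logarithm grows at most like its length, because a point extremal
  for \<open>u\<close> does not see the difference between \<open>dexp\<^sub>u\<close> and the identity. If moreover \<open>y\<close> is extremal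
  for all \<open>x\<^sub>t\<close>, then \<open>\<gamma>\<^sub>t\<close> fixes \<open>y\<close>, hence so does the one-parameter group through it by injectivity
  of the exponential map, and \<open>\<langle>y, log \<gamma>\<^sub>t\<rangle>\<close> grows exactly like \<open>\<integral> \<langle>y, x\<^sub>t\<rangle> dt\<close>: the bound is attained.

  The existence of one-parameter subgroups, the definiteness of \<open>N\<close> and the nondegeneracy of the
  Killing form are all read off from the injectivity of the exponential map on a ball.
\<close>

section \<open>Calculus of smooth functions\<close>

text \<open>The norm \<open>N\<close> is in general not differentiable, so no first variation
  formula is available. It is handled through the linear functionals \<open>ip y - ip z\<close> with
  \<open>y\<close>, \<open>z\<close> in \<open>S\<close>: all of them lie below \<open>N\<close>,
  and an extremal pair for \<open>u\<close> attains it at \<open>u\<close>. Extremal points are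
  orthogonal to brackets because \<open>Ad\<close> preserves the image of the moment map, so that
  they are critical on their own orbits; and dexp at \<open>u\<close> differs from the identity only
  by brackets with \<open>u\<close>. In the first half, the competitor moves the logarithmic
  derivative a fraction \<open>s\<close> of the way towards its mean \<open>m\<close>, so that
  convexity of \<open>N\<close> applies up to an error of lower order. In the second half the
  obstacle is that \<open>lie_exp\<close> is controlled only on the open ball of radius
  \<open>R\<close>, while length exactly \<open>R\<close> is allowed: such a curve need not lift up
  to its end point, and the contradiction has to be found at an earlier time.\<close>

lemma Ck_on_subset: "Ck_on k f S \<Longrightarrow> T \<subseteq> S \<Longrightarrow> Ck_on k f T"
  by (induction k arbitrary: f) (auto intro: continuous_on_subset)

lemma Ck_on_SucD: "Ck_on (Suc k) f S \<Longrightarrow> Ck_on k f S"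
proof (induction k arbitrary: f)
  case 0
  then show ?case
    by (auto intro!: continuous_at_imp_continuous_on differentiable_imp_continuous_within)
qed auto

text \<open>Functions that agree on an open set have the same derivatives there, so the induction
  can descend to directional derivatives.\<close>

lemma Ck_on_cong:
  assumes "open S" "\<And>x. x \<in> S \<Longrightarrow> f x = g x" "Ck_on k f S"
  shows "Ck_on k g S"
  using assms(2,3)
proof (induction k arbitrary: f g)
  case 0
  then show ?case by (simp cong: continuous_on_cong)
next
  case (Suc k)
  have tr: "(g has_derivative F) (at x)" if "x \<in> S" "(f has_derivative F) (at x)" for x F
    using has_derivative_transform_within_open[OF that(2) assms(1) that(1)] Suc.prems(1) by auto
  have d: "f differentiable (at x)" if "x \<in> S" for x
    using Suc.prems that by auto
  have eq: "frechet_derivative f (at x) v = frechet_derivative g (at x) v" if "x \<in> S" for x v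
    using frechet_derivative_at[OF tr[OF that]] frechet_derivative_works[THEN iffD1, OF d[OF that]]
    by metis
  have "g differentiable (at x)" if "x \<in> S" for x
    using d[OF that] tr[OF that] unfolding differentiable_def by blast
  moreover have "Ck_on k (\<lambda>x. frechet_derivative g (at x) v) S" for v
    by (rule Suc.IH[of "\<lambda>x. frechet_derivative f (at x) v"]) (use eq Suc.prems in auto)
  ultimately show ?case by simp
qed

lemma Ck_on_local:
  assumes "\<And>x. x \<in> S \<Longrightarrow> \<exists>U. open U \<and> x \<in> U \<and> Ck_on k f U"
  shows "Ck_on k f S"
  using assms
proof (induction k arbitrary: f)
  case 0
  show ?case
  proof (simp, rule continuous_at_imp_continuous_on, rule ballI)
    fix x assume "x \<in> S"
    then obtain U where "open U" "x \<in> U" "continuous_on U f" using 0 by force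
    then show "isCont f x" using continuous_on_eq_continuous_at by blast
  qed
next
  case (Suc k)
  have "f differentiable (at x)" if "x \<in> S" for x
    using Suc.prems[OF that] unfolding Ck_on.simps by blast
  moreover have "Ck_on k (\<lambda>x. frechet_derivative f (at x) v) S" for v
  proof (rule Suc.IH)
    fix x assume "x \<in> S"
    then show "\<exists>U. open U \<and> x \<in> U \<and> Ck_on k (\<lambda>x. frechet_derivative f (at x) v) U"
      using Suc.prems unfolding Ck_on.simps by blast
  qed
  ultimately show ?case by simp
qed

lemma Ck_on_const: "Ck_on k (\<lambda>x. c) S"
proof (induction k arbitrary: c)
  case (Suc k)
  have "frechet_derivative (\<lambda>x. c) (at x) v = 0" for x :: 'a and v
    by (simp add: frechet_derivative_const)
  then show ?case using Suc[of 0] by simp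
qed simp

lemma Ck_on_bounded_linear:
  assumes "bounded_linear f"
  shows "Ck_on k f S"
proof (cases k)
  case 0
  then show ?thesis using assms by (simp add: linear_continuous_on)
next
  case (Suc j)
  have "frechet_derivative f (at x) v = f v" for x v
    using frechet_derivative_at[OF bounded_linear_imp_has_derivative[OF assms]] by metis
  then show ?thesis
    using Suc bounded_linear_imp_differentiable[OF assms] by (simp add: Ck_on_const)
qed

lemma frechet_derivative_eqI: "(f has_derivative F) (at x) \<Longrightarrow> frechet_derivative f (at x) v = F v"
  using frechet_derivative_at by fastforce

lemma frechet_derivativeD:
  "f differentiable (at x) \<Longrightarrow> (f has_derivative frechet_derivative f (at x)) (at x)"
  by (rule frechet_derivative_works[THEN iffD1])

lemma Ck_on_add:
  assumes "open S" "Ck_on k f S" "Ck_on k g S"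
  shows "Ck_on k (\<lambda>x. f x + g x) S"
  using assms(2,3)
proof (induction k arbitrary: f g)
  case 0
  then show ?case by (simp add: continuous_on_add)
next
  case (Suc k)
  have d: "((\<lambda>x. f x + g x) has_derivative
      (\<lambda>v. frechet_derivative f (at x) v + frechet_derivative g (at x) v)) (at x)" if "x \<in> S" for x
    using Suc.prems that by (intro has_derivative_add frechet_derivativeD) auto
  have "Ck_on k (\<lambda>x. frechet_derivative (\<lambda>x. f x + g x) (at x) v) S" for v
  proof (rule Ck_on_cong[OF assms(1)])
    show "Ck_on k (\<lambda>x. frechet_derivative f (at x) v + frechet_derivative g (at x) v) S"
      using Suc by simp
  qed (simp add: frechet_derivative_eqI[OF d])
  then show ?case using d by (auto simp: differentiable_def)
qed

lemma Ck_on_scaleR: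
  fixes f :: "'a::real_normed_vector \<Rightarrow> real"
  assumes "open S" "Ck_on k f S" "Ck_on k g S"
  shows "Ck_on k (\<lambda>x. f x *\<^sub>R g x) S"
  using assms(2,3)
proof (induction k arbitrary: f g)
  case 0
  then show ?case by (simp add: continuous_on_scaleR)
next
  case (Suc k)
  have d: "((\<lambda>x. f x *\<^sub>R g x) has_derivative
      (\<lambda>v. f x *\<^sub>R frechet_derivative g (at x) v + frechet_derivative f (at x) v *\<^sub>R g x)) (at x)"
    if "x \<in> S" for x
    using Suc.prems that by (intro has_derivative_scaleR frechet_derivativeD) auto
  have "Ck_on k (\<lambda>x. frechet_derivative (\<lambda>x. f x *\<^sub>R g x) (at x) v) S" for v
  proof (rule Ck_on_cong[OF assms(1)])
    show "Ck_on k (\<lambda>x. f x *\<^sub>R frechet_derivative g (at x) v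
        + frechet_derivative f (at x) v *\<^sub>R g x) S"
      using Suc.prems Suc.prems[THEN Ck_on_SucD] by (intro Ck_on_add assms(1) Suc.IH) simp_all
  qed (simp add: frechet_derivative_eqI[OF d])
  then show ?case using d by (auto simp: differentiable_def)
qed

lemma Ck_on_sum:
  assumes "open S" "finite I" "\<And>i. i \<in> I \<Longrightarrow> Ck_on k (f i) S"
  shows "Ck_on k (\<lambda>x. \<Sum>i\<in>I. f i x) S"
  using assms(2,3)
  by (induction I) (auto intro: Ck_on_const Ck_on_add[OF assms(1)])

lemma Ck_on_linear_compose:
  assumes "open S" "bounded_linear L" "Ck_on k f S"
  shows "Ck_on k (\<lambda>x. L (f x)) S"
  using assms(3)
proof (induction k arbitrary: f)
  case 0
  then show ?case by (simp add: bounded_linear.continuous_on[OF assms(2)])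
next
  case (Suc k)
  have d: "((\<lambda>x. L (f x)) has_derivative (\<lambda>v. L (frechet_derivative f (at x) v))) (at x)"
    if "x \<in> S" for x
    using Suc.prems that
    by (intro bounded_linear.has_derivative[OF assms(2)] frechet_derivativeD) auto
  have "Ck_on k (\<lambda>x. frechet_derivative (\<lambda>x. L (f x)) (at x) v) S" for v
  proof (rule Ck_on_cong[OF assms(1)])
    show "Ck_on k (\<lambda>x. L (frechet_derivative f (at x) v)) S"
      using Suc by simp
  qed (simp add: frechet_derivative_eqI[OF d])
  then show ?case using d by (auto simp: differentiable_def)
qed

lemma Ck_on_Pair:
  assumes "open S" "Ck_on k f S" "Ck_on k g S"
  shows "Ck_on k (\<lambda>x. (f x, g x)) S"
proof -
  have "bounded_linear (\<lambda>x. (x, 0))" "bounded_linear (\<lambda>x. (0, x))"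
    by (auto intro!: bounded_linear_Pair bounded_linear_ident bounded_linear_zero)
  note this[THEN Ck_on_linear_compose[OF assms(1)]]
  from Ck_on_add[OF assms(1) this(1)[OF assms(2)] this(2)[OF assms(3)]]
  show ?thesis by simp
qed

lemma linear_Basis_expansion:
  fixes f :: "'a::euclidean_space \<Rightarrow> 'b::real_vector"
  assumes "linear f"
  shows "f v = (\<Sum>b\<in>Basis. (v \<bullet> b) *\<^sub>R f b)"
proof -
  have "f v = f (\<Sum>b\<in>Basis. (v \<bullet> b) *\<^sub>R b)"
    by (simp only: euclidean_representation)
  also have "\<dots> = (\<Sum>b\<in>Basis. (v \<bullet> b) *\<^sub>R f b)"
    by (simp only: linear_sum[OF assms] linear_scale[OF assms])
  finally show ?thesis .
qed

text \<open>\<open>Ck_on\<close> speaks only of derivatives in fixed directions, whereas the chain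
  rule evaluates the derivative of \<open>f\<close> in the moving direction \<open>?g' x v\<close>.
  Expanding that direction in the basis gives a finite sum of products, each covered by the
  induction hypothesis.\<close>

lemma Ck_on_compose:
  fixes g :: "'a::real_normed_vector \<Rightarrow> 'b::euclidean_space"
  assumes "open S" "open T" "g ` S \<subseteq> T" "Ck_on k g S" "Ck_on k f T"
  shows "Ck_on k (\<lambda>x. f (g x)) S"
  using assms(4,5)
proof (induction k arbitrary: f)
  case 0
  then show ?case using assms(3) by (simp add: continuous_on_compose2[of T f S g])
next
  case (Suc k)
  let ?f' = "\<lambda>x. frechet_derivative f (at x)" and ?g' = "\<lambda>x. frechet_derivative g (at x)"
  have df: "f differentiable (at (g x))" and dg: "g differentiable (at x)" if "x \<in> S" for x
    using Suc.prems that assms(3) by auto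
  have d: "((\<lambda>x. f (g x)) has_derivative (\<lambda>v. ?f' (g x) (?g' x v))) (at x)" if "x \<in> S" for x
    by (rule has_derivative_compose[OF frechet_derivativeD[OF dg] frechet_derivativeD[OF df]]; fact that)
  have e: "frechet_derivative (\<lambda>x. f (g x)) (at x) v = (\<Sum>b\<in>Basis. (?g' x v \<bullet> b) *\<^sub>R ?f' (g x) b)"
    if "x \<in> S" for x v
    unfolding frechet_derivative_eqI[OF d[OF that]]
    by (rule linear_Basis_expansion[OF linear_frechet_derivative[OF df[OF that]]])
  have "Ck_on k (\<lambda>x. frechet_derivative (\<lambda>x. f (g x)) (at x) v) S" for v
  proof (rule Ck_on_cong[OF assms(1)])
    have "Ck_on k (\<lambda>x. ?g' x v \<bullet> b) S" for b
      by (rule Ck_on_linear_compose[OF assms(1) bounded_linear_inner_left]) (use Suc.prems in simp)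
    moreover have "Ck_on k (\<lambda>x. ?f' (g x) b) S" for b
      by (rule Suc.IH[OF Ck_on_SucD[OF Suc.prems(1)]]) (use Suc.prems(2) in simp)
    ultimately show "Ck_on k (\<lambda>x. \<Sum>b\<in>Basis. (?g' x v \<bullet> b) *\<^sub>R ?f' (g x) b) S"
      by (intro Ck_on_sum Ck_on_scaleR assms(1) finite_Basis) 
  qed (rule e[symmetric])
  then show ?case using d by (auto simp: differentiable_def)
qed

lemma smooth_on_subset: "smooth_on f S \<Longrightarrow> T \<subseteq> S \<Longrightarrow> smooth_on f T"
  using Ck_on_subset unfolding smooth_on_def by blast

lemma smooth_on_cong: "open S \<Longrightarrow> (\<And>x. x \<in> S \<Longrightarrow> f x = g x) \<Longrightarrow> smooth_on f S \<Longrightarrow> smooth_on g S"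
  using Ck_on_cong unfolding smooth_on_def by blast

lemma smooth_on_local:
  "(\<And>x. x \<in> S \<Longrightarrow> \<exists>U. open U \<and> x \<in> U \<and> smooth_on f U) \<Longrightarrow> smooth_on f S"
  unfolding smooth_on_def by (intro allI Ck_on_local) blast

lemma smooth_on_const: "smooth_on (\<lambda>x. c) S"
  by (simp add: smooth_on_def Ck_on_const)

lemma smooth_on_bounded_linear: "bounded_linear f \<Longrightarrow> smooth_on f S"
  by (simp add: smooth_on_def Ck_on_bounded_linear)

lemma smooth_on_Pair:
  "open S \<Longrightarrow> smooth_on f S \<Longrightarrow> smooth_on g S \<Longrightarrow> smooth_on (\<lambda>x. (f x, g x)) S"
  by (simp add: smooth_on_def Ck_on_Pair)

lemma smooth_on_compose:
  fixes g :: "'a::real_normed_vector \<Rightarrow> 'b::euclidean_space"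
  shows "open S \<Longrightarrow> open T \<Longrightarrow> g ` S \<subseteq> T \<Longrightarrow> smooth_on g S \<Longrightarrow> smooth_on f T \<Longrightarrow>
    smooth_on (\<lambda>x. f (g x)) S"
  unfolding smooth_on_def by (blast intro: Ck_on_compose)

lemma smooth_on_has_derivative:
  "smooth_on f S \<Longrightarrow> x \<in> S \<Longrightarrow> (f has_derivative frechet_derivative f (at x)) (at x)"
  unfolding smooth_on_def by (metis Ck_on.simps(2) frechet_derivativeD)

lemma smooth_on_continuous_on: "smooth_on f S \<Longrightarrow> continuous_on S f"
  unfolding smooth_on_def by (metis Ck_on.simps(1))

lemma smooth_on_derivative: "smooth_on f S \<Longrightarrow> smooth_on (\<lambda>x. frechet_derivative f (at x) v) S"
  unfolding smooth_on_def by (metis Ck_on.simps(2))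

text \<open>Base point and direction both move with \<open>t\<close>; the basis expansion separates
  them.\<close>

lemma continuous_on_frechet_derivative:
  fixes f :: "'a::euclidean_space \<Rightarrow> 'b::real_normed_vector"
  assumes "smooth_on f S" "continuous_on T z" "z ` T \<subseteq> S" "continuous_on T v"
  shows "continuous_on T (\<lambda>t. frechet_derivative f (at (z t)) (v t))"
proof -
  have "frechet_derivative f (at (z t)) (v t)
      = (\<Sum>b\<in>Basis. (v t \<bullet> b) *\<^sub>R frechet_derivative f (at (z t)) b)" if "t \<in> T" for t
  proof -
    have "linear (frechet_derivative f (at (z t)))"
      using smooth_on_has_derivative[OF assms(1), of "z t"] that assms(3) has_derivative_linear by auto
    then show ?thesis
      by (rule linear_Basis_expansion)
  qed
  moreover have "continuous_on T (\<lambda>t. frechet_derivative f (at (z t)) b)" for b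
    by (rule continuous_on_compose2[OF
          smooth_on_continuous_on[OF smooth_on_derivative[OF assms(1)]] assms(2,3)])
  then have "continuous_on T (\<lambda>t. \<Sum>b\<in>Basis. (v t \<bullet> b) *\<^sub>R frechet_derivative f (at (z t)) b)"
    by (intro continuous_on_sum continuous_on_scaleR continuous_on_inner continuous_on_const assms(4))
  ultimately show ?thesis by (simp cong: continuous_on_cong)
qed

section \<open>Manifolds and smooth maps\<close>

text \<open>The weak notion of manifold that suffices for composing smooth maps; it makes no demand on transition maps.\<close>

definition charted :: "('a, 'e::euclidean_space) mfd \<Rightarrow> bool" where
  "charted M \<longleftrightarrow>
     (\<Union>c\<in>Atlas M. fst c) = pts M \<and>
     (\<forall>c\<in>Atlas M. openin (Top M) (fst c) \<and> inj_on (snd c) (fst c) \<and>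
        (\<forall>V. openin (Top M) V \<and> V \<subseteq> fst c \<longrightarrow> open (snd c ` V)))"

lemma chart_inv_left: "inj_on (snd c) (fst c) \<Longrightarrow> p \<in> fst c \<Longrightarrow> chart_inv c (snd c p) = p"
  by (simp add: chart_inv_def)

lemma charted_openin: "charted M \<Longrightarrow> c \<in> Atlas M \<Longrightarrow> openin (Top M) (fst c)"
  and charted_inj: "charted M \<Longrightarrow> c \<in> Atlas M \<Longrightarrow> inj_on (snd c) (fst c)"
  and charted_open_image:
    "charted M \<Longrightarrow> c \<in> Atlas M \<Longrightarrow> openin (Top M) V \<Longrightarrow> V \<subseteq> fst c \<Longrightarrow> open (snd c ` V)"
  unfolding charted_def by auto

lemma charted_left: "charted M \<Longrightarrow> c \<in> Atlas M \<Longrightarrow> p \<in> fst c \<Longrightarrow> chart_inv c (snd c p) = p"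
  by (rule chart_inv_left[OF charted_inj])

lemma charted_cover:
  assumes "charted M" "p \<in> pts M"
  obtains c where "c \<in> Atlas M" "p \<in> fst c"
  using assms unfolding charted_def by blast

lemma charted_subset: "charted M \<Longrightarrow> c \<in> Atlas M \<Longrightarrow> fst c \<subseteq> pts M"
  unfolding charted_def by blast

lemma is_chart_inj: "is_chart X c \<Longrightarrow> inj_on (snd c) (fst c)"
  unfolding is_chart_def using homeomorphic_imp_injective_map openin_subset
  by (metis topspace_subtopology_subset)

lemma smooth_manifold_charted:
  assumes "smooth_manifold M"
  shows "charted M"
proof -
  have "open (snd c ` V)" if c: "c \<in> Atlas M" and V: "openin (Top M) V" "V \<subseteq> fst c" for c V
  proof -
    have ch: "is_chart (Top M) c" using assms c by (auto simp: smooth_manifold_def)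
    then have "open_map (subtopology (Top M) (fst c)) (top_of_set (snd c ` fst c)) (snd c)"
      unfolding is_chart_def by (simp add: homeomorphic_imp_open_map)
    moreover have "openin (subtopology (Top M) (fst c)) V"
      using V by (metis inf.absorb1 openin_subtopology_Int)
    ultimately have "openin (top_of_set (snd c ` fst c)) (snd c ` V)"
      unfolding open_map_def by blast
    then show ?thesis using ch openin_open_trans unfolding is_chart_def by blast
  qed
  moreover have "openin (Top M) (fst c)" "inj_on (snd c) (fst c)" if "c \<in> Atlas M" for c
  proof -
    have "is_chart (Top M) c" using assms that by (simp add: smooth_manifold_def)
    then show "openin (Top M) (fst c)" "inj_on (snd c) (fst c)"
      using is_chart_inj by (blast intro: is_chart_def[THEN iffD1, THEN conjunct1])+
  qed
  ultimately show ?thesis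
    using assms by (simp add: charted_def smooth_manifold_def)
qed

lemma charted_preimage_open:
  assumes "charted M" "continuous_map (Top M) (Top N) f" "charted N" "c \<in> Atlas M" "d \<in> Atlas N"
  shows "openin (Top M) {p \<in> fst c. f p \<in> fst d}" "open (snd c ` {p \<in> fst c. f p \<in> fst d})"
proof -
  show "openin (Top M) {p \<in> fst c. f p \<in> fst d}"
    by (rule openin_continuous_map_preimage_gen[OF assms(2) charted_openin[OF assms(1,4)]
          charted_openin[OF assms(3,5)]])
  then show "open (snd c ` {p \<in> fst c. f p \<in> fst d})"
    by (intro charted_open_image[OF assms(1,4)]) auto
qed

lemma smooth_map_continuous: "smooth_map M N f \<Longrightarrow> continuous_map (Top M) (Top N) f"
  by (simp add: smooth_map_def)

lemma smooth_map_in_pts: "smooth_map M N f \<Longrightarrow> p \<in> pts M \<Longrightarrow> f p \<in> pts N"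
  using continuous_map_funspace[OF smooth_map_continuous] by blast

lemma smooth_map_charts:
  "smooth_map M N f \<Longrightarrow> c \<in> Atlas M \<Longrightarrow> d \<in> Atlas N \<Longrightarrow>
    smooth_on (snd d \<circ> f \<circ> chart_inv c) (snd c ` {p \<in> fst c. f p \<in> fst d})"
  by (simp add: smooth_map_def)

lemma smooth_map_compose:
  assumes L: "charted L" and M: "charted M" and N: "charted N"
    and f: "smooth_map L M f" and g: "smooth_map M N g"
  shows "smooth_map L N (g \<circ> f)"
  unfolding smooth_map_def
proof (intro conjI ballI)
  show cgf: "continuous_map (Top L) (Top N) (g \<circ> f)"
    using f g by (meson continuous_map_compose smooth_map_continuous)
  fix c e assume c: "c \<in> Atlas L" and e: "e \<in> Atlas N"
  show "smooth_on (snd e \<circ> (g \<circ> f) \<circ> chart_inv c) (snd c ` {p \<in> fst c. (g \<circ> f) p \<in> fst e})"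
  proof (rule smooth_on_local)
    fix x assume "x \<in> snd c ` {p \<in> fst c. (g \<circ> f) p \<in> fst e}"
    then obtain p where p: "p \<in> fst c" "g (f p) \<in> fst e" "x = snd c p" by auto
    have "f p \<in> pts M"
      using smooth_map_in_pts[OF f] charted_subset[OF L c] p(1) by blast
    then obtain d where d: "d \<in> Atlas M" "f p \<in> fst d" using charted_cover[OF M] by blast
    \<comment> \<open>On \<open>P\<close> the composite, read in the charts \<open>c\<close> and
      \<open>e\<close>, factors through the single chart \<open>d\<close> of the middle
      manifold.\<close>
    define P where "P = {p \<in> fst c. f p \<in> fst d} \<inter> {p \<in> fst c. (g \<circ> f) p \<in> fst e}"
    have P: "openin (Top L) P"
      unfolding P_def
      using charted_preimage_open(1)[OF L smooth_map_continuous[OF f] M c d(1)]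
        charted_preimage_open(1)[OF L cgf N c e] by blast
    then have oU: "open (snd c ` P)"
      by (rule charted_open_image[OF L c]) (auto simp: P_def)
    have oV: "open (snd d ` {q \<in> fst d. g q \<in> fst e})"
      by (rule charted_preimage_open(2)[OF M smooth_map_continuous[OF g] N d(1) e])
    have "smooth_on (\<lambda>y. (snd e \<circ> g \<circ> chart_inv d) ((snd d \<circ> f \<circ> chart_inv c) y)) (snd c ` P)"
    proof (rule smooth_on_compose[OF oU oV])
      show "(snd d \<circ> f \<circ> chart_inv c) ` snd c ` P \<subseteq> snd d ` {q \<in> fst d. g q \<in> fst e}"
        by (auto simp: P_def charted_left[OF L c])
      show "smooth_on (snd d \<circ> f \<circ> chart_inv c) (snd c ` P)"
        by (rule smooth_on_subset[OF smooth_map_charts[OF f c d(1)]]) (auto simp: P_def)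
    qed (rule smooth_map_charts[OF g d(1) e])
    then have "smooth_on (snd e \<circ> (g \<circ> f) \<circ> chart_inv c) (snd c ` P)"
      by (rule smooth_on_cong[OF oU, rotated])
        (auto simp: P_def charted_left[OF L c] charted_left[OF M d(1)])
    then show "\<exists>U. open U \<and> x \<in> U \<and> smooth_on (snd e \<circ> (g \<circ> f) \<circ> chart_inv c) U"
      using oU p d unfolding P_def by (intro exI[of _ "snd c ` P"]) (auto simp: P_def)
  qed
qed

lemma smooth_map_pair:
  assumes L: "charted L" and M: "charted M" and N: "charted N"
    and f: "smooth_map L M f" and g: "smooth_map L N g"
  shows "smooth_map L (prod_mfd M N) (\<lambda>x. (f x, g x))"
  unfolding smooth_map_def
proof (intro conjI ballI)
  show "continuous_map (Top L) (Top (prod_mfd M N)) (\<lambda>x. (f x, g x))"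
    using f g by (simp add: prod_mfd_def continuous_map_pairedI smooth_map_continuous)
  fix c de assume c: "c \<in> Atlas L" and "de \<in> Atlas (prod_mfd M N)"
  then obtain d e where de: "de = (fst d \<times> fst e, map_prod (snd d) (snd e))"
    and d: "d \<in> Atlas M" and e: "e \<in> Atlas N" by (auto simp: prod_mfd_def)
  define P where "P = {p \<in> fst c. f p \<in> fst d} \<inter> {p \<in> fst c. g p \<in> fst e}"
  have "openin (Top L) P"
    unfolding P_def
    using charted_preimage_open(1)[OF L smooth_map_continuous[OF f] M c d]
      charted_preimage_open(1)[OF L smooth_map_continuous[OF g] N c e] by blast
  then have oU: "open (snd c ` P)"
    by (rule charted_open_image[OF L c]) (auto simp: P_def)
  have "smooth_on (\<lambda>y. ((snd d \<circ> f \<circ> chart_inv c) y, (snd e \<circ> g \<circ> chart_inv c) y)) (snd c ` P)"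
    by (intro smooth_on_Pair oU smooth_on_subset[OF smooth_map_charts[OF f c d]]
        smooth_on_subset[OF smooth_map_charts[OF g c e]]) (auto simp: P_def)
  moreover have "(\<lambda>y. ((snd d \<circ> f \<circ> chart_inv c) y, (snd e \<circ> g \<circ> chart_inv c) y))
      = snd de \<circ> (\<lambda>x. (f x, g x)) \<circ> chart_inv c"
    by (auto simp: de)
  moreover have "P = {p \<in> fst c. (f p, g p) \<in> fst de}" by (auto simp: P_def de)
  ultimately show "smooth_on (snd de \<circ> (\<lambda>x. (f x, g x)) \<circ> chart_inv c)
      (snd c ` {p \<in> fst c. (f p, g p) \<in> fst de})" by simp
qed

lemma charted_prod:
  assumes M: "charted M" and N: "charted N"
  shows "charted (prod_mfd M N)"
proof -
  have "open (map_prod (snd d) (snd e) ` V)"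
    if d: "d \<in> Atlas M" and e: "e \<in> Atlas N" and V: "openin (prod_topology (Top M) (Top N)) V"
      and sub: "V \<subseteq> fst d \<times> fst e" for d e V
  proof (rule open_prod_intro)
    fix z assume "z \<in> map_prod (snd d) (snd e) ` V"
    then obtain p q where pq: "(p, q) \<in> V" "z = (snd d p, snd e q)" by auto
    then obtain A B where AB: "openin (Top M) A" "openin (Top N) B" "p \<in> A" "q \<in> B" "A \<times> B \<subseteq> V"
      using V unfolding openin_prod_topology_alt by meson
    then have "A \<subseteq> fst d" "B \<subseteq> fst e" using sub by blast+
    then have "open (snd d ` A)" "open (snd e ` B)"
      using AB charted_open_image[OF M d] charted_open_image[OF N e] by auto
    then show "\<exists>A B. open A \<and> open B \<and> z \<in> A \<times> B \<and> A \<times> B \<subseteq> map_prod (snd d) (snd e) ` V"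
      using AB pq by (intro exI[of _ "snd d ` A"] exI[of _ "snd e ` B"]) force
  qed
  moreover have "inj_on (map_prod (snd d) (snd e)) (fst d \<times> fst e)"
    if "d \<in> Atlas M" "e \<in> Atlas N" for d e
    using that charted_inj[OF M] charted_inj[OF N] by (intro map_prod_inj_on) auto
  moreover have "(\<Union>c\<in>Atlas (prod_mfd M N). fst c) = pts (prod_mfd M N)"
  proof -
    have "(\<Union>c\<in>Atlas (prod_mfd M N). fst c) = (\<Union>d\<in>Atlas M. fst d) \<times> (\<Union>e\<in>Atlas N. fst e)"
      unfolding prod_mfd_def by auto (metis fst_conv mem_Sigma_iff)
    then show ?thesis using M N by (simp add: charted_def prod_mfd_def)
  qed
  ultimately show ?thesis
    unfolding charted_def
    using charted_openin[OF M] charted_openin[OF N]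
    by (auto simp: prod_mfd_def openin_prod_Times_iff)
qed

lemma charted_open_submfd:
  assumes "charted M" "openin (Top M) W"
  shows "charted (open_submfd M W)"
proof -
  have "openin (Top M) V" if "openin (subtopology (Top M) W) V" for V
    using openin_trans_full[OF that assms(2)] .
  then show ?thesis
    using assms unfolding charted_def open_submfd_def
    by (auto simp: openin_subtopology_Int openin_Int intro: inj_on_subset)
qed

abbreviation euclidean_open :: "'e::euclidean_space set \<Rightarrow> ('e, 'e) mfd" where
  "euclidean_open U \<equiv> open_submfd euclidean_mfd U"

lemma euclidean_mfd_eq: "euclidean_mfd = euclidean_open UNIV"
  by (simp add: euclidean_mfd_def open_submfd_def)

lemma charted_euclidean_mfd: "charted euclidean_mfd"
  by (auto simp: charted_def euclidean_mfd_def)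

lemma charted_euclidean_open: "open U \<Longrightarrow> charted (euclidean_open U)"
  by (rule charted_open_submfd[OF charted_euclidean_mfd]) (simp add: euclidean_mfd_def)

lemma Top_euclidean_open [simp]: "Top (euclidean_open U) = top_of_set U"
  and Atlas_euclidean_open [simp]: "Atlas (euclidean_open U) = {(U, id)}"
  by (simp_all add: euclidean_mfd_def open_submfd_def)

lemma chart_inv_id: "y \<in> U \<Longrightarrow> chart_inv (U, id) y = y"
  by (simp add: chart_inv_def)

lemma smooth_map_euclidean_open_iff:
  assumes "open U" "charted M"
  shows "smooth_map (euclidean_open U) M f \<longleftrightarrow>
    continuous_map (top_of_set U) (Top M) f \<and>
    (\<forall>d\<in>Atlas M. smooth_on (\<lambda>u. snd d (f u)) {u\<in>U. f u \<in> fst d})"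
proof -
  have "smooth_on (snd d \<circ> f \<circ> chart_inv (U, id)) {u\<in>U. f u \<in> fst d}
      = smooth_on (\<lambda>u. snd d (f u)) {u\<in>U. f u \<in> fst d}"
    if "continuous_map (top_of_set U) (Top M) f" "d \<in> Atlas M" for d
  proof -
    have "open {u\<in>U. f u \<in> fst d}"
      using charted_preimage_open(2)[OF charted_euclidean_open[OF assms(1)] _ assms(2) _ that(2),
          of f "(U, id)"] that by simp
    then show ?thesis
      by (intro iffI; elim smooth_on_cong[rotated 2]) (auto simp: chart_inv_id)
  qed
  then show ?thesis unfolding smooth_map_def by auto
qed

lemma smooth_map_euclidean_euclidean_iff:
  assumes "open U" "open V"
  shows "smooth_map (euclidean_open U) (euclidean_open V) f \<longleftrightarrow> f ` U \<subseteq> V \<and> smooth_on f U"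
proof -
  have "{u \<in> U. f u \<in> V} = U" if "\<forall>x\<in>U. f x \<in> V" using that by auto
  then have "smooth_on f {u \<in> U. f u \<in> V} = smooth_on f U" if "\<forall>x\<in>U. f x \<in> V" using that by simp
  then show ?thesis
    using assms smooth_on_continuous_on[of f U]
    by (auto simp: smooth_map_euclidean_open_iff charted_euclidean_open continuous_map_in_subtopology
        image_subset_iff Pi_iff simp del: Collect_mem_eq)
qed

text \<open>This is where compatibility of charts enters: an inverse chart read in another chart is
  a transition map.\<close>

lemma smooth_map_chart_inv:
  assumes M: "smooth_manifold M" and c: "c \<in> Atlas M"
  shows "smooth_map (euclidean_open (snd c ` fst c)) M (chart_inv c)"
proof -
  have ch: "is_chart (Top M) c" using assms by (auto simp: smooth_manifold_def)
  then have op: "open (snd c ` fst c)" by (simp add: is_chart_def)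
  note CM = smooth_manifold_charted[OF M]
  have sub: "pts M \<inter> fst c = fst c" using charted_subset[OF CM c] by blast
  have "homeomorphic_map (subtopology (Top M) (fst c)) (top_of_set (snd c ` fst c)) (snd c)"
    using ch by (simp add: is_chart_def)
  then obtain g where g: "homeomorphic_maps (subtopology (Top M) (fst c)) (top_of_set (snd c ` fst c)) (snd c) g"
    by (meson homeomorphic_map_maps)
  then have cg: "continuous_map (top_of_set (snd c ` fst c)) (Top M) g"
    by (simp add: homeomorphic_maps_def continuous_map_in_subtopology)
  moreover from g have "g y = chart_inv c y" if "y \<in> snd c ` fst c" for y
    using that g charted_left[OF CM c] by (auto simp: homeomorphic_maps_def sub)
  ultimately have ct: "continuous_map (top_of_set (snd c ` fst c)) (Top M) (chart_inv c)"
    using continuous_map_eq[OF cg, of "chart_inv c"] by auto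
  have "smooth_on (\<lambda>u. snd d (chart_inv c u)) {u \<in> snd c ` fst c. chart_inv c u \<in> fst d}"
    if d: "d \<in> Atlas M" for d
  proof -
    have "{u \<in> snd c ` fst c. chart_inv c u \<in> fst d} = snd c ` (fst c \<inter> fst d)"
      using charted_left[OF CM c] by auto
    moreover have "smooth_on (snd d \<circ> chart_inv c) (snd c ` (fst c \<inter> fst d))"
      using M c d by (auto simp: smooth_manifold_def)
    ultimately show ?thesis by (simp add: o_def)
  qed
  then show ?thesis using ct by (simp add: smooth_map_euclidean_open_iff[OF op CM])
qed

lemma smooth_map_const:
  assumes L: "charted L" and M: "charted M" and p: "p \<in> pts M"
  shows "smooth_map L M (\<lambda>x. p)"
  unfolding smooth_map_def using p by (auto simp: o_def smooth_on_const)

lemma smooth_map_id: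
  assumes M: "smooth_manifold M"
  shows "smooth_map M M (\<lambda>x. x)"
proof -
  have "{p \<in> fst c. p \<in> fst d} = fst c \<inter> fst d" for c d :: "('a,'b) chart" by auto
  then show ?thesis using M unfolding smooth_map_def smooth_manifold_def by (simp add: o_def)
qed

lemma smooth_map_into_open_submfd:
  assumes M: "charted M" and N: "charted N" and f: "\<And>p. p \<in> pts M \<Longrightarrow> f p \<in> W"
  shows "smooth_map M (open_submfd N W) f \<longleftrightarrow> smooth_map M N f"
proof -
  have "{p \<in> fst c. f p \<in> fst d \<and> f p \<in> W} = {p \<in> fst c. f p \<in> fst d}" if "c \<in> Atlas M"
    for c and d :: "('c, 'd) chart"
    using charted_subset[OF M that] f by blast
  then show ?thesis
    using f unfolding smooth_map_def open_submfd_def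
    by (simp add: continuous_map_in_subtopology image_subset_iff Pi_iff cong: ball_cong)
qed

lemma smooth_map_open_submfdD:
  assumes "charted M" "charted N" "smooth_map M (open_submfd N W) f"
  shows "smooth_map M N f" "\<And>p. p \<in> pts M \<Longrightarrow> f p \<in> W"
proof -
  show W: "f p \<in> W" if "p \<in> pts M" for p
    using smooth_map_in_pts[OF assms(3) that] by (simp add: open_submfd_def)
  show "smooth_map M N f"
    using assms(3) smooth_map_into_open_submfd[where f=f, OF assms(1,2) W] by simp
qed

section \<open>Curves of class C1\<close>

lemma has_vector_derivative_chain:
  assumes "(z has_vector_derivative d) (at t within T)" "(F has_derivative F') (at (z t))"
  shows "((\<lambda>s. F (z s)) has_vector_derivative F' d) (at t within T)"
  using vector_derivative_diff_chain_within[OF assms(1) has_derivative_at_withinI[OF assms(2)]]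
  by (simp add: o_def)

lemma has_vector_derivative_eventually_cong:
  assumes "(f has_vector_derivative d) (at t within T)" "\<forall>\<^sub>F s in at t within T. f s = g s"
    "f t = g t" "t \<in> T"
  shows "(g has_vector_derivative d) (at t within T)"
  using assms has_derivative_transform_eventually unfolding has_vector_derivative_def by blast

lemma C1_curve_continuous: "C1_curve M a b \<gamma> \<Longrightarrow> continuous_map (top_of_set {a..b}) (Top M) \<gamma>"
  by (simp add: C1_curve_def)

lemma C1_curve_in_pts: "C1_curve M a b \<gamma> \<Longrightarrow> t \<in> {a..b} \<Longrightarrow> \<gamma> t \<in> pts M"
  using continuous_map_funspace[OF C1_curve_continuous[of M a b \<gamma>]] by auto

lemma C1_curve_chart:
  assumes "C1_curve M a b \<gamma>" "c \<in> Atlas M"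
  obtains D where "continuous_on {t \<in> {a..b}. \<gamma> t \<in> fst c} D"
    "\<And>t. t \<in> {a..b} \<Longrightarrow> \<gamma> t \<in> fst c \<Longrightarrow>
      ((\<lambda>s. snd c (\<gamma> s)) has_vector_derivative D t) (at t within {a..b})"
  using assms unfolding C1_curve_def o_def by blast

lemma curve_preimage_open:
  fixes a b t :: real
  assumes "continuous_map (top_of_set {a..b}) X \<gamma>" "openin X P" "t \<in> {a..b}" "\<gamma> t \<in> P"
  obtains J where "open J" "t \<in> J" "\<And>s. s \<in> J \<Longrightarrow> s \<in> {a..b} \<Longrightarrow> \<gamma> s \<in> P"
proof -
  have "openin (top_of_set {a..b}) {s \<in> {a..b}. \<gamma> s \<in> P}"
    using openin_continuous_map_preimage[OF assms(1,2)] by simp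
  then obtain J where "open J" "{s \<in> {a..b}. \<gamma> s \<in> P} = {a..b} \<inter> J"
    unfolding openin_open by blast
  then show thesis using that assms by blast
qed

lemma curve_limitin:
  fixes a b t :: real
  assumes "continuous_map (top_of_set {a..b}) X \<gamma>" "t \<in> {a..b}"
  shows "limitin X \<gamma> (\<gamma> t) (at t within {a..b})"
  unfolding limitin_def
proof (intro conjI allI impI)
  show "\<gamma> t \<in> topspace X" using continuous_map_funspace[OF assms(1)] assms(2) by auto
  fix U assume "openin X U \<and> \<gamma> t \<in> U"
  then obtain J where "open J" "t \<in> J" "\<And>s. s \<in> J \<Longrightarrow> s \<in> {a..b} \<Longrightarrow> \<gamma> s \<in> U"
    using curve_preimage_open[OF assms(1) _ assms(2)] by blast
  then show "\<forall>\<^sub>F s in at t within {a..b}. \<gamma> s \<in> U"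
    unfolding eventually_at_topological by blast
qed

text \<open>\<open>C1_curve\<close> demands one continuous derivative on the whole preimage of a
  chart domain. Derivatives within a nondegenerate interval are unique, so local candidates agree
  with \<open>vector_derivative\<close> and glue.\<close>

lemma C1_curve_localI:
  assumes "a < b" "continuous_map (top_of_set {a..b}) (Top M) \<gamma>"
    and loc: "\<And>c t. c \<in> Atlas M \<Longrightarrow> t \<in> {a..b} \<Longrightarrow> \<gamma> t \<in> fst c \<Longrightarrow>
      \<exists>J D. open J \<and> t \<in> J \<and> continuous_on (J \<inter> {a..b}) D \<and>
        (\<forall>s\<in>J \<inter> {a..b}. ((\<lambda>s. snd c (\<gamma> s)) has_vector_derivative D s) (at s within {a..b}))"
  shows "C1_curve M a b \<gamma>"
  unfolding C1_curve_def
proof (intro conjI ballI assms(2))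
  fix c assume c: "c \<in> Atlas M"
  define D where "D t = vector_derivative (\<lambda>s. snd c (\<gamma> s)) (at t within {a..b})" for t
  have nb: "at t within {a..b} \<noteq> bot" if "t \<in> {a..b}" for t
    using assms(1) that by (simp add: trivial_limit_within islimpt_Icc)
  have key: "((\<lambda>s. snd c (\<gamma> s)) has_vector_derivative D t) (at t within {a..b}) \<and>
      continuous (at t within {a..b}) D" if t: "t \<in> {a..b}" "\<gamma> t \<in> fst c" for t
  proof -
    obtain J D' where J: "open J" "t \<in> J" "continuous_on (J \<inter> {a..b}) D'"
      and D': "\<And>s. s \<in> J \<inter> {a..b} \<Longrightarrow> ((\<lambda>s. snd c (\<gamma> s)) has_vector_derivative D' s) (at s within {a..b})"
      using loc[OF c t] by auto
    have eq: "D s = D' s" if "s \<in> J \<inter> {a..b}" for s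
      unfolding D_def using vector_derivative_within[OF nb D'[OF that]] that by simp
    have "continuous_on (J \<inter> {a..b}) D" by (subst continuous_on_cong[OF refl eq]) (use J(3) in auto)
    then have "continuous (at t within J \<inter> {a..b}) D"
      using J(2) t by (simp add: continuous_on_eq_continuous_within)
    moreover have "at t within J \<inter> {a..b} = at t within {a..b}"
      by (rule at_within_nhd[OF J(2,1)]) auto
    ultimately show ?thesis using D'[of t] eq[of t] t J(2) by simp
  qed
  have "continuous_on {t \<in> {a..b}. \<gamma> t \<in> fst c} D"
    unfolding continuous_on_eq_continuous_within
  proof
    fix t assume "t \<in> {t \<in> {a..b}. \<gamma> t \<in> fst c}"
    then show "continuous (at t within {t \<in> {a..b}. \<gamma> t \<in> fst c}) D"
      using continuous_within_subset[of t "{a..b}" D "{t \<in> {a..b}. \<gamma> t \<in> fst c}"] key by blast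
  qed
  then show "\<exists>D. continuous_on {t \<in> {a..b}. \<gamma> t \<in> fst c} D \<and>
      (\<forall>t\<in>{a..b}. \<gamma> t \<in> fst c \<longrightarrow> ((snd c \<circ> \<gamma>) has_vector_derivative D t) (at t within {a..b}))"
    unfolding o_def using key by blast
qed

lemma C1_curve_smooth_map:
  assumes M: "charted M" and N: "charted N" and f: "smooth_map M N f"
    and \<gamma>: "C1_curve M a b \<gamma>" and ab: "a < b"
  shows "C1_curve N a b (\<lambda>t. f (\<gamma> t))"
proof (rule C1_curve_localI[OF ab])
  show "continuous_map (top_of_set {a..b}) (Top N) (\<lambda>t. f (\<gamma> t))"
    using continuous_map_compose[OF C1_curve_continuous[OF \<gamma>] smooth_map_continuous[OF f]]
    by (simp add: o_def)
  fix e t assume e: "e \<in> Atlas N" and t: "t \<in> {a..b}" "f (\<gamma> t) \<in> fst e"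
  obtain d where d: "d \<in> Atlas M" "\<gamma> t \<in> fst d"
    using charted_cover[OF M C1_curve_in_pts[OF \<gamma> t(1)]] by blast
  define P where "P = {p \<in> fst d. f p \<in> fst e}"
  define F where "F = snd e \<circ> f \<circ> chart_inv d"
  have P: "openin (Top M) P" and oP: "open (snd d ` P)" and F: "smooth_on F (snd d ` P)"
    unfolding P_def F_def
    using charted_preimage_open[OF M smooth_map_continuous[OF f] N d(1) e] smooth_map_charts[OF f d(1) e]
    by auto
  obtain J where J: "open J" "t \<in> J" "\<And>s. s \<in> J \<Longrightarrow> s \<in> {a..b} \<Longrightarrow> \<gamma> s \<in> P"
    using curve_preimage_open[OF C1_curve_continuous[OF \<gamma>] P t(1)] d t by (auto simp: P_def)
  obtain D where D: "continuous_on {t \<in> {a..b}. \<gamma> t \<in> fst d} D"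
    "\<And>t. t \<in> {a..b} \<Longrightarrow> \<gamma> t \<in> fst d \<Longrightarrow>
      ((\<lambda>s. snd d (\<gamma> s)) has_vector_derivative D t) (at t within {a..b})"
    using C1_curve_chart[OF \<gamma> d(1)] by blast
  define D' where "D' s = frechet_derivative F (at (snd d (\<gamma> s))) (D s)" for s
  have der: "((\<lambda>s. snd e (f (\<gamma> s))) has_vector_derivative D' s) (at s within {a..b})"
    if s: "s \<in> J \<inter> {a..b}" for s
  proof -
    have gs: "\<gamma> s \<in> P" using J s by blast
    then have "((\<lambda>s. snd d (\<gamma> s)) has_vector_derivative D s) (at s within {a..b})"
      using D(2) s by (auto simp: P_def)
    then have "((\<lambda>s. F (snd d (\<gamma> s))) has_vector_derivative D' s) (at s within {a..b})"
      unfolding D'_def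
      by (rule has_vector_derivative_chain) (rule smooth_on_has_derivative[OF F], use gs in blast)
    moreover have "\<forall>\<^sub>F s' in at s within {a..b}. F (snd d (\<gamma> s')) = snd e (f (\<gamma> s'))"
      unfolding eventually_at_topological using J s
      by (intro exI[of _ J]) (auto simp: F_def P_def charted_left[OF M d(1)])
    ultimately show ?thesis
      by (rule has_vector_derivative_eventually_cong)
        (use gs s in \<open>auto simp: F_def P_def charted_left[OF M d(1)]\<close>)
  qed
  have "continuous_on (J \<inter> {a..b}) D'"
    unfolding D'_def
  proof (rule continuous_on_frechet_derivative[OF F])
    show "continuous_on (J \<inter> {a..b}) D"
      by (rule continuous_on_subset[OF D(1)]) (use J in \<open>auto simp: P_def\<close>)
    have "continuous (at s within {a..b}) (\<lambda>s. snd d (\<gamma> s))" if "s \<in> J \<inter> {a..b}" for s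
      using D(2)[of s] J(3)[of s] that has_vector_derivative_continuous by (auto simp: P_def)
    then show "continuous_on (J \<inter> {a..b}) (\<lambda>s. snd d (\<gamma> s))"
      by (auto simp: continuous_on_eq_continuous_within intro: continuous_within_subset[of _ "{a..b}"])
  qed (use J in auto)
  then show "\<exists>J D. open J \<and> t \<in> J \<and> continuous_on (J \<inter> {a..b}) D \<and>
      (\<forall>s\<in>J \<inter> {a..b}. ((\<lambda>s. snd e (f (\<gamma> s))) has_vector_derivative D s) (at s within {a..b}))"
    using J(1,2) der by blast
qed

lemma C1_curve_pair:
  assumes "C1_curve M a b \<gamma>" "C1_curve N a b \<eta>"
  shows "C1_curve (prod_mfd M N) a b (\<lambda>t. (\<gamma> t, \<eta> t))"
  unfolding C1_curve_def
proof (intro conjI ballI)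
  show "continuous_map (top_of_set {a..b}) (Top (prod_mfd M N)) (\<lambda>t. (\<gamma> t, \<eta> t))"
    using assms by (simp add: prod_mfd_def continuous_map_pairedI C1_curve_continuous)
  fix de assume "de \<in> Atlas (prod_mfd M N)"
  then obtain d e where de: "de = (fst d \<times> fst e, map_prod (snd d) (snd e))"
    and d: "d \<in> Atlas M" and e: "e \<in> Atlas N" by (auto simp: prod_mfd_def)
  obtain D where D: "continuous_on {t \<in> {a..b}. \<gamma> t \<in> fst d} D"
    "\<And>t. t \<in> {a..b} \<Longrightarrow> \<gamma> t \<in> fst d \<Longrightarrow>
      ((\<lambda>s. snd d (\<gamma> s)) has_vector_derivative D t) (at t within {a..b})"
    using C1_curve_chart[OF assms(1) d] by blast
  obtain E where E: "continuous_on {t \<in> {a..b}. \<eta> t \<in> fst e} E"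
    "\<And>t. t \<in> {a..b} \<Longrightarrow> \<eta> t \<in> fst e \<Longrightarrow>
      ((\<lambda>s. snd e (\<eta> s)) has_vector_derivative E t) (at t within {a..b})"
    using C1_curve_chart[OF assms(2) e] by blast
  have "continuous_on {t \<in> {a..b}. \<gamma> t \<in> fst d \<and> \<eta> t \<in> fst e} (\<lambda>t. (D t, E t))"
    by (intro continuous_on_Pair continuous_on_subset[OF D(1)] continuous_on_subset[OF E(1)]) auto
  then show "\<exists>D. continuous_on {t \<in> {a..b}. (\<gamma> t, \<eta> t) \<in> fst de} D \<and>
      (\<forall>t\<in>{a..b}. (\<gamma> t, \<eta> t) \<in> fst de \<longrightarrow>
        ((snd de \<circ> (\<lambda>t. (\<gamma> t, \<eta> t))) has_vector_derivative D t) (at t within {a..b}))"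
    using D(2) E(2)
    by (intro exI[of _ "\<lambda>t. (D t, E t)"]) (auto simp: de o_def intro: has_vector_derivative_Pair)
qed

lemma C1_curve_euclidean_open:
  assumes "\<And>t. t \<in> {a..b} \<Longrightarrow> (z has_vector_derivative D t) (at t within {a..b})"
    and "continuous_on {a..b} D" "\<And>t. t \<in> {a..b} \<Longrightarrow> z t \<in> U"
  shows "C1_curve (euclidean_open U) a b z"
proof -
  have "continuous_on {a..b} z"
    using assms(1) has_vector_derivative_continuous continuous_on_eq_continuous_within by blast
  then show ?thesis
    using assms unfolding C1_curve_def
    by (auto simp: continuous_map_in_subtopology intro!: exI[of _ D] continuous_on_subset[OF assms(2)])
qed

lemma C1_curve_euclidean_openD:
  assumes "C1_curve (euclidean_open U) a b z"
  obtains D where "\<And>t. t \<in> {a..b} \<Longrightarrow> (z has_vector_derivative D t) (at t within {a..b})"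
    and "continuous_on {a..b} D"
proof -
  have U: "z t \<in> U" if "t \<in> {a..b}" for t using C1_curve_in_pts[OF assms that] by simp
  then have eq: "{t \<in> {a..b}. z t \<in> U} = {a..b}" by auto
  obtain D where "continuous_on {t \<in> {a..b}. z t \<in> U} D"
    "\<And>t. t \<in> {a..b} \<Longrightarrow> z t \<in> U \<Longrightarrow> (z has_vector_derivative D t) (at t within {a..b})"
    using C1_curve_chart[OF assms, of "(U, id)"] by auto
  then show thesis using that[of D] U unfolding eq by blast
qed

lemma C1_curve_open_submfd:
  assumes "C1_curve M a b \<gamma>" "\<And>t. t \<in> {a..b} \<Longrightarrow> \<gamma> t \<in> W"
  shows "C1_curve (open_submfd M W) a b \<gamma>"
proof -
  have "{t \<in> {a..b}. \<gamma> t \<in> fst c \<inter> W} = {t \<in> {a..b}. \<gamma> t \<in> fst c}" for c :: "('a,'b) chart"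
    using assms(2) by blast
  then show ?thesis
    using assms unfolding C1_curve_def open_submfd_def
    by (auto simp: continuous_map_in_subtopology)
qed

lemma C1_curve_cong:
  assumes \<gamma>: "C1_curve M a b \<gamma>" and eq: "\<And>t. t \<in> {a..b} \<Longrightarrow> \<gamma> t = \<eta> t"
  shows "C1_curve M a b \<eta>"
  unfolding C1_curve_def
proof (intro conjI ballI)
  show "continuous_map (top_of_set {a..b}) (Top M) \<eta>"
    by (rule continuous_map_eq[OF C1_curve_continuous[OF \<gamma>]]) (simp add: eq)
  fix c assume "c \<in> Atlas M"
  then obtain D where D: "continuous_on {t \<in> {a..b}. \<gamma> t \<in> fst c} D"
    "\<And>t. t \<in> {a..b} \<Longrightarrow> \<gamma> t \<in> fst c \<Longrightarrow>
      ((\<lambda>s. snd c (\<gamma> s)) has_vector_derivative D t) (at t within {a..b})"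
    using C1_curve_chart[OF \<gamma>] by blast
  have set_eq: "{t \<in> {a..b}. \<eta> t \<in> fst c} = {t \<in> {a..b}. \<gamma> t \<in> fst c}" using eq by auto
  have "((snd c \<circ> \<eta>) has_vector_derivative D t) (at t within {a..b})"
    if t: "t \<in> {a..b}" "\<eta> t \<in> fst c" for t
    by (rule has_vector_derivative_transform[OF t(1) _ D(2)[OF t(1)]]) (use t eq in auto)
  then show "\<exists>D. continuous_on {t \<in> {a..b}. \<eta> t \<in> fst c} D \<and>
      (\<forall>t\<in>{a..b}. \<eta> t \<in> fst c \<longrightarrow> ((snd c \<circ> \<eta>) has_vector_derivative D t) (at t within {a..b}))"
    unfolding set_eq using D(1) by blast
qed

lemma C1_curve_subinterval:
  assumes "C1_curve M a b \<gamma>" "a \<le> c" "d \<le> b"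
  shows "C1_curve M c d \<gamma>"
  unfolding C1_curve_def
proof (intro conjI ballI)
  have sub: "{c..d} \<subseteq> {a..b}" using assms by auto
  show "continuous_map (top_of_set {c..d}) (Top M) \<gamma>"
    using C1_curve_continuous[OF assms(1)] continuous_map_from_subtopology_mono sub by blast
  fix k assume "k \<in> Atlas M"
  then obtain D where D: "continuous_on {t \<in> {a..b}. \<gamma> t \<in> fst k} D"
    "\<And>t. t \<in> {a..b} \<Longrightarrow> \<gamma> t \<in> fst k \<Longrightarrow>
      ((\<lambda>s. snd k (\<gamma> s)) has_vector_derivative D t) (at t within {a..b})"
    using C1_curve_chart[OF assms(1)] by blast
  have "continuous_on {t \<in> {c..d}. \<gamma> t \<in> fst k} D"
    by (rule continuous_on_subset[OF D(1)]) (use sub in auto)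
  moreover have "((\<lambda>s. snd k (\<gamma> s)) has_vector_derivative D t) (at t within {c..d})"
    if "t \<in> {c..d}" "\<gamma> t \<in> fst k" for t
    using has_vector_derivative_within_subset[OF D(2) sub] that sub by blast
  ultimately show "\<exists>D. continuous_on {t \<in> {c..d}. \<gamma> t \<in> fst k} D \<and>
      (\<forall>t\<in>{c..d}. \<gamma> t \<in> fst k \<longrightarrow> ((snd k \<circ> \<gamma>) has_vector_derivative D t) (at t within {c..d}))"
    by (auto simp: o_def)
qed

section \<open>Tangent vectors and logarithmic derivatives on a Lie group\<close>

locale lie_grp =
  fixes G :: "('k, 'z) monoid_scheme" (structure) and K :: "('k, 'g::euclidean_space) mfd"
  assumes lie: "lie_group G K"
begin

sublocale group G
  using lie by (simp add: lie_group_def)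

lemma smooth_K: "smooth_manifold K"
  and pts_K: "pts K = carrier G"
  and smooth_map_mult: "smooth_map (prod_mfd K K) K (\<lambda>(g, h). g \<otimes> h)"
  and smooth_map_inv: "smooth_map K K (\<lambda>g. inv g)"
  using lie by (simp_all add: lie_group_def)

lemma charted_K: "charted K"
  using smooth_K by (rule smooth_manifold_charted)

abbreviation c1 :: "('k, 'g) chart" where "c1 \<equiv> chart_at K \<one>"
abbreviation \<kappa> :: "'k \<Rightarrow> 'g" where "\<kappa> \<equiv> coord K \<one>"
abbreviation \<kappa>' :: "'g \<Rightarrow> 'k" where "\<kappa>' \<equiv> coord_inv K \<one>"

lemma chart_at_K:
  assumes "g \<in> carrier G"
  shows "chart_at K g \<in> Atlas K" "g \<in> fst (chart_at K g)"
proof -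
  have "\<exists>c. c \<in> Atlas K \<and> g \<in> fst c"
    using charted_cover[OF charted_K] assms pts_K by metis
  then have "chart_at K g \<in> Atlas K \<and> g \<in> fst (chart_at K g)"
    unfolding chart_at_def by (rule someI_ex)
  then show "chart_at K g \<in> Atlas K" "g \<in> fst (chart_at K g)" by auto
qed

lemmas c1 = chart_at_K[OF one_closed]

lemma openin_c1: "openin (Top K) (fst c1)"
  by (rule charted_openin[OF charted_K c1(1)])

lemma c1_carrier: "fst c1 \<subseteq> carrier G"
  using charted_subset[OF charted_K c1(1)] pts_K by simp

lemma \<kappa>'_\<kappa>: "g \<in> fst c1 \<Longrightarrow> \<kappa>' (\<kappa> g) = g"
  unfolding coord_def coord_inv_def by (rule charted_left[OF charted_K c1(1)])

lemma open_\<kappa>: "open (\<kappa> ` fst c1)"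
  unfolding coord_def by (rule charted_open_image[OF charted_K c1(1) openin_c1 order_refl])

lemma smooth_\<kappa>': "smooth_map (euclidean_open (\<kappa> ` fst c1)) K \<kappa>'"
  unfolding coord_def coord_inv_def by (rule smooth_map_chart_inv[OF smooth_K c1(1)])

lemma smooth_mult:
  assumes L: "charted L" and "smooth_map L K f" "smooth_map L K h"
  shows "smooth_map L K (\<lambda>x. f x \<otimes> h x)"
proof -
  have "smooth_map L K ((\<lambda>(g, h). g \<otimes> h) \<circ> (\<lambda>x. (f x, h x)))"
    by (rule smooth_map_compose[OF L charted_prod[OF charted_K charted_K] charted_K
          smooth_map_pair[OF L charted_K charted_K assms(2,3)] smooth_map_mult])
  then show ?thesis by (simp add: o_def)
qed

lemma smooth_inv:
  assumes L: "charted L" and "smooth_map L K f"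
  shows "smooth_map L K (\<lambda>x. inv (f x))"
  using smooth_map_compose[OF L charted_K charted_K assms(2) smooth_map_inv] by (simp add: o_def)

lemma smooth_const: "charted L \<Longrightarrow> g \<in> carrier G \<Longrightarrow> smooth_map L K (\<lambda>x. g)"
  by (rule smooth_map_const[OF _ charted_K]) (simp_all add: pts_K)

lemmas smooth_id = smooth_map_id[OF smooth_K]

lemma smooth_conj: "g \<in> carrier G \<Longrightarrow> smooth_map K K (\<lambda>h. g \<otimes> h \<otimes> inv g)"
  by (intro smooth_mult smooth_const smooth_id charted_K) auto

lemma smooth_\<kappa>:
  assumes "open U" "smooth_map (euclidean_open U) K f"
  shows "smooth_on (\<lambda>u. \<kappa> (f u)) {u \<in> U. f u \<in> fst c1}" "open {u \<in> U. f u \<in> fst c1}"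
proof -
  show "smooth_on (\<lambda>u. \<kappa> (f u)) {u \<in> U. f u \<in> fst c1}"
    using assms(2) c1(1) by (auto simp: smooth_map_euclidean_open_iff[OF assms(1) charted_K] coord_def)
  show "open {u \<in> U. f u \<in> fst c1}"
    using charted_preimage_open(2)[OF charted_euclidean_open[OF assms(1)]
        smooth_map_continuous[OF assms(2)] charted_K _ c1(1), of "(U, id)"] by simp
qed

lemma smooth_precompose:
  fixes z :: "'u::euclidean_space \<Rightarrow> 'v::euclidean_space"
  assumes "open U" "open V" "smooth_map (euclidean_open V) K f" "smooth_on z U" "z ` U \<subseteq> V"
  shows "smooth_map (euclidean_open U) K (\<lambda>u. f (z u))"
  using smooth_map_compose[OF charted_euclidean_open[OF assms(1)] charted_euclidean_open[OF assms(2)]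
      charted_K _ assms(3), of z] assms
  by (simp add: smooth_map_euclidean_euclidean_iff o_def)

lemma limitin_K_mult:
  assumes "limitin (Top K) F g F'" "limitin (Top K) H h F'"
  shows "limitin (Top K) (\<lambda>s. F s \<otimes> H s) (g \<otimes> h) F'"
proof -
  have "limitin (prod_topology (Top K) (Top K)) (\<lambda>s. (F s, H s)) (g, h) F'"
    using assms by (simp add: limitin_pairwise o_def)
  from continuous_map_limit[OF _ this, of "Top K" "\<lambda>(g, h). g \<otimes> h"] smooth_map_mult
  show ?thesis by (simp add: smooth_map_def prod_mfd_def o_def)
qed

lemma limitin_K_const: "g \<in> carrier G \<Longrightarrow> limitin (Top K) (\<lambda>s. g) g F'"
  by (simp add: pts_K)

text \<open>All velocities are measured in the one chart around \<one>. The separate limit condition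
  is essential: off its domain the coordinate map is arbitrary, so a derivative of
  \<open>\<kappa> (F s)\<close> alone would not force \<open>F\<close> to stay near \<one>.\<close>

definition tangent :: "(real \<Rightarrow> 'k) \<Rightarrow> real \<Rightarrow> real set \<Rightarrow> 'g \<Rightarrow> bool" where
  "tangent F t T x \<longleftrightarrow> t \<in> T \<and> F t = \<one> \<and> limitin (Top K) F \<one> (at t within T) \<and>
     ((\<lambda>s. \<kappa> (F s)) has_vector_derivative x) (at t within T)"

lemma tangent_cong:
  assumes "tangent F t T x" "\<forall>\<^sub>F s in at t within T. F s = H s" "F t = H t"
  shows "tangent H t T x"
proof -
  have "\<forall>\<^sub>F s in at t within T. \<kappa> (F s) = \<kappa> (H s)"
    using assms(2) by eventually_elim simp
  then show ?thesis
    using assms limitin_transform_eventually[OF assms(2)]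
    by (auto simp: tangent_def elim: has_vector_derivative_eventually_cong)
qed

lemma tangent_unique:
  assumes "tangent F t T x" "tangent F t T y" "at t within T \<noteq> bot"
  shows "x = y"
  using assms vector_derivative_unique_within unfolding tangent_def by blast

lemma tangent_near: "tangent F t T x \<Longrightarrow> \<forall>\<^sub>F s in at t within T. F s \<in> fst c1"
  unfolding tangent_def using limitinD[OF _ openin_c1 c1(2)] by blast

lemma tangent_chain:
  assumes F: "tangent F t T x" and h: "((\<lambda>a. h (\<kappa>' a)) has_derivative h') (at (\<kappa> \<one>))"
  shows "((\<lambda>s. h (F s)) has_vector_derivative h' x) (at t within T)"
proof (rule has_vector_derivative_eventually_cong)
  show "((\<lambda>s. h (\<kappa>' (\<kappa> (F s)))) has_vector_derivative h' x) (at t within T)"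
    by (rule has_vector_derivative_chain[where F="\<lambda>a. h (\<kappa>' a)"]) (use F h in \<open>auto simp: tangent_def\<close>)
  show "\<forall>\<^sub>F s in at t within T. h (\<kappa>' (\<kappa> (F s))) = h (F s)"
    using tangent_near[OF F] by eventually_elim (simp add: \<kappa>'_\<kappa>)
qed (use F c1 in \<open>auto simp: tangent_def \<kappa>'_\<kappa>\<close>)

lemma tangent_map:
  assumes F: "tangent F t T x" and h: "smooth_map K K h" "h \<one> = \<one>"
  shows "tangent (\<lambda>s. h (F s)) t T (differential K K h \<one> x)"
proof -
  have "smooth_map (euclidean_open (\<kappa> ` fst c1)) K (\<lambda>a. h (\<kappa>' a))"
    using smooth_map_compose[OF charted_euclidean_open[OF open_\<kappa>] charted_K charted_K smooth_\<kappa>' h(1)]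
    by (simp add: o_def)
  note smooth_\<kappa>(1)[OF open_\<kappa> this]
  then have "((\<lambda>a. \<kappa> (h (\<kappa>' a))) has_derivative frechet_derivative (\<lambda>a. \<kappa> (h (\<kappa>' a))) (at (\<kappa> \<one>))) (at (\<kappa> \<one>))"
    by (rule smooth_on_has_derivative) (use c1 in \<open>auto simp: \<kappa>'_\<kappa> h(2)\<close>)
  moreover have "frechet_derivative (\<lambda>a. \<kappa> (h (\<kappa>' a))) (at (\<kappa> \<one>)) = differential K K h \<one>"
    by (simp add: differential_def h(2) o_def)
  ultimately have "((\<lambda>s. \<kappa> (h (F s))) has_vector_derivative differential K K h \<one> x) (at t within T)"
    using tangent_chain[OF F, of "\<lambda>g. \<kappa> (h g)"] by simp
  moreover have "limitin (Top K) (\<lambda>s. h (F s)) \<one> (at t within T)"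
    using continuous_map_limit[OF smooth_map_continuous[OF h(1)], of F \<one>] F h(2)
    by (simp add: tangent_def o_def)
  ultimately show ?thesis using F h(2) by (simp add: tangent_def)
qed

lemma tangent_const: "t \<in> T \<Longrightarrow> tangent (\<lambda>s. \<one>) t T 0"
  by (simp add: tangent_def pts_K)

text \<open>Provides a curve with any prescribed velocity, so that identities between differentials
  at \<one> can be checked on curves.\<close>

lemma tangent_line: "tangent (\<lambda>s. \<kappa>' (\<kappa> \<one> + s *\<^sub>R u)) 0 UNIV u"
proof -
  let ?z = "\<lambda>s::real. \<kappa> \<one> + s *\<^sub>R u"
  have z: "(?z has_vector_derivative u) (at 0)"
    by (auto intro!: derivative_eq_intros)
  have "(?z \<longlongrightarrow> ?z 0) (at 0)" by (intro tendsto_intros)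
  then have lim: "(?z \<longlongrightarrow> \<kappa> \<one>) (at 0)" by simp
  have in1: "\<kappa> \<one> \<in> \<kappa> ` fst c1" using c1 by blast
  have "limitin (top_of_set (\<kappa> ` fst c1)) ?z (\<kappa> \<one>) (at 0)"
    using lim in1 by (simp add: open_\<kappa>)
  from continuous_map_limit[OF _ this] smooth_map_continuous[OF smooth_\<kappa>']
  have l: "limitin (Top K) (\<lambda>s. \<kappa>' (?z s)) \<one> (at 0)"
    using \<kappa>'_\<kappa>[OF c1(2)] by (fastforce simp: o_def)
  have "\<forall>\<^sub>F s in at 0. ?z s \<in> \<kappa> ` fst c1"
    using topological_tendstoD[OF lim open_\<kappa> in1] .
  then have ev: "\<forall>\<^sub>F s in at 0. ?z s = \<kappa> (\<kappa>' (?z s))"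
    by eventually_elim (auto simp: \<kappa>'_\<kappa>)
  have "((\<lambda>s. \<kappa> (\<kappa>' (?z s))) has_vector_derivative u) (at 0)"
    by (rule has_vector_derivative_eventually_cong[OF z ev]) (simp_all add: \<kappa>'_\<kappa>[OF c1(2)])
  then show ?thesis using l \<kappa>'_\<kappa>[OF c1(2)] by (simp add: tangent_def)
qed

text \<open>By linearity the two coordinate axes suffice, and on each of them one factor is \<one>,
  so that multiplication is the identity.\<close>

lemma mult_derivative:
  "((\<lambda>p. \<kappa> (\<kappa>' (fst p) \<otimes> \<kappa>' (snd p))) has_derivative (\<lambda>p. fst p + snd p)) (at (\<kappa> \<one>, \<kappa> \<one>))"
proof -
  let ?V = "\<kappa> ` fst c1" and ?m = "\<lambda>p. \<kappa> (\<kappa>' (fst p) \<otimes> \<kappa>' (snd p))"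
  let ?m' = "frechet_derivative ?m (at (\<kappa> \<one>, \<kappa> \<one>))"
  have oV: "open (?V \<times> ?V)" by (intro open_Times open_\<kappa>)
  have "smooth_map (euclidean_open (?V \<times> ?V)) K (\<lambda>p. \<kappa>' (fst p) \<otimes> \<kappa>' (snd p))"
    by (intro smooth_mult charted_euclidean_open oV smooth_precompose[OF oV open_\<kappa> smooth_\<kappa>']
        smooth_on_bounded_linear bounded_linear_fst bounded_linear_snd) auto
  from smooth_\<kappa>(1)[OF oV this]
  have d: "(?m has_derivative ?m') (at (\<kappa> \<one>, \<kappa> \<one>))"
    by (rule smooth_on_has_derivative) (use c1 in \<open>auto simp: \<kappa>'_\<kappa>\<close>)
  have near: "\<forall>\<^sub>F s in at 0. \<kappa>' (\<kappa> \<one> + s *\<^sub>R u) \<in> fst c1" for u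
    using tangent_near[OF tangent_line] by simp
  have 1: "?m' (u, 0) = u" for u
  proof -
    let ?z = "\<lambda>s::real. (\<kappa> \<one> + s *\<^sub>R u, \<kappa> \<one>)"
    have "(?z has_vector_derivative (u, 0)) (at 0)"
      by (auto intro!: derivative_eq_intros has_vector_derivative_Pair)
    then have "((\<lambda>s. ?m (?z s)) has_vector_derivative ?m' (u, 0)) (at 0)"
      by (rule has_vector_derivative_chain) (use d in simp)
    then have "((\<lambda>s. \<kappa> (\<kappa>' (\<kappa> \<one> + s *\<^sub>R u))) has_vector_derivative ?m' (u, 0)) (at 0)"
      by (rule has_vector_derivative_eventually_cong)
        (use near[of u] c1 c1_carrier in \<open>auto elim!: eventually_mono simp: \<kappa>'_\<kappa>\<close>)
    then show ?thesis
      using tangent_line[of u] vector_derivative_unique_at unfolding tangent_def by blast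
  qed
  have 2: "?m' (0, u) = u" for u
  proof -
    let ?z = "\<lambda>s::real. (\<kappa> \<one>, \<kappa> \<one> + s *\<^sub>R u)"
    have "(?z has_vector_derivative (0, u)) (at 0)"
      by (auto intro!: derivative_eq_intros has_vector_derivative_Pair)
    then have "((\<lambda>s. ?m (?z s)) has_vector_derivative ?m' (0, u)) (at 0)"
      by (rule has_vector_derivative_chain) (use d in simp)
    then have "((\<lambda>s. \<kappa> (\<kappa>' (\<kappa> \<one> + s *\<^sub>R u))) has_vector_derivative ?m' (0, u)) (at 0)"
      by (rule has_vector_derivative_eventually_cong)
        (use near[of u] c1 c1_carrier in \<open>auto elim!: eventually_mono simp: \<kappa>'_\<kappa>\<close>)
    then show ?thesis
      using tangent_line[of u] vector_derivative_unique_at unfolding tangent_def by blast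
  qed
  have "?m' p = fst p + snd p" for p
  proof -
    have "?m' ((fst p, 0) + (0, snd p)) = ?m' (fst p, 0) + ?m' (0, snd p)"
      by (rule linear_add[OF has_derivative_linear[OF d]])
    then show ?thesis by (simp add: 1 2)
  qed
  then have "?m' = (\<lambda>p. fst p + snd p)" by (rule ext)
  then show ?thesis using d by simp
qed

lemma tangent_mult:
  assumes F: "tangent F t T x" and H: "tangent H t T y"
  shows "tangent (\<lambda>s. F s \<otimes> H s) t T (x + y)"
proof -
  let ?m = "\<lambda>p. \<kappa> (\<kappa>' (fst p) \<otimes> \<kappa>' (snd p))"
  have "((\<lambda>s. (\<kappa> (F s), \<kappa> (H s))) has_vector_derivative (x, y)) (at t within T)"
    using assms by (intro has_vector_derivative_Pair) (auto simp: tangent_def)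
  then have "((\<lambda>s. ?m (\<kappa> (F s), \<kappa> (H s))) has_vector_derivative (fst (x, y) + snd (x, y))) (at t within T)"
    by (rule has_vector_derivative_chain) (use mult_derivative assms in \<open>auto simp: tangent_def\<close>)
  moreover have "\<forall>\<^sub>F s in at t within T. ?m (\<kappa> (F s), \<kappa> (H s)) = \<kappa> (F s \<otimes> H s)"
    using tangent_near[OF F] tangent_near[OF H] by eventually_elim (simp add: \<kappa>'_\<kappa>)
  ultimately have "((\<lambda>s. \<kappa> (F s \<otimes> H s)) has_vector_derivative (fst (x, y) + snd (x, y))) (at t within T)"
    by (rule has_vector_derivative_eventually_cong) (use assms c1 in \<open>auto simp: tangent_def \<kappa>'_\<kappa>\<close>)
  moreover have "limitin (Top K) (\<lambda>s. F s \<otimes> H s) (\<one> \<otimes> \<one>) (at t within T)"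
    using assms by (intro limitin_K_mult) (auto simp: tangent_def)
  ultimately show ?thesis using assms by (simp add: tangent_def)
qed

text \<open>Obtained by differentiating \<open>F s \<otimes> inv (F s) = \<one>\<close> with the
  product rule.\<close>

lemma differential_inv: "differential K K (\<lambda>g. inv g) \<one> x = - x"
proof -
  let ?F = "\<lambda>s. \<kappa>' (\<kappa> \<one> + s *\<^sub>R x)"
  have i: "tangent (\<lambda>s. inv (?F s)) 0 UNIV (differential K K (\<lambda>g. inv g) \<one> x)"
    by (rule tangent_map[OF tangent_line smooth_map_inv]) simp
  have "tangent (\<lambda>s. ?F s \<otimes> inv (?F s)) 0 UNIV (x + differential K K (\<lambda>g. inv g) \<one> x)"
    by (rule tangent_mult[OF tangent_line i])
  then have "tangent (\<lambda>s. \<one>) 0 UNIV (x + differential K K (\<lambda>g. inv g) \<one> x)"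
    by (rule tangent_cong)
      (use tangent_near[OF tangent_line[of x]] c1_carrier c1 in
        \<open>auto elim!: eventually_mono simp: \<kappa>'_\<kappa> subset_eq\<close>)
  then have "x + differential K K (\<lambda>g. inv g) \<one> x = 0"
    using tangent_unique[OF _ tangent_const] by fastforce
  then show ?thesis by (simp add: eq_neg_iff_add_eq_0 add.commute)
qed

lemma tangent_inv: "tangent F t T x \<Longrightarrow> tangent (\<lambda>s. inv (F s)) t T (- x)"
  using tangent_map[OF _ smooth_map_inv] by (simp add: differential_inv)

lemma tangent_conj:
  assumes "g \<in> carrier G" "tangent F t T x"
  shows "tangent (\<lambda>s. g \<otimes> F s \<otimes> inv g) t T (Ad G K g x)"
  unfolding Ad_def by (rule tangent_map[OF assms(2) smooth_conj[OF assms(1)]]) (simp add: assms(1))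

lemma linear_Ad:
  assumes g: "g \<in> carrier G"
  shows "linear (Ad G K g)"
proof -
  let ?h = "\<lambda>h. g \<otimes> h \<otimes> inv g"
  have "smooth_map (euclidean_open (\<kappa> ` fst c1)) K (\<lambda>a. ?h (\<kappa>' a))"
    using smooth_map_compose[OF charted_euclidean_open[OF open_\<kappa>] charted_K charted_K smooth_\<kappa>' smooth_conj[OF g]]
    by (simp add: o_def)
  from smooth_on_has_derivative[OF smooth_\<kappa>(1)[OF open_\<kappa> this], of "\<kappa> \<one>"]
  have "linear (frechet_derivative (\<lambda>a. \<kappa> (?h (\<kappa>' a))) (at (\<kappa> \<one>)))"
    using c1 g by (auto simp: \<kappa>'_\<kappa> dest: has_derivative_linear)
  then show ?thesis using g by (simp add: Ad_def differential_def o_def)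
qed

lemma Ad_eqI:
  assumes "g \<in> carrier G" "tangent F 0 UNIV x" "tangent (\<lambda>s. g \<otimes> F s \<otimes> inv g) 0 UNIV y"
  shows "Ad G K g x = y"
  using tangent_unique[OF tangent_conj[OF assms(1,2)] assms(3)] by simp

lemma Ad_one: "Ad G K \<one> x = x"
proof (rule Ad_eqI[OF one_closed tangent_line])
  show "tangent (\<lambda>s. \<one> \<otimes> \<kappa>' (\<kappa> \<one> + s *\<^sub>R x) \<otimes> inv \<one>) 0 UNIV x"
    by (rule tangent_cong[OF tangent_line])
      (use tangent_near[OF tangent_line[of x]] c1_carrier c1 in
        \<open>auto elim!: eventually_mono simp: \<kappa>'_\<kappa> subset_eq\<close>)
qed

lemma Ad_mult:
  assumes "g \<in> carrier G" "h \<in> carrier G"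
  shows "Ad G K (g \<otimes> h) x = Ad G K g (Ad G K h x)"
proof (rule Ad_eqI[OF _ tangent_line])
  have cancel: "h \<otimes> (inv h \<otimes> inv g) = inv g"
    using assms by (simp add: m_assoc[symmetric])
  show "tangent (\<lambda>s. g \<otimes> h \<otimes> \<kappa>' (\<kappa> \<one> + s *\<^sub>R x) \<otimes> inv (g \<otimes> h)) 0 UNIV (Ad G K g (Ad G K h x))"
    by (rule tangent_cong[OF tangent_conj[OF assms(1) tangent_conj[OF assms(2) tangent_line]]])
      (use tangent_near[OF tangent_line[of x]] c1_carrier c1 assms in
        \<open>auto elim!: eventually_mono simp: \<kappa>'_\<kappa> subset_eq m_assoc inv_mult_group cancel\<close>)
qed (use assms in simp)

lemma Ad_inv_left: "g \<in> carrier G \<Longrightarrow> Ad G K (inv g) (Ad G K g x) = x"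
  and Ad_inv_right: "g \<in> carrier G \<Longrightarrow> Ad G K g (Ad G K (inv g) x) = x"
  by (simp_all add: Ad_mult[symmetric] Ad_one)

end

section \<open>Right logarithmic derivatives and the Maurer-Cartan form\<close>

context lie_grp
begin

lemma tangent_cong_on: "tangent F t T x \<Longrightarrow> (\<And>s. s \<in> T \<Longrightarrow> F s = H s) \<Longrightarrow> tangent H t T x"
  by (frule tangent_cong[where H=H]) (auto simp: eventually_at_filter tangent_def)

lemma tangent_subset:
  assumes "tangent F t T x" "T' \<subseteq> T" "t \<in> T'"
  shows "tangent F t T' x"
proof -
  have "at t within T' \<le> at t within T" by (rule at_le[OF assms(2)])
  then have "limitin (Top K) F \<one> (at t within T')"
    using assms(1) unfolding tangent_def limitin_def by (meson filter_leD)
  then show ?thesis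
    using assms has_vector_derivative_within_subset unfolding tangent_def by blast
qed

text \<open>The quotient \<open>\<gamma> s \<otimes> inv (\<gamma> t)\<close> already passes through
  \<one> at time \<open>t\<close>, so no change of charts between tangent spaces is needed. The set
  \<open>T\<close> permits one-sided derivatives at end points.\<close>

definition has_rld :: "(real \<Rightarrow> 'k) \<Rightarrow> 'g \<Rightarrow> real \<Rightarrow> real set \<Rightarrow> bool" where
  "has_rld \<gamma> x t T \<longleftrightarrow> (\<forall>s\<in>T. \<gamma> s \<in> carrier G) \<and> tangent (\<lambda>s. \<gamma> s \<otimes> inv (\<gamma> t)) t T x"

lemma has_rld_carrier: "has_rld \<gamma> x t T \<Longrightarrow> s \<in> T \<Longrightarrow> \<gamma> s \<in> carrier G"
  and has_rld_mem: "has_rld \<gamma> x t T \<Longrightarrow> t \<in> T"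
  by (auto simp: has_rld_def tangent_def)

lemma has_rld_unique:
  "has_rld \<gamma> x t T \<Longrightarrow> has_rld \<gamma> y t T \<Longrightarrow> at t within T \<noteq> bot \<Longrightarrow> x = y"
  unfolding has_rld_def using tangent_unique by blast

lemma has_rld_subset: "has_rld \<gamma> x t T \<Longrightarrow> T' \<subseteq> T \<Longrightarrow> t \<in> T' \<Longrightarrow> has_rld \<gamma> x t T'"
  unfolding has_rld_def using tangent_subset by blast

lemma has_rld_cong: "has_rld \<gamma> x t T \<Longrightarrow> (\<And>s. s \<in> T \<Longrightarrow> \<gamma> s = \<eta> s) \<Longrightarrow> has_rld \<eta> x t T"
  using tangent_cong_on[of "\<lambda>s. \<gamma> s \<otimes> inv (\<gamma> t)" t T x "\<lambda>s. \<eta> s \<otimes> inv (\<eta> t)"]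
  by (auto simp: has_rld_def tangent_def)

lemma has_rld_local:
  assumes "has_rld \<gamma> x t (J \<inter> T)" "open J" "\<And>s. s \<in> T \<Longrightarrow> \<gamma> s \<in> carrier G"
  shows "has_rld \<gamma> x t T"
proof -
  have "t \<in> J" using has_rld_mem[OF assms(1)] by blast
  then have "at t within J \<inter> T = at t within T"
    using assms(2) by (intro at_within_nhd[of _ J]) auto
  then show ?thesis using assms by (auto simp: has_rld_def tangent_def)
qed

lemma has_rld_const: "t \<in> T \<Longrightarrow> g \<in> carrier G \<Longrightarrow> has_rld (\<lambda>s. g) 0 t T"
  by (simp add: has_rld_def tangent_const)

text \<open>The quotient of the product factors as the quotient of \<open>\<gamma>\<close> times the
  quotient of \<open>\<eta>\<close> conjugated by \<open>\<gamma> t\<close>; the conjugation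
  produces the \<open>Ad\<close> term.\<close>

lemma has_rld_mult:
  assumes "has_rld \<gamma> x t T" "has_rld \<eta> y t T"
  shows "has_rld (\<lambda>s. \<gamma> s \<otimes> \<eta> s) (x + Ad G K (\<gamma> t) y) t T"
proof -
  have t: "t \<in> T" by (rule has_rld_mem[OF assms(1)])
  have c: "\<gamma> s \<in> carrier G" "\<eta> s \<in> carrier G" if "s \<in> T" for s
    using that assms by (auto simp: has_rld_def)
  note t = t c[OF t]
  have "tangent (\<lambda>s. (\<gamma> s \<otimes> inv (\<gamma> t)) \<otimes> (\<gamma> t \<otimes> (\<eta> s \<otimes> inv (\<eta> t)) \<otimes> inv (\<gamma> t))) t T
      (x + Ad G K (\<gamma> t) y)"
    using assms t by (intro tangent_mult tangent_conj) (auto simp: has_rld_def)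
  then have "tangent (\<lambda>s. \<gamma> s \<otimes> \<eta> s \<otimes> inv (\<gamma> t \<otimes> \<eta> t)) t T (x + Ad G K (\<gamma> t) y)"
  proof (rule tangent_cong_on)
    fix s assume "s \<in> T"
    note cs = c[OF this]
    have "inv (\<gamma> t) \<otimes> (\<gamma> t \<otimes> z) = z" if "z \<in> carrier G" for z
      using t that by (simp add: m_assoc[symmetric])
    then show "\<gamma> s \<otimes> inv (\<gamma> t) \<otimes> (\<gamma> t \<otimes> (\<eta> s \<otimes> inv (\<eta> t)) \<otimes> inv (\<gamma> t))
        = \<gamma> s \<otimes> \<eta> s \<otimes> inv (\<gamma> t \<otimes> \<eta> t)"
      using cs t by (simp add: m_assoc inv_mult_group)
  qed
  then show ?thesis using c by (simp add: has_rld_def)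
qed

lemma has_rld_inv:
  assumes "has_rld \<gamma> x t T"
  shows "has_rld (\<lambda>s. inv (\<gamma> s)) (- Ad G K (inv (\<gamma> t)) x) t T"
proof -
  have t: "t \<in> T" by (rule has_rld_mem[OF assms(1)])
  have c: "\<gamma> s \<in> carrier G" if "s \<in> T" for s
    using that assms by (auto simp: has_rld_def)
  note t = t c[OF t]
  have "tangent (\<lambda>s. inv (\<gamma> t) \<otimes> inv (\<gamma> s \<otimes> inv (\<gamma> t)) \<otimes> inv (inv (\<gamma> t))) t T
      (Ad G K (inv (\<gamma> t)) (- x))"
    using assms t by (intro tangent_inv tangent_conj) (auto simp: has_rld_def)
  then have "tangent (\<lambda>s. inv (\<gamma> s) \<otimes> inv (inv (\<gamma> t))) t T (Ad G K (inv (\<gamma> t)) (- x))"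
  proof (rule tangent_cong_on)
    fix s assume "s \<in> T"
    note cs = c[OF this]
    have "inv (\<gamma> t) \<otimes> (\<gamma> t \<otimes> z) = z" if "z \<in> carrier G" for z
      using t that by (simp add: m_assoc[symmetric])
    then show "inv (\<gamma> t) \<otimes> inv (\<gamma> s \<otimes> inv (\<gamma> t)) \<otimes> inv (inv (\<gamma> t)) = inv (\<gamma> s) \<otimes> inv (inv (\<gamma> t))"
      using cs t by (simp add: m_assoc inv_mult_group)
  qed
  then show ?thesis
    using c linear_neg[OF linear_Ad[of "inv (\<gamma> t)"]] t by (simp add: has_rld_def)
qed

lemma has_rld_left:
  assumes "has_rld \<gamma> x t T" "g \<in> carrier G"
  shows "has_rld (\<lambda>s. g \<otimes> \<gamma> s) (Ad G K g x) t T"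
  using has_rld_mult[OF has_rld_const[OF has_rld_mem[OF assms(1)] assms(2)] assms(1)] by simp

lemma has_rld_right:
  assumes "has_rld \<gamma> x t T" "g \<in> carrier G"
  shows "has_rld (\<lambda>s. \<gamma> s \<otimes> g) x t T"
  using has_rld_mult[OF assms(1) has_rld_const[OF has_rld_mem[OF assms(1)] assms(2)]]
    linear_0[OF linear_Ad[OF has_rld_carrier[OF assms(1) has_rld_mem[OF assms(1)]]]] by simp

text \<open>The pull-back of the right Maurer--Cartan form along a smooth map from an open subset of a Euclidean space.\<close>

definition mc :: "('u::euclidean_space \<Rightarrow> 'k) \<Rightarrow> 'u \<Rightarrow> 'u \<Rightarrow> 'g" where
  "mc f v w = frechet_derivative (\<lambda>v'. \<kappa> (f v' \<otimes> inv (f v))) (at v) w"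

text \<open>With the base point as a second variable the quotient map is jointly smooth, and
  \<open>mc f v w\<close> is its derivative at the diagonal point \<open>(v, v)\<close> in the
  direction \<open>(w, 0)\<close>. This yields continuity of \<open>mc\<close> in the base point as
  well.\<close>

lemma mc_aux:
  assumes U: "open U" and f: "smooth_map (euclidean_open U) K f"
  defines "O' \<equiv> {p \<in> U \<times> U. f (fst p) \<otimes> inv (f (snd p)) \<in> fst c1}"
    and "F \<equiv> \<lambda>p. \<kappa> (f (fst p) \<otimes> inv (f (snd p)))"
  shows "smooth_on F O'" "\<And>v. v \<in> U \<Longrightarrow> (v, v) \<in> O'"
    "\<And>v. v \<in> U \<Longrightarrow>
      ((\<lambda>v'. \<kappa> (f v' \<otimes> inv (f v))) has_derivative (\<lambda>w. frechet_derivative F (at (v, v)) (w, 0))) (at v)"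
proof -
  have oU: "open (U \<times> U)" by (intro open_Times U)
  have "smooth_map (euclidean_open (U \<times> U)) K (\<lambda>p. f (fst p) \<otimes> inv (f (snd p)))"
    by (intro smooth_mult smooth_inv charted_euclidean_open oU smooth_precompose[OF oU U f]
        smooth_on_bounded_linear bounded_linear_fst bounded_linear_snd) auto
  from smooth_\<kappa>(1)[OF oU this] show s: "smooth_on F O'" by (simp add: F_def O'_def)
  have carr: "f v \<in> carrier G" if "v \<in> U" for v
    using smooth_map_in_pts[OF f, of v] that by (simp add: pts_K)
  show d: "(v, v) \<in> O'" if "v \<in> U" for v
    using that carr[OF that] c1(2) by (simp add: O'_def)
  show "((\<lambda>v'. \<kappa> (f v' \<otimes> inv (f v))) has_derivative (\<lambda>w. frechet_derivative F (at (v, v)) (w, 0))) (at v)"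
    if v: "v \<in> U" for v
  proof -
    have "((\<lambda>v'. (v', v)) has_derivative (\<lambda>w. (w, 0))) (at v)"
      by (auto intro!: derivative_eq_intros has_derivative_Pair)
    from has_derivative_compose[OF this smooth_on_has_derivative[OF s d[OF v]]]
    show ?thesis by (simp add: F_def)
  qed
qed

lemma mc_has_derivative:
  assumes "open U" "smooth_map (euclidean_open U) K f" "v \<in> U"
  shows "((\<lambda>v'. \<kappa> (f v' \<otimes> inv (f v))) has_derivative mc f v) (at v)"
  using frechet_derivativeD[OF differentiableI[OF mc_aux(3)[OF assms]]]
  by (simp add: mc_def[abs_def])

lemma linear_mc:
  assumes "open U" "smooth_map (euclidean_open U) K f" "v \<in> U"
  shows "linear (mc f v)"
  using has_derivative_linear[OF mc_has_derivative[OF assms]] .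

lemma continuous_on_mc:
  assumes "open U" "smooth_map (euclidean_open U) K f"
    and "continuous_on T z" "z ` T \<subseteq> U" "continuous_on T w"
  shows "continuous_on T (\<lambda>t. mc f (z t) (w t))"
proof -
  note a = mc_aux[OF assms(1,2)]
  let ?F = "\<lambda>p. \<kappa> (f (fst p) \<otimes> inv (f (snd p)))"
  have "continuous_on T (\<lambda>t. frechet_derivative ?F (at (z t, z t)) (w t, 0))"
    by (rule continuous_on_frechet_derivative[OF a(1)])
      (use assms a(2) in \<open>auto intro!: continuous_intros\<close>)
  moreover have "mc f (z t) (w t) = frechet_derivative ?F (at (z t, z t)) (w t, 0)" if "t \<in> T" for t
    unfolding mc_def using frechet_derivative_eqI[OF a(3), of "z t"] that assms(4) by auto
  ultimately show ?thesis by (simp cong: continuous_on_cong)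
qed

lemma has_rld_mc:
  assumes U: "open U" "smooth_map (euclidean_open U) K f"
    and z: "(z has_vector_derivative w) (at t within T)" "t \<in> T" "z ` T \<subseteq> U"
  shows "has_rld (\<lambda>s. f (z s)) (mc f (z t) w) t T"
proof -
  have zU: "z s \<in> U" if "s \<in> T" for s using z(3) that by blast
  have carr: "f v \<in> carrier G" if "v \<in> U" for v
    using smooth_map_in_pts[OF U(2), of v] that by (simp add: pts_K)
  have "(z \<longlongrightarrow> z t) (at t within T)"
    using has_vector_derivative_continuous[OF z(1)] by (simp add: continuous_within)
  then have "limitin (top_of_set U) z (z t) (at t within T)"
    using zU[OF z(2)] U(1) by simp
  from continuous_map_limit[OF _ this] smooth_map_continuous[OF U(2)]
  have "limitin (Top K) (\<lambda>s. f (z s)) (f (z t)) (at t within T)" by (fastforce simp: o_def)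
  from limitin_K_mult[OF this limitin_K_const[of "inv (f (z t))"]]
  have lim: "limitin (Top K) (\<lambda>s. f (z s) \<otimes> inv (f (z t))) \<one> (at t within T)"
    using carr[OF zU[OF z(2)]] by simp
  have "((\<lambda>s. \<kappa> (f (z s) \<otimes> inv (f (z t)))) has_vector_derivative mc f (z t) w) (at t within T)"
    by (rule has_vector_derivative_chain[OF z(1) mc_has_derivative[OF U zU[OF z(2)]]])
  then show ?thesis
    using lim carr zU z(2) by (auto simp: has_rld_def tangent_def)
qed

lemma Icc_at_within_neq_bot: "(a::real) < b \<Longrightarrow> t \<in> {a..b} \<Longrightarrow> at t within {a..b} \<noteq> bot"
  by (simp add: trivial_limit_within islimpt_Icc)

lemma curve_carrier:
  assumes "continuous_map (top_of_set {a..b}) (Top K) \<gamma>" "t \<in> {a..b::real}"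
  shows "\<gamma> t \<in> carrier G"
  using continuous_map_funspace[OF assms(1)] assms(2) pts_K by auto

text \<open>Near each time the curve is an inverse chart applied to a C1 coordinate curve, so
  \<open>mc\<close> supplies a continuous logarithmic derivative; uniqueness makes the local ones
  agree.\<close>

lemma C1_curve_has_rld:
  assumes ab: "a < b" and \<gamma>: "C1_curve K a b \<gamma>"
  obtains X where "continuous_on {a..b} X" "\<And>t. t \<in> {a..b} \<Longrightarrow> has_rld \<gamma> (X t) t {a..b}"
proof -
  define X where "X t = vector_derivative (\<lambda>s. \<kappa> (\<gamma> s \<otimes> inv (\<gamma> t))) (at t within {a..b})" for t
  note ct = C1_curve_continuous[OF \<gamma>]
  have carr: "\<gamma> t \<in> carrier G" if "t \<in> {a..b}" for t
    using curve_carrier[OF ct that] .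
  have XI: "X t = x" if "has_rld \<gamma> x t {a..b}" for x t
    using that vector_derivative_within[OF Icc_at_within_neq_bot[OF ab has_rld_mem[OF that]]]
    unfolding X_def has_rld_def tangent_def by blast
  have key: "has_rld \<gamma> (X t) t {a..b} \<and> continuous (at t within {a..b}) X" if t: "t \<in> {a..b}" for t
  proof -
    define d where "d = chart_at K (\<gamma> t)"
    have d: "d \<in> Atlas K" "\<gamma> t \<in> fst d" using chart_at_K[OF carr[OF t]] by (simp_all add: d_def)
    let ?V = "snd d ` fst d" and ?f = "chart_inv d" and ?z = "\<lambda>s. snd d (\<gamma> s)"
    have V: "open ?V" using charted_open_image[OF charted_K d(1) charted_openin[OF charted_K d(1)]] by simp
    have f: "smooth_map (euclidean_open ?V) K ?f" by (rule smooth_map_chart_inv[OF smooth_K d(1)])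
    obtain J where J: "open J" "t \<in> J" "\<And>s. s \<in> J \<Longrightarrow> s \<in> {a..b} \<Longrightarrow> \<gamma> s \<in> fst d"
      using curve_preimage_open[OF ct charted_openin[OF charted_K d(1)] t d(2)] by blast
    obtain D where D: "continuous_on {t \<in> {a..b}. \<gamma> t \<in> fst d} D"
      "\<And>t. t \<in> {a..b} \<Longrightarrow> \<gamma> t \<in> fst d \<Longrightarrow>
        (?z has_vector_derivative D t) (at t within {a..b})"
      using C1_curve_chart[OF \<gamma> d(1)] by blast
    have rld: "has_rld \<gamma> (mc ?f (?z s) (D s)) s {a..b}" if s: "s \<in> J \<inter> {a..b}" for s
    proof (rule has_rld_local[OF _ J(1) carr])
      have "has_rld (\<lambda>s. ?f (?z s)) (mc ?f (?z s) (D s)) s (J \<inter> {a..b})"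
        by (rule has_rld_mc[OF V f has_vector_derivative_within_subset[OF D(2)]]) (use s J(3) in auto)
      then show "has_rld \<gamma> (mc ?f (?z s) (D s)) s (J \<inter> {a..b})"
        by (rule has_rld_cong) (use J(3) charted_left[OF charted_K d(1)] in auto)
    qed
    have "continuous_on (J \<inter> {a..b}) (\<lambda>s. mc ?f (?z s) (D s))"
    proof (rule continuous_on_mc[OF V f])
      show "continuous_on (J \<inter> {a..b}) D"
        by (rule continuous_on_subset[OF D(1)]) (use J in auto)
      have "continuous (at s within {a..b}) ?z" if "s \<in> J \<inter> {a..b}" for s
        using has_vector_derivative_continuous[OF D(2)[of s]] J(3)[of s] that by auto
      then have "continuous (at s within J \<inter> {a..b}) ?z" if "s \<in> J \<inter> {a..b}" for s
        using continuous_within_subset[of s "{a..b}" ?z "J \<inter> {a..b}"] that by blast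
      then show "continuous_on (J \<inter> {a..b}) ?z"
        by (simp add: continuous_on_eq_continuous_within)
    qed (use J in auto)
    then have "continuous_on (J \<inter> {a..b}) X"
      by (subst continuous_on_cong[OF refl XI[OF rld]])
    then have "continuous (at t within J \<inter> {a..b}) X"
      using J(2) t by (simp add: continuous_on_eq_continuous_within)
    moreover have "at t within J \<inter> {a..b} = at t within {a..b}"
      by (rule at_within_nhd[OF J(2,1)]) auto
    ultimately show ?thesis using rld[of t] XI[OF rld[of t]] t J(2) by simp
  qed
  then show thesis using that[of X] by (simp add: continuous_on_eq_continuous_within)
qed

text \<open>Chain rule for the right translation by \<open>inv (\<gamma> t)\<close>. Only
  differentiability at \<open>t\<close> is assumed, so that break points at which the curve happens
  to be differentiable are covered.\<close>

lemma right_log_deriv_has_rld: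
  assumes ab: "a < b" and t: "t \<in> {a..b}" and ct: "continuous_map (top_of_set {a..b}) (Top K) \<gamma>"
    and diff: "curve_differentiable_at K {a..b} \<gamma> t"
  shows "has_rld \<gamma> (right_log_deriv G K a b \<gamma> t) t {a..b}"
proof -
  have carr: "\<gamma> t \<in> carrier G" if "t \<in> {a..b}" for t
    using curve_carrier[OF ct that] .
  define d where "d = chart_at K (\<gamma> t)"
  have d: "d \<in> Atlas K" "\<gamma> t \<in> fst d" using chart_at_K[OF carr[OF t]] by (simp_all add: d_def)
  let ?z = "\<lambda>s. snd d (\<gamma> s)" and ?R = "\<lambda>g. g \<otimes> inv (\<gamma> t)"
  let ?F = "\<lambda>y. \<kappa> (?R (chart_inv d y))"
  have R1: "?R (\<gamma> t) = \<one>" using carr[OF t] by simp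
  have R: "smooth_map K K ?R"
    by (intro smooth_mult smooth_id smooth_const charted_K inv_closed carr t)
  have "smooth_on (snd c1 \<circ> ?R \<circ> chart_inv d) (snd d ` {p \<in> fst d. ?R p \<in> fst c1})"
    by (rule smooth_map_charts[OF R d(1) c1(1)])
  then have "((snd c1 \<circ> ?R \<circ> chart_inv d) has_derivative
      frechet_derivative (snd c1 \<circ> ?R \<circ> chart_inv d) (at (?z t))) (at (?z t))"
    by (rule smooth_on_has_derivative) (use d R1 c1(2) in auto)
  then have F: "(?F has_derivative frechet_derivative ?F (at (?z t))) (at (?z t))"
    by (simp add: o_def coord_def)
  have "(?z has_vector_derivative velocity K {a..b} \<gamma> t) (at t within {a..b})"
    using diff by (simp add: velocity_def curve_differentiable_at_def vector_derivative_works coord_def d_def o_def)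
  from has_vector_derivative_chain[OF this F]
  have "((\<lambda>s. ?F (?z s)) has_vector_derivative right_log_deriv G K a b \<gamma> t) (at t within {a..b})"
    by (simp add: right_log_deriv_def differential_def R1 coord_def coord_inv_def d_def o_def)
  moreover have lim: "limitin (Top K) \<gamma> (\<gamma> t) (at t within {a..b})"
    by (rule curve_limitin[OF ct t])
  then have "\<forall>\<^sub>F s in at t within {a..b}. \<gamma> s \<in> fst d"
    by (rule limitinD[OF _ charted_openin[OF charted_K d(1)] d(2)])
  then have "\<forall>\<^sub>F s in at t within {a..b}. ?F (?z s) = \<kappa> (?R (\<gamma> s))"
    by eventually_elim (simp add: charted_left[OF charted_K d(1)])
  ultimately have "((\<lambda>s. \<kappa> (?R (\<gamma> s))) has_vector_derivative right_log_deriv G K a b \<gamma> t) (at t within {a..b})"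
    by (rule has_vector_derivative_eventually_cong) (use t in \<open>auto simp: charted_left[OF charted_K d]\<close>)
  moreover have "limitin (Top K) (\<lambda>s. ?R (\<gamma> s)) \<one> (at t within {a..b})"
    using limitin_K_mult[OF lim limitin_K_const[of "inv (\<gamma> t)"]] carr[OF t] by simp
  ultimately show ?thesis using carr t R1 by (simp add: has_rld_def tangent_def)
qed

lemma C1_curve_differentiable:
  assumes "C1_curve K a b \<gamma>" "t \<in> {a..b}"
  shows "curve_differentiable_at K {a..b} \<gamma> t"
proof -
  have "\<gamma> t \<in> carrier G" using C1_curve_in_pts[OF assms] pts_K by simp
  note ch = chart_at_K[OF this]
  from C1_curve_chart[OF assms(1) ch(1)] obtain D where
    "((\<lambda>s. snd (chart_at K (\<gamma> t)) (\<gamma> s)) has_vector_derivative D t) (at t within {a..b})"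
    using assms(2) ch(2) by metis
  then show ?thesis
    by (auto simp: curve_differentiable_at_def coord_def o_def differentiable_def has_vector_derivative_def)
qed

lemma C1_curve_rld:
  assumes "a < b" "C1_curve K a b \<gamma>"
  shows "continuous_on {a..b} (right_log_deriv G K a b \<gamma>)"
    and "t \<in> {a..b} \<Longrightarrow> has_rld \<gamma> (right_log_deriv G K a b \<gamma> t) t {a..b}"
proof -
  show r: "has_rld \<gamma> (right_log_deriv G K a b \<gamma> t) t {a..b}" if "t \<in> {a..b}" for t
    by (rule right_log_deriv_has_rld[OF assms(1) that C1_curve_continuous[OF assms(2)]
          C1_curve_differentiable[OF assms(2) that]])
  obtain X where X: "continuous_on {a..b} X" "\<And>t. t \<in> {a..b} \<Longrightarrow> has_rld \<gamma> (X t) t {a..b}"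
    using C1_curve_has_rld[OF assms] by blast
  have "right_log_deriv G K a b \<gamma> t = X t" if "t \<in> {a..b}" for t
    using has_rld_unique[OF r[OF that] X(2)[OF that] Icc_at_within_neq_bot[OF assms(1) that]] .
  then show "continuous_on {a..b} (right_log_deriv G K a b \<gamma>)"
    by (subst continuous_on_cong[OF refl]) (use X(1) in auto)
qed

lemma right_log_deriv_eqI:
  assumes "a < b" "C1_curve K a b \<gamma>" "has_rld \<gamma> x t {a..b}"
  shows "right_log_deriv G K a b \<gamma> t = x"
  using has_rld_unique[OF C1_curve_rld(2)[OF assms(1,2)] assms(3)]
    Icc_at_within_neq_bot[OF assms(1)] has_rld_mem[OF assms(3)] by blast

lemma right_log_deriv_subinterval:
  assumes "a \<le> p" "p < q" "q \<le> b" "C1_curve K p q \<gamma>" "t \<in> {p..q}"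
    and "continuous_map (top_of_set {a..b}) (Top K) \<gamma>" "curve_differentiable_at K {a..b} \<gamma> t"
  shows "right_log_deriv G K a b \<gamma> t = right_log_deriv G K p q \<gamma> t"
proof -
  have "has_rld \<gamma> (right_log_deriv G K a b \<gamma> t) t {a..b}"
    by (rule right_log_deriv_has_rld) (use assms in auto)
  then have "has_rld \<gamma> (right_log_deriv G K a b \<gamma> t) t {p..q}"
    by (rule has_rld_subset) (use assms in auto)
  then show ?thesis using right_log_deriv_eqI[OF assms(2,4)] by metis
qed

lemma curve_differentiable_interior:
  assumes "a \<le> p" "q \<le> b" "C1_curve K p q \<gamma>" "p < t" "t < q"
  shows "curve_differentiable_at K {a..b} \<gamma> t"
proof -
  have "at t within {a..b} = at t within {p..q}"
    using assms by (simp add: at_within_Icc_at)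
  then show ?thesis
    using C1_curve_differentiable[OF assms(3), of t] assms(4,5) by (simp add: curve_differentiable_at_def)
qed

end

section \<open>Adjoint representation and Killing form\<close>

text \<open>The sums are traces, written as in \<open>killing_form\<close>; this gives both its
  symmetry and its invariance.\<close>

lemma trace_commute:
  fixes f g :: "'a::euclidean_space \<Rightarrow> 'a"
  assumes "linear f" "linear g"
  shows "(\<Sum>b\<in>Basis. f (g b) \<bullet> b) = (\<Sum>b\<in>Basis. g (f b) \<bullet> b)"
proof -
  have e: "h (k b) \<bullet> b = (\<Sum>c\<in>Basis. (k b \<bullet> c) * (h c \<bullet> b))" if "linear h" for h k :: "'a \<Rightarrow> 'a" and b
    by (subst linear_Basis_expansion[OF that]) (simp add: inner_sum_left)
  have "(\<Sum>b\<in>Basis. f (g b) \<bullet> b) = (\<Sum>b\<in>Basis. \<Sum>c\<in>Basis. (g b \<bullet> c) * (f c \<bullet> b))"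
    by (simp only: e[OF assms(1)])
  also have "\<dots> = (\<Sum>c\<in>Basis. \<Sum>b\<in>Basis. (f c \<bullet> b) * (g b \<bullet> c))"
    by (subst sum.swap) (simp only: mult.commute)
  also have "\<dots> = (\<Sum>c\<in>Basis. g (f c) \<bullet> c)"
    by (simp only: e[OF assms(2)])
  finally show ?thesis .
qed

lemma coord_euclidean_mfd: "coord euclidean_mfd p = id"
proof -
  have "chart_at euclidean_mfd p = (UNIV, id)"
    unfolding chart_at_def by (rule some_equality) (auto simp: euclidean_mfd_def)
  then show ?thesis by (simp add: coord_def)
qed

context lie_grp
begin

abbreviation bracket :: "'g \<Rightarrow> 'g \<Rightarrow> 'g" where "bracket \<equiv> lie_bracket G K"

text \<open>\<open>Ad\<close> is a partial derivative, in the second variable at \<one>, of the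
  jointly smooth conjugation map, hence smooth in the first variable.\<close>

lemma Ad_chart_smooth: "smooth_on (\<lambda>a. Ad G K (\<kappa>' a) y) (\<kappa> ` fst c1)"
proof -
  let ?V = "\<kappa> ` fst c1"
  let ?c = "\<lambda>p. \<kappa>' (fst p) \<otimes> \<kappa>' (snd p) \<otimes> inv (\<kappa>' (fst p))"
  let ?C = "\<lambda>p. \<kappa> (?c p)"
  define O' where "O' = {p \<in> ?V \<times> ?V. ?c p \<in> fst c1}"
  have oV: "open (?V \<times> ?V)" by (intro open_Times open_\<kappa>)
  have "smooth_map (euclidean_open (?V \<times> ?V)) K ?c"
    by (intro smooth_mult smooth_inv charted_euclidean_open oV smooth_precompose[OF oV open_\<kappa> smooth_\<kappa>']
        smooth_on_bounded_linear bounded_linear_fst bounded_linear_snd) auto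
  from smooth_\<kappa>[OF oV this] have C: "smooth_on ?C O'" "open O'" by (simp_all add: O'_def)
  have carr: "\<kappa>' a \<in> carrier G" if "a \<in> ?V" for a
    using that c1_carrier by (auto simp: \<kappa>'_\<kappa>)
  have mem: "(a, \<kappa> \<one>) \<in> O'" if "a \<in> ?V" for a
    using that carr[OF that] c1(2) by (auto simp: O'_def \<kappa>'_\<kappa>)
  have eq: "Ad G K (\<kappa>' a) y = frechet_derivative ?C (at (a, \<kappa> \<one>)) (0, y)" if a: "a \<in> ?V" for a
  proof -
    have "((\<lambda>b. (a, b)) has_derivative (\<lambda>w. (0, w))) (at (\<kappa> \<one>))"
      by (auto intro!: derivative_eq_intros has_derivative_Pair)
    from has_derivative_compose[OF this smooth_on_has_derivative[OF C(1) mem[OF a]]]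
    have "((\<lambda>b. ?C (a, b)) has_derivative (\<lambda>w. frechet_derivative ?C (at (a, \<kappa> \<one>)) (0, w))) (at (\<kappa> \<one>))" .
    from frechet_derivative_eqI[OF this, of y] show ?thesis
      using carr[OF a] by (simp add: Ad_def differential_def o_def)
  qed
  have "smooth_on (\<lambda>a. (a, \<kappa> \<one>)) ?V"
    by (intro smooth_on_Pair open_\<kappa> smooth_on_const smooth_on_bounded_linear bounded_linear_ident)
  from smooth_on_compose[OF open_\<kappa> C(2) _ this smooth_on_derivative[OF C(1)]]
  have "smooth_on (\<lambda>a. frechet_derivative ?C (at (a, \<kappa> \<one>)) (0, y)) ?V"
    using mem by blast
  then show ?thesis by (rule smooth_on_cong[OF open_\<kappa>, rotated]) (simp add: eq)
qed

lemma Ad_chart_has_derivative: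
  "((\<lambda>a. Ad G K (\<kappa>' a) y) has_derivative (\<lambda>x. bracket x y)) (at (\<kappa> \<one>))"
  using smooth_on_has_derivative[OF Ad_chart_smooth, of "\<kappa> \<one>"] c1(2)
  by (simp add: lie_bracket_def[abs_def] differential_def coord_euclidean_mfd o_def)

lemma tangent_Ad:
  "tangent F t T x \<Longrightarrow> ((\<lambda>s. Ad G K (F s) y) has_vector_derivative bracket x y) (at t within T)"
  by (rule tangent_chain[OF _ Ad_chart_has_derivative])

text \<open>Splitting \<open>Ad (\<gamma> s)\<close> as \<open>Ad\<close> of the quotient after
  \<open>Ad (\<gamma> t)\<close> reduces the derivative at \<open>t\<close> to the one at \<one>,
  which defines the bracket.\<close>

lemma has_rld_Ad:
  assumes "has_rld \<gamma> x t T"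
  shows "((\<lambda>s. Ad G K (\<gamma> s) y) has_vector_derivative bracket x (Ad G K (\<gamma> t) y)) (at t within T)"
proof (rule has_vector_derivative_transform)
  show t: "t \<in> T" by (rule has_rld_mem[OF assms])
  show "((\<lambda>s. Ad G K (\<gamma> s \<otimes> inv (\<gamma> t)) (Ad G K (\<gamma> t) y)) has_vector_derivative
      bracket x (Ad G K (\<gamma> t) y)) (at t within T)"
    by (rule tangent_Ad) (use assms in \<open>simp add: has_rld_def\<close>)
  show "Ad G K (\<gamma> s) y = Ad G K (\<gamma> s \<otimes> inv (\<gamma> t)) (Ad G K (\<gamma> t) y)" if "s \<in> T" for s
    using has_rld_carrier[OF assms that] has_rld_carrier[OF assms t]
    by (simp add: Ad_mult[symmetric] m_assoc)
qed

lemma linear_bracket_left: "linear (\<lambda>x. bracket x y)"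
  by (rule has_derivative_linear[OF Ad_chart_has_derivative])

lemma bracket_eqI:
  assumes "tangent F 0 UNIV x" "((\<lambda>s. Ad G K (F s) y) has_vector_derivative z) (at 0)"
  shows "bracket x y = z"
  using tangent_Ad[OF assms(1)] assms(2) vector_derivative_unique_at by blast

lemma line_carrier: "\<forall>\<^sub>F s in at 0. \<kappa>' (\<kappa> \<one> + s *\<^sub>R x) \<in> carrier G"
  using tangent_near[OF tangent_line[of x]] c1_carrier by (auto elim: eventually_mono)

lemma linear_bracket_right: "linear (bracket x)"
proof (rule linearI)
  let ?F = "\<lambda>s::real. \<kappa>' (\<kappa> \<one> + s *\<^sub>R x)"
  have F0: "?F 0 \<in> carrier G" using \<kappa>'_\<kappa>[OF c1(2)] by simp
  fix y z :: 'g and r :: real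
  show "bracket x (y + z) = bracket x y + bracket x z"
  proof (rule bracket_eqI[OF tangent_line])
    have "((\<lambda>s. Ad G K (?F s) y + Ad G K (?F s) z) has_vector_derivative (bracket x y + bracket x z)) (at 0)"
      by (intro has_vector_derivative_add tangent_Ad tangent_line)
    then show "((\<lambda>s. Ad G K (?F s) (y + z)) has_vector_derivative (bracket x y + bracket x z)) (at 0)"
      by (rule has_vector_derivative_eventually_cong)
        (use line_carrier[of x] F0 in \<open>auto elim!: eventually_mono simp: linear_add[OF linear_Ad]\<close>)
  qed
  show "bracket x (r *\<^sub>R y) = r *\<^sub>R bracket x y"
  proof (rule bracket_eqI[OF tangent_line])
    have "((\<lambda>s. r *\<^sub>R Ad G K (?F s) y) has_vector_derivative (r *\<^sub>R bracket x y)) (at 0)"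
      by (rule bounded_linear.has_vector_derivative[OF bounded_linear_scaleR_right
            tangent_Ad[OF tangent_line]])
    then show "((\<lambda>s. Ad G K (?F s) (r *\<^sub>R y)) has_vector_derivative (r *\<^sub>R bracket x y)) (at 0)"
      by (rule has_vector_derivative_eventually_cong)
        (use line_carrier[of x] F0 in \<open>auto elim!: eventually_mono simp: linear_scale[OF linear_Ad]\<close>)
  qed
qed

text \<open>Differentiates, in \<open>h\<close> at \<one>, the identity that \<open>Ad g\<close>
  after \<open>Ad h\<close> is \<open>Ad (g h inv g)\<close> after \<open>Ad g\<close>.\<close>

lemma Ad_bracket:
  assumes g: "g \<in> carrier G"
  shows "Ad G K g (bracket x y) = bracket (Ad G K g x) (Ad G K g y)"
proof (rule sym, rule bracket_eqI[OF tangent_conj[OF g tangent_line]])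
  let ?F = "\<lambda>s::real. \<kappa>' (\<kappa> \<one> + s *\<^sub>R x)"
  have F0: "?F 0 \<in> carrier G" using \<kappa>'_\<kappa>[OF c1(2)] by simp
  have bl: "bounded_linear (Ad G K g)"
    using linear_Ad[OF g] linear_conv_bounded_linear by blast
  have eq: "Ad G K g (Ad G K h y) = Ad G K (g \<otimes> h \<otimes> inv g) (Ad G K g y)" if "h \<in> carrier G" for h
    using that g by (simp add: Ad_mult Ad_inv_left)
  have "((\<lambda>s. Ad G K g (Ad G K (?F s) y)) has_vector_derivative Ad G K g (bracket x y)) (at 0)"
    by (rule bounded_linear.has_vector_derivative[OF bl tangent_Ad[OF tangent_line]])
  then show "((\<lambda>s. Ad G K (g \<otimes> ?F s \<otimes> inv g) (Ad G K g y)) has_vector_derivative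
      Ad G K g (bracket x y)) (at 0)"
    by (rule has_vector_derivative_eventually_cong)
      (use line_carrier[of x] eq F0 in \<open>auto elim!: eventually_mono\<close>)
qed

abbreviation ip :: "'g \<Rightarrow> 'g \<Rightarrow> real" where "ip \<equiv> lie_inner G K"

lemma linear_ip_right: "linear (ip x)"
  by (rule linearI)
    (simp_all add: lie_inner_def killing_form_def linear_add[OF linear_bracket_left]
      linear_add[OF linear_bracket_right] linear_scale[OF linear_bracket_left]
      linear_scale[OF linear_bracket_right] inner_add_left sum.distrib sum_distrib_left sum_negf)

lemma ip_commute: "ip x y = ip y x"
  unfolding lie_inner_def killing_form_def
  using trace_commute[OF linear_bracket_right linear_bracket_right] by simp

lemma linear_ip_left: "linear (\<lambda>x. ip x y)"
  using linear_ip_right[of y] by (subst ip_commute)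

text \<open>By \<open>Ad_bracket\<close>, the operator \<open>bracket (Ad g x)\<close> is
  \<open>bracket x\<close> conjugated by \<open>Ad g\<close>, and the trace is invariant under
  conjugation.\<close>

lemma ip_Ad:
  assumes g: "g \<in> carrier G"
  shows "ip (Ad G K g x) (Ad G K g y) = ip x y"
proof -
  let ?A = "Ad G K g" and ?B = "Ad G K (inv g)"
  have l: "linear (\<lambda>v. bracket x (bracket y (?B v)))"
    using linear_compose[OF linear_compose[OF linear_Ad linear_bracket_right] linear_bracket_right] g
    by (auto simp: o_def)
  have "bracket (?A x) (bracket (?A y) b) = ?A (bracket x (bracket y (?B b)))" for b
    using g by (simp add: Ad_bracket Ad_inv_right)
  then have "killing_form G K (?A x) (?A y) = (\<Sum>b\<in>Basis. ?A (bracket x (bracket y (?B b))) \<bullet> b)"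
    by (simp add: killing_form_def)
  also have "\<dots> = (\<Sum>b\<in>Basis. bracket x (bracket y (?B (?A b))) \<bullet> b)"
    by (rule trace_commute[OF linear_Ad[OF g] l])
  finally show ?thesis using g by (simp add: lie_inner_def killing_form_def Ad_inv_left)
qed

lemma ip_Ad_left: "g \<in> carrier G \<Longrightarrow> ip (Ad G K g x) y = ip x (Ad G K (inv g) y)"
  using ip_Ad[of g x "Ad G K (inv g) y"] by (simp add: Ad_inv_right)

section \<open>One-parameter subgroups\<close>

definition one_param :: "(real \<Rightarrow> 'k) \<Rightarrow> 'g \<Rightarrow> bool" where
  "one_param c x \<longleftrightarrow> smooth_map euclidean_mfd K c \<and> (\<forall>s t. c (s + t) = c s \<otimes> c t) \<and>
     velocity K UNIV c 0 = x"

lemma lie_exp_THE: "lie_exp G K x = (THE c. one_param c x) 1"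
  by (simp add: lie_exp_def one_param_def)

lemma limitin_smooth_curve:
  assumes "smooth_map euclidean_mfd K c" "(z \<longlongrightarrow> (l::real)) F"
  shows "limitin (Top K) (\<lambda>s. c (z s)) (c l) F"
  using continuous_map_limit[OF smooth_map_continuous[OF assms(1)], of z l F] assms(2)
  by (simp add: euclidean_mfd_def o_def)

lemma smooth_curve_derivative:
  assumes "smooth_map euclidean_mfd K c" "c 0 = \<one>"
  shows "((\<lambda>s. \<kappa> (c s)) has_vector_derivative velocity K UNIV c 0) (at 0)"
proof -
  have "smooth_on (\<lambda>s. \<kappa> (c s)) {s \<in> UNIV. c s \<in> fst c1}"
    using smooth_\<kappa>(1)[OF open_UNIV, of c] assms(1) by (simp add: euclidean_mfd_eq[symmetric])
  then have "(\<lambda>s. \<kappa> (c s)) differentiable (at 0)"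
    using smooth_on_has_derivative[of "\<lambda>s. \<kappa> (c s)" "{s \<in> UNIV. c s \<in> fst c1}" 0] assms(2) c1(2)
    by (intro differentiableI) simp
  then show ?thesis by (simp add: velocity_def assms(2) o_def vector_derivative_works)
qed

lemma one_param_carrier:
  assumes "one_param c x"
  shows "c s \<in> carrier G"
  using smooth_map_in_pts[of euclidean_mfd K c s] assms pts_K
  by (simp add: one_param_def euclidean_mfd_def)

lemma one_param_add: "one_param c x \<Longrightarrow> c (s + t) = c s \<otimes> c t"
  by (simp add: one_param_def)

lemma one_param_0:
  assumes "one_param c x"
  shows "c 0 = \<one>"
  using one_param_add[OF assms, of 0 0] one_param_carrier[OF assms, of 0] by (metis add_0 r_cancel_one)

lemma one_param_minus:
  assumes "one_param c x"
  shows "inv (c s) = c (- s)"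
  using one_param_add[OF assms, of "- s" s] one_param_0[OF assms] one_param_carrier[OF assms]
  by (simp add: inv_equality)

lemma one_param_derivative:
  assumes "one_param c x"
  shows "((\<lambda>s. \<kappa> (c s)) has_vector_derivative x) (at 0)"
  using smooth_curve_derivative[of c] one_param_0[OF assms] assms by (simp add: one_param_def)

lemma one_param_has_rld:
  assumes c: "one_param c x"
  shows "has_rld c x t UNIV"
proof -
  have eq: "c s \<otimes> inv (c t) = c (s - t)" for s
    using one_param_add[OF c, of s "- t"] by (simp add: one_param_minus[OF c])
  have s: "smooth_map euclidean_mfd K c" using c by (simp add: one_param_def)
  have "((\<lambda>s. s - t) has_vector_derivative 1) (at t)" by (auto intro!: derivative_eq_intros)
  from has_vector_derivative_chain[OF this, of "\<lambda>s. \<kappa> (c s)" "\<lambda>h. h *\<^sub>R x"]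
  have "((\<lambda>s. \<kappa> (c (s - t))) has_vector_derivative x) (at t)"
    using one_param_derivative[OF c] by (simp add: has_vector_derivative_def)
  moreover have "((\<lambda>s. s - t) \<longlongrightarrow> t - t) (at t)" by (intro tendsto_intros)
  then have "limitin (Top K) (\<lambda>s. c (s - t)) \<one> (at t)"
    using limitin_smooth_curve[OF s, of "\<lambda>s. s - t" 0] one_param_0[OF c] by simp
  ultimately show ?thesis
    using one_param_carrier[OF c] one_param_0[OF c] by (simp add: has_rld_def tangent_def eq)
qed

lemma one_paramI:
  assumes "smooth_map euclidean_mfd K c" "\<And>s t. c (s + t) = c s \<otimes> c t" "tangent c 0 UNIV x"
  shows "one_param c x"
proof -
  have 0: "c 0 = \<one>" using assms(3) by (simp add: tangent_def)
  have "((\<lambda>s. \<kappa> (c s)) has_vector_derivative x) (at 0)" using assms(3) by (simp add: tangent_def)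
  then have "velocity K UNIV c 0 = x"
    using smooth_curve_derivative[OF assms(1) 0] vector_derivative_unique_at by blast
  then show ?thesis using assms by (simp add: one_param_def)
qed

lemma one_param_tangent:
  assumes "one_param c x"
  shows "tangent c 0 UNIV x"
  using one_param_has_rld[OF assms, of 0] one_param_0[OF assms] one_param_carrier[OF assms]
  by (simp add: has_rld_def)

lemma one_param_scale:
  assumes c: "one_param c x"
  shows "one_param (\<lambda>s. c (r * s)) (r *\<^sub>R x)"
proof (rule one_paramI)
  have s: "smooth_map euclidean_mfd K c" using c by (simp add: one_param_def)
  show "smooth_map euclidean_mfd K (\<lambda>s. c (r * s))"
    using smooth_precompose[OF open_UNIV open_UNIV, of c "\<lambda>s. r * s"] s
    by (simp add: euclidean_mfd_eq[symmetric] smooth_on_bounded_linear bounded_linear_mult_right)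
  show "c (r * (s + t)) = c (r * s) \<otimes> c (r * t)" for s t
    by (simp add: distrib_left one_param_add[OF c])
  have "((\<lambda>s. r * s) has_vector_derivative r) (at 0)" by (auto intro!: derivative_eq_intros)
  from has_vector_derivative_chain[OF this, of "\<lambda>s. \<kappa> (c s)" "\<lambda>h. h *\<^sub>R x"]
  have "((\<lambda>s. \<kappa> (c (r * s))) has_vector_derivative r *\<^sub>R x) (at 0)"
    using one_param_derivative[OF c] by (simp add: has_vector_derivative_def)
  moreover have "((\<lambda>s. r * s) \<longlongrightarrow> r * 0) (at 0)" by (intro tendsto_intros)
  then have "limitin (Top K) (\<lambda>s. c (r * s)) \<one> (at 0)"
    using limitin_smooth_curve[OF s, of "\<lambda>s. r * s" 0] one_param_0[OF c] by simp
  ultimately show "tangent (\<lambda>s. c (r * s)) 0 UNIV (r *\<^sub>R x)"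
    using one_param_0[OF c] by (simp add: tangent_def)
qed

lemma one_param_conj:
  assumes c: "one_param c x" and g: "g \<in> carrier G"
  shows "one_param (\<lambda>s. g \<otimes> c s \<otimes> inv g) (Ad G K g x)"
proof (rule one_paramI)
  have s: "smooth_map euclidean_mfd K c" using c by (simp add: one_param_def)
  show "smooth_map euclidean_mfd K (\<lambda>s. g \<otimes> c s \<otimes> inv g)"
    by (intro smooth_mult smooth_const charted_euclidean_mfd s g inv_closed)
  show "g \<otimes> c (s + t) \<otimes> inv g = g \<otimes> c s \<otimes> inv g \<otimes> (g \<otimes> c t \<otimes> inv g)" for s t
  proof -
    have "inv g \<otimes> (g \<otimes> z) = z" if "z \<in> carrier G" for z
      using g that by (simp add: m_assoc[symmetric])
    then show ?thesis
      using g one_param_carrier[OF c] by (simp add: one_param_add[OF c] m_assoc)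
  qed
  show "tangent (\<lambda>s. g \<otimes> c s \<otimes> inv g) 0 UNIV (Ad G K g x)"
    by (rule tangent_conj[OF g one_param_tangent[OF c]])
qed

lemma one_param_zero: "one_param (\<lambda>s. \<one>) 0"
  by (rule one_paramI) (simp_all add: smooth_const charted_euclidean_mfd tangent_const)

text \<open>Plays the part of uniqueness for differential equations. Near each time the curve stays
  in a translate of the chart domain at \<one>, where its coordinates have derivative zero;
  connectedness of the line does the rest.\<close>

lemma rld_zero_constant:
  assumes F: "\<And>t. has_rld F 0 t UNIV"
  shows "F t = F s"
proof (rule connected_local_const[of UNIV])
  show "\<forall>t\<in>UNIV. \<forall>\<^sub>F s in at t within UNIV. F t = F s"
  proof
    fix t0
    have carr: "F s \<in> carrier G" for s using has_rld_carrier[OF F] by blast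
    define P where "P s = F s \<otimes> inv (F t0)" for s
    have P0: "P t0 = \<one>" using carr by (simp add: P_def)
    have "\<forall>\<^sub>F s in at t0. P s \<in> fst c1"
      using tangent_near[of P] F[of t0] unfolding has_rld_def P_def by blast
    then obtain d where d: "d > 0" "\<And>s. s \<in> ball t0 d \<Longrightarrow> P s \<in> fst c1"
      using P0 c1(2) unfolding eventually_at by (metis dist_commute mem_ball UNIV_I)
    have "((\<lambda>s. \<kappa> (P s)) has_vector_derivative 0) (at s within ball t0 d)" if s: "s \<in> ball t0 d" for s
    proof -
      have Pc: "P s \<in> carrier G" using carr by (simp add: P_def)
      \<comment> \<open>The hypothesis concerns the quotient at time \<open>s\<close>, which passes
        through \<one>; right translation by \<open>P s\<close> is smooth and carries the vanishing
        derivative to \<open>P\<close> itself.\<close>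
      have "smooth_map (euclidean_open (\<kappa> ` fst c1)) K (\<lambda>a. \<kappa>' a \<otimes> P s)"
        by (intro smooth_mult smooth_const charted_euclidean_open open_\<kappa> smooth_\<kappa>' Pc)
      from smooth_on_has_derivative[OF smooth_\<kappa>(1)[OF open_\<kappa> this], of "\<kappa> \<one>"]
      have D: "((\<lambda>a. \<kappa> (\<kappa>' a \<otimes> P s)) has_derivative frechet_derivative (\<lambda>a. \<kappa> (\<kappa>' a \<otimes> P s)) (at (\<kappa> \<one>))) (at (\<kappa> \<one>))"
        using c1(2) Pc d(2)[OF s] by (auto simp: \<kappa>'_\<kappa>)
      have "tangent (\<lambda>s'. F s' \<otimes> inv (F s)) s UNIV 0" using F[of s] by (simp add: has_rld_def)
      from tangent_chain[OF this, of "\<lambda>g. \<kappa> (g \<otimes> P s)", OF D]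
      have "((\<lambda>s'. \<kappa> (F s' \<otimes> inv (F s) \<otimes> P s)) has_vector_derivative 0) (at s)"
        using linear_0[OF has_derivative_linear[OF D]] by simp
      moreover have "F s' \<otimes> inv (F s) \<otimes> P s = P s'" for s'
      proof -
        have "inv (F s) \<otimes> (F s \<otimes> z) = z" if "z \<in> carrier G" for z
          using carr that by (simp add: m_assoc[symmetric])
        then show ?thesis using carr by (simp add: P_def m_assoc)
      qed
      ultimately show ?thesis by (simp add: has_vector_derivative_at_within)
    qed
    then obtain k where k: "\<And>s. s \<in> ball t0 d \<Longrightarrow> \<kappa> (P s) = k"
      using has_vector_derivative_zero_constant[OF convex_ball] by metis
    have "F t0 = F s" if s: "s \<in> ball t0 d" for s
    proof -
      have "\<kappa> (P s) = \<kappa> (P t0)" using k[OF s] k[of t0] d(1) by simp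
      then have "P s = \<one>" using d(2)[OF s] P0 \<kappa>'_\<kappa> c1(2) by metis
      then show ?thesis using carr unfolding P_def by (metis inv_solve_right' l_one one_closed)
    qed
    then show "\<forall>\<^sub>F s in at t0 within UNIV. F t0 = F s"
      using d(1) unfolding eventually_at by (metis dist_commute mem_ball)
  qed
qed auto

text \<open>In the logarithmic derivative of \<open>inv (c' t) \<otimes> c t\<close> the two
  contributions cancel.\<close>

lemma one_param_unique:
  assumes c: "one_param c x" and c': "one_param c' x"
  shows "c = c'"
proof
  fix t
  let ?F = "\<lambda>t. inv (c' t) \<otimes> c t"
  have "has_rld ?F (- Ad G K (inv (c' t)) x + Ad G K (inv (c' t)) x) t UNIV" for t
    by (rule has_rld_mult[OF has_rld_inv[OF one_param_has_rld[OF c']] one_param_has_rld[OF c]])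
  then have "?F t = ?F 0" by (intro rld_zero_constant) simp
  then have "inv (c' t) \<otimes> c t = \<one>" using one_param_0[OF c] one_param_0[OF c'] by simp
  then show "c t = c' t"
    using one_param_carrier[OF c] one_param_carrier[OF c'] by (metis inv_equality inv_inv inv_closed)
qed

lemma lie_exp_one_param:
  assumes "one_param c x"
  shows "lie_exp G K (s *\<^sub>R x) = c s"
proof -
  have "(THE c'. one_param c' (s *\<^sub>R x)) = (\<lambda>t. c (s * t))"
    using one_param_scale[OF assms] one_param_unique by (intro the_equality) blast+
  then show ?thesis by (simp add: lie_exp_THE)
qed

end

section \<open>The exponential map\<close>

text \<open>Existence of one-parameter subgroups is isolated as an assumption because no flow of a
  vector field is constructed; it is discharged later from the injectivity radius.\<close>

locale lie_grp_exp = lie_grp G K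
  for G :: "('k, 'z) monoid_scheme" (structure) and K :: "('k, 'g::euclidean_space) mfd" +
  assumes one_param_exists: "\<exists>c. one_param c x"
begin

abbreviation E :: "'g \<Rightarrow> 'k" where "E \<equiv> lie_exp G K"

lemma exp_one_param: "one_param (\<lambda>s. E (s *\<^sub>R x)) x"
proof -
  obtain c where "one_param c x" using one_param_exists by blast
  moreover from this have "c = (\<lambda>s. E (s *\<^sub>R x))" by (intro ext) (simp add: lie_exp_one_param)
  ultimately show ?thesis by simp
qed

lemma exp_carrier: "E x \<in> carrier G"
  using one_param_carrier[OF exp_one_param[of x], of 1] by simp

lemma exp_zero: "E 0 = \<one>"
  using one_param_0[OF exp_one_param] by simp

lemma exp_add: "E ((s + t) *\<^sub>R x) = E (s *\<^sub>R x) \<otimes> E (t *\<^sub>R x)"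
  by (rule one_param_add[OF exp_one_param])

lemma exp_minus: "inv (E x) = E (- x)"
  using one_param_minus[OF exp_one_param[of x], of 1] by simp

lemma exp_has_rld: "has_rld (\<lambda>s. E (s *\<^sub>R x)) x t UNIV"
  by (rule one_param_has_rld[OF exp_one_param])

lemma exp_conj:
  assumes "g \<in> carrier G"
  shows "g \<otimes> E x \<otimes> inv g = E (Ad G K g x)"
  using lie_exp_one_param[OF one_param_conj[OF exp_one_param assms], of 1] by simp

lemma exp_tangent: "tangent (\<lambda>s. E (s *\<^sub>R x)) 0 UNIV x"
  by (rule one_param_tangent[OF exp_one_param])

lemma Ad_fixedI:
  assumes g: "g \<in> carrier G" and eq: "\<And>s. g \<otimes> E (s *\<^sub>R y) \<otimes> inv g = E (s *\<^sub>R y)"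
  shows "Ad G K g y = y"
  by (rule Ad_eqI[OF g exp_tangent]) (simp add: eq exp_tangent)

lemma Ad_exp_self: "Ad G K (E (s *\<^sub>R w)) w = w"
proof (rule Ad_fixedI[OF exp_carrier])
  fix t
  have "E (s *\<^sub>R w) \<otimes> E (t *\<^sub>R w) = E (t *\<^sub>R w) \<otimes> E (s *\<^sub>R w)"
    by (simp only: exp_add[symmetric] add.commute)
  then show "E (s *\<^sub>R w) \<otimes> E (t *\<^sub>R w) \<otimes> inv E (s *\<^sub>R w) = E (t *\<^sub>R w)"
    by (simp add: m_assoc exp_carrier)
qed

text \<open>A one-parameter subgroup commutes with itself, so \<open>Ad (E (s w)) w\<close> is
  constant in \<open>s\<close>; its derivative is this bracket.\<close>

lemma bracket_self: "bracket w w = 0"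
  by (rule bracket_eqI[OF exp_tangent]) (simp add: Ad_exp_self)

lemma bracket_antisym: "bracket x y = - bracket y x"
proof -
  have "bracket (x + y) (x + y) = bracket x y + bracket y x"
    using bracket_self[of x] bracket_self[of y]
    by (simp add: linear_add[OF linear_bracket_left] linear_add[OF linear_bracket_right])
  then have "bracket x y + bracket y x = 0" by (simp only: bracket_self)
  then show ?thesis by (simp only: eq_neg_iff_add_eq_0)
qed

text \<open>The derivative pairs \<open>y\<close> with the bracket of \<open>X t\<close> and the
  moving vector \<open>Ad (\<gamma> t) w\<close>; hence the hypothesis on \<open>y\<close> for every
  \<open>w\<close>.\<close>

lemma ip_Ad_constant:
  assumes T: "convex T" "t \<in> T" "s \<in> T"
    and rld: "\<And>t. t \<in> T \<Longrightarrow> has_rld \<gamma> (X t) t T"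
    and X: "\<And>t w. t \<in> T \<Longrightarrow> ip y (bracket (X t) w) = 0"
  shows "ip y (Ad G K (\<gamma> t) w) = ip y (Ad G K (\<gamma> s) w)"
proof -
  have bl: "bounded_linear (ip y)" using linear_ip_right linear_conv_bounded_linear by blast
  have "((\<lambda>t. ip y (Ad G K (\<gamma> t) w)) has_vector_derivative 0) (at t within T)" if "t \<in> T" for t
    using bounded_linear.has_vector_derivative[OF bl has_rld_Ad[OF rld[OF that]], of w] X[OF that] by simp
  from has_vector_derivative_zero_constant[OF T(1) this] obtain k
    where "\<And>t. t \<in> T \<Longrightarrow> ip y (Ad G K (\<gamma> t) w) = k" by metis
  then show ?thesis using T(2,3) by simp
qed

lemma ip_Ad_exp:
  assumes "\<And>w. ip y (bracket u w) = 0"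
  shows "ip y (Ad G K (E (s *\<^sub>R u)) w) = ip y w"
  using ip_Ad_constant[where T=UNIV and t=s and s=0 and y=y and w=w and X="\<lambda>_. u",
      OF convex_UNIV UNIV_I UNIV_I exp_has_rld] assms
  by (simp add: exp_zero Ad_one)

lemma exp_line_has_rld:
  assumes U: "open U" "smooth_map (euclidean_open U) K E" and v: "v \<in> U"
  shows "has_rld (\<lambda>\<tau>. E (v + \<tau> *\<^sub>R x)) (mc E v x) 0 UNIV"
proof (rule has_rld_local)
  let ?z = "\<lambda>\<tau>::real. v + \<tau> *\<^sub>R x"
  let ?J = "?z -` U"
  show "open ?J" by (rule open_vimage[OF U(1)]) (intro continuous_intros)
  have "(?z has_vector_derivative x) (at 0 within ?J \<inter> UNIV)"
    by (auto intro!: derivative_eq_intros)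
  then have "has_rld (\<lambda>\<tau>. E (?z \<tau>)) (mc E (?z 0) x) 0 (?J \<inter> UNIV)"
    by (rule has_rld_mc[OF U]) (use v in auto)
  then show "has_rld (\<lambda>\<tau>. E (?z \<tau>)) (mc E v x) 0 (?J \<inter> UNIV)" by simp
qed (simp add: exp_carrier)

lemma mc_exp_zero:
  assumes "open U" "smooth_map (euclidean_open U) K E" "0 \<in> U"
  shows "mc E 0 w = w"
  using has_rld_unique[OF exp_line_has_rld[OF assms, of w]] exp_has_rld[of w 0] by simp

text \<open>
  With \<open>Z s\<close> the logarithmic derivative at \<open>\<tau> = 0\<close> of \<open>E (s (u + \<tau> w))\<close>, the law
  \<open>Z (s + s') = Z s + Ad (E (s u)) (Z s')\<close> makes \<open>ip y (Z s)\<close> additive in \<open>s\<close>, so that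
  \<open>ip y (Z 1)\<close> is the limit of \<open>n * ip y (Z (1/n))\<close>; this replaces the usual formula for the
  differential of the exponential map.
\<close>

lemma ip_mc_exp:
  assumes B: "open B" "smooth_map (euclidean_open B) K E" "\<And>s. s \<in> {0..1} \<Longrightarrow> s *\<^sub>R u \<in> B"
    and y: "\<And>s w. ip y (Ad G K (E (s *\<^sub>R u)) w) = ip y w"
  shows "ip y (mc E u w) = ip y w"
proof -
  define Z where "Z s = mc E (s *\<^sub>R u) (s *\<^sub>R w)" for s
  note rld = exp_line_has_rld[OF B(1,2)]
  have Z: "has_rld (\<lambda>\<tau>. E (s *\<^sub>R (u + \<tau> *\<^sub>R w))) (Z s) 0 UNIV" if "s \<in> {0..1}" for s
    using rld[OF B(3)[OF that], of "s *\<^sub>R w"] by (simp add: Z_def scaleR_add_right mult.commute)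
  have add: "ip y (Z (s + s')) = ip y (Z s) + ip y (Z s')"
    if "s \<in> {0..1}" "s' \<in> {0..1}" "s + s' \<in> {0..1}" for s s'
  proof -
    have "has_rld (\<lambda>\<tau>. E ((s + s') *\<^sub>R (u + \<tau> *\<^sub>R w))) (Z s + Ad G K (E (s *\<^sub>R u)) (Z s')) 0 UNIV"
      using has_rld_mult[OF Z[OF that(1)] Z[OF that(2)]] by (simp add: exp_add)
    then have "Z (s + s') = Z s + Ad G K (E (s *\<^sub>R u)) (Z s')"
      using has_rld_unique[OF Z[OF that(3)]] by simp
    then show ?thesis by (simp add: linear_add[OF linear_ip_right] y)
  qed
  have Z1: "ip y (mc E u w) = ip y (mc E (inverse (real (Suc n)) *\<^sub>R u) w)" for n
  proof -
    let ?r = "inverse (real (Suc n))"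
    have r: "?r \<in> {0..1}" by (simp add: field_simps)
    have "ip y (Z (real (Suc k) * ?r)) = real (Suc k) * ip y (Z ?r)" if "k \<le> n" for k
      using that
    proof (induction k)
      case (Suc k)
      have kn: "real (Suc k) * ?r \<in> {0..1}" "real (Suc k) * ?r + ?r \<in> {0..1}"
        using Suc.prems by (auto simp: field_simps)
      have "real (Suc (Suc k)) * ?r = real (Suc k) * ?r + ?r"
        by (simp add: distrib_right)
      then have "ip y (Z (real (Suc (Suc k)) * ?r)) = ip y (Z (real (Suc k) * ?r)) + ip y (Z ?r)"
        using add[OF kn(1) r kn(2)] by (simp only:)
      then show ?case using Suc by (simp add: distrib_right)
    qed simp
    from this[of n] have "ip y (Z 1) = real (Suc n) * ip y (Z ?r)" by simp
    \<comment> \<open>Linearity in the direction cancels the factor \<open>Suc n\<close>: the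
      pairing is unchanged when the base point shrinks from \<open>u\<close> to
      \<open>?r *\<^sub>R u\<close>.\<close>
    also have "Z ?r = ?r *\<^sub>R mc E (?r *\<^sub>R u) w"
      unfolding Z_def by (rule linear_scale[OF linear_mc[OF B(1,2) B(3)[OF r]]])
    finally show ?thesis by (simp add: Z_def linear_scale[OF linear_ip_right])
  qed
  have 0: "(0::'g) \<in> B" using B(3)[of 0] by simp
  note mc0 = mc_exp_zero[OF B(1,2) 0, of w]
  have "continuous_on {0..1} (\<lambda>s. mc E (s *\<^sub>R u) w)"
    by (rule continuous_on_mc[OF B(1,2)]) (use B(3) in \<open>auto intro!: continuous_intros\<close>)
  then have "continuous_on {0..1} (\<lambda>s. ip y (mc E (s *\<^sub>R u) w))"
    using bounded_linear.continuous_on linear_ip_right linear_conv_bounded_linear by blast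
  moreover have "(\<lambda>n. inverse (real (Suc n))) \<longlonglongrightarrow> 0" by (rule LIMSEQ_inverse_real_of_nat)
  moreover have "\<forall>\<^sub>F n in sequentially. inverse (real (Suc n)) \<in> {0..1}"
    by (auto simp: field_simps intro!: always_eventually)
  ultimately have "(\<lambda>n. ip y (mc E (inverse (real (Suc n)) *\<^sub>R u) w)) \<longlonglongrightarrow> ip y (mc E (0 *\<^sub>R u) w)"
    using continuous_on_tendsto_compose[of "{0..1::real}"] by fastforce
  then have "(\<lambda>n::nat. ip y (mc E u w)) \<longlonglongrightarrow> ip y w" using Z1 mc0 by simp
  then show ?thesis by (simp add: LIMSEQ_const_iff)
qed

end

section \<open>The generalized Hofer norm\<close>

text \<open>\<open>S\<close> abstracts the image of the moment map: its \<open>Ad\<close>-invariance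
  comes from equivariance, and compactness makes the suprema and infima in the norm
  attained.\<close>

locale lie_grp_set = lie_grp G K
  for G :: "('k, 'z) monoid_scheme" (structure) and K :: "('k, 'g::euclidean_space) mfd" +
  fixes S :: "'g set"
  assumes compact_S: "compact S" and nonempty_S: "S \<noteq> {}"
    and Ad_S: "g \<in> carrier G \<Longrightarrow> y \<in> S \<Longrightarrow> Ad G K g y \<in> S"
begin

abbreviation N :: "'g \<Rightarrow> real" where "N \<equiv> hofer_norm G K S"

definition maximal :: "'g \<Rightarrow> 'g \<Rightarrow> bool" where
  "maximal p x \<longleftrightarrow> p \<in> S \<and> (\<forall>y\<in>S. ip y x \<le> ip p x)"

definition minimal :: "'g \<Rightarrow> 'g \<Rightarrow> bool" where
  "minimal p x \<longleftrightarrow> p \<in> S \<and> (\<forall>y\<in>S. ip p x \<le> ip y x)"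

lemma extremal_exist: obtains p q where "maximal p x" "minimal q x"
proof -
  have "continuous_on S (\<lambda>y. ip y x)"
    by (rule linear_continuous_on) (use linear_ip_left linear_conv_bounded_linear in blast)
  then show thesis
    using continuous_attains_sup[OF compact_S nonempty_S] continuous_attains_inf[OF compact_S nonempty_S] that
    unfolding maximal_def minimal_def by metis
qed

lemma hofer_norm_extremal: "maximal p x \<Longrightarrow> minimal q x \<Longrightarrow> N x = ip p x - ip q x"
  unfolding hofer_norm_def maximal_def minimal_def
  by (intro arg_cong2[where f="(-)"] cSup_eq_maximum cInf_eq_minimum) auto

text \<open>Every pair of points of \<open>S\<close> gives a linear minorant of \<open>N\<close>.
  Together with equality for an extremal pair, this is the working description of the norm.\<close>

lemma hofer_norm_ge: "p \<in> S \<Longrightarrow> q \<in> S \<Longrightarrow> ip p x - ip q x \<le> N x"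
  by (rule extremal_exist[of x])
    (auto simp: hofer_norm_extremal maximal_def minimal_def intro!: diff_mono)

lemma hofer_norm_triangle: "N (x + y) \<le> N x + N y"
proof -
  obtain p q where pq: "maximal p (x + y)" "minimal q (x + y)" by (rule extremal_exist)
  then have "p \<in> S" "q \<in> S" by (auto simp: maximal_def minimal_def)
  then show ?thesis
    using hofer_norm_ge[of p q x] hofer_norm_ge[of p q y]
    by (simp add: hofer_norm_extremal[OF pq] linear_add[OF linear_ip_right])
qed

lemma hofer_norm_minus: "N (- x) = N x"
proof -
  have "N (- x) \<le> N x" for x
  proof -
    obtain p q where pq: "maximal p (- x)" "minimal q (- x)" by (rule extremal_exist)
    then have "q \<in> S" "p \<in> S" by (auto simp: maximal_def minimal_def)
    then show ?thesis
      using hofer_norm_ge[of q p x] by (simp add: hofer_norm_extremal[OF pq] linear_neg[OF linear_ip_right])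
  qed
  from this[of x] this[of "- x"] show ?thesis by simp
qed

lemma hofer_norm_scale_pos:
  assumes "0 \<le> r"
  shows "N (r *\<^sub>R x) = r * N x"
proof -
  obtain p q where pq: "maximal p x" "minimal q x" by (rule extremal_exist)
  then have "maximal p (r *\<^sub>R x)" "minimal q (r *\<^sub>R x)"
    using assms by (auto simp: maximal_def minimal_def linear_scale[OF linear_ip_right] mult_left_mono)
  then show ?thesis
    by (simp add: hofer_norm_extremal[OF pq] hofer_norm_extremal linear_scale[OF linear_ip_right]
        right_diff_distrib)
qed

lemma hofer_norm_scale: "N (r *\<^sub>R x) = \<bar>r\<bar> * N x"
  using hofer_norm_scale_pos[of r x] hofer_norm_scale_pos[of "- r" "- x"] hofer_norm_minus[of x]
  by (cases "0 \<le> r") auto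

lemma hofer_norm_0: "N 0 = 0"
  using hofer_norm_scale[of 0 0] by simp

lemma hofer_norm_nonneg: "0 \<le> N x"
  using hofer_norm_triangle[of x "- x"] by (simp add: hofer_norm_minus hofer_norm_0)

text \<open>\<open>Ad\<close> is moved across the invariant form onto \<open>S\<close>, which it
  preserves.\<close>

lemma hofer_norm_Ad:
  assumes g: "g \<in> carrier G"
  shows "N (Ad G K g x) = N x"
proof -
  have "N (Ad G K g x) \<le> N x" if g: "g \<in> carrier G" for g x
  proof -
    obtain p q where pq: "maximal p (Ad G K g x)" "minimal q (Ad G K g x)" by (rule extremal_exist)
    then have "p \<in> S" "q \<in> S" by (auto simp: maximal_def minimal_def)
    then have "ip (Ad G K (inv g) p) x - ip (Ad G K (inv g) q) x \<le> N x"
      using g by (intro hofer_norm_ge Ad_S) auto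
    then show ?thesis using g by (simp add: hofer_norm_extremal[OF pq] ip_Ad_left)
  qed
  from this[OF g, of x] this[OF inv_closed[OF g], of "Ad G K g x"] show ?thesis
    using g by (simp add: Ad_inv_left)
qed

lemma continuous_on_hofer_norm: "continuous_on T N"
proof -
  have "convex_on UNIV N"
    unfolding convex_on_def
    using hofer_norm_triangle hofer_norm_scale_pos by (auto simp: convex_UNIV) (metis hofer_norm_triangle hofer_norm_scale_pos)
  then have "continuous_on UNIV N" by (rule convex_on_continuous[OF open_UNIV])
  then show ?thesis by (rule continuous_on_subset) simp
qed

lemma open_hofer_ball: "open {v. N v < r}"
  by (intro open_Collect_less continuous_on_hofer_norm continuous_intros)

end

section \<open>Consequences of a positive injectivity radius on a compact group\<close>

locale hofer_grp = lie_grp_set G K S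
  for G :: "('k, 'z) monoid_scheme" (structure) and K :: "('k, 'g::euclidean_space) mfd"
    and S :: "'g set" +
  fixes R :: real
  assumes compact_K: "compact_space (Top K)"
    and injectivity: "injectivity_radius G K S R"
begin

abbreviation B :: "'g set" where "B \<equiv> {v. N v < R}"
abbreviation W :: "'k set" where "W \<equiv> lie_exp G K ` B"
abbreviation lg :: "'k \<Rightarrow> 'g" where "lg \<equiv> inv_into B (lie_exp G K)"

lemma R_pos: "R > 0"
  and openin_W: "openin (Top K) W"
  and exp_diffeomorphism: "diffeomorphism (euclidean_open B) (open_submfd K W) (lie_exp G K)"
  using injectivity by (simp_all add: injectivity_radius_def exp_diffeo_radius_def Let_def)

lemma inj_on_exp: "inj_on (lie_exp G K) B"
  using exp_diffeomorphism by (simp add: diffeomorphism_def bij_betw_def)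

lemma zero_in_B: "0 \<in> B"
  using R_pos by (simp add: hofer_norm_0)

lemma scaled_in_B: "v \<in> B \<Longrightarrow> s \<in> {0..1} \<Longrightarrow> s *\<^sub>R v \<in> B"
  using mult_left_le_one_le[OF hofer_norm_nonneg, of s v] by (simp add: hofer_norm_scale_pos)

lemma exists_small_multiple: "\<exists>n. inverse (real (Suc n)) *\<^sub>R x \<in> B"
proof -
  have "(\<lambda>n. inverse (real (Suc n)) * N x) \<longlonglongrightarrow> 0 * N x"
    by (intro tendsto_intros LIMSEQ_inverse_real_of_nat)
  then have "\<forall>\<^sub>F n in sequentially. inverse (real (Suc n)) * N x < R"
    using R_pos order_tendstoD(2) by fastforce
  then obtain n where "inverse (real (Suc n)) * N x < R"
    by (meson eventually_sequentially order_refl)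
  then show ?thesis by (intro exI[of _ n]) (simp add: hofer_norm_scale)
qed

text \<open>
  If no one-parameter subgroup had velocity \<open>x \<in> B\<close>, then none would have velocity \<open>x / 2\<close>, and
  \<open>lie_exp\<close> would take the same unspecified value at \<open>x\<close> and \<open>x / 2\<close>, against injectivity.
\<close>

lemma one_param_exists_B:
  assumes x: "x \<in> B"
  shows "\<exists>c. one_param c x"
proof (rule ccontr)
  assume "\<not> ?thesis"
  then have 1: "one_param c x = False" for c by simp
  have 2: "one_param c ((1/2) *\<^sub>R x) = False" for c
    using one_param_scale[of c "(1/2) *\<^sub>R x" 2] 1 by auto
  have "lie_exp G K x = lie_exp G K ((1/2) *\<^sub>R x)"
    unfolding lie_exp_THE 1 2 ..
  moreover have "(1/2) *\<^sub>R x \<in> B" by (rule scaled_in_B[OF x]) simp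
  ultimately have "x = (1/2) *\<^sub>R x" using inj_on_exp x by (meson inj_onD)
  then have "(1/2) *\<^sub>R x = 0" by (metis add_cancel_right_left scaleR_half_double scaleR_right_distrib)
  then have "x = 0" by simp
  then show False using 1 one_param_zero by blast
qed

text \<open>Speeding up the subgroup of a small multiple of \<open>x\<close> extends existence from
  \<open>B\<close> to the whole Lie algebra.\<close>

sublocale lie_grp_exp G K
proof
  fix x
  obtain n where n: "inverse (real (Suc n)) *\<^sub>R x \<in> B" using exists_small_multiple by blast
  obtain c where "one_param c (inverse (real (Suc n)) *\<^sub>R x)" using one_param_exists_B[OF n] by blast
  from one_param_scale[OF this, of "real (Suc n)"] show "\<exists>c. one_param c x" by auto
qed

lemma charted_W: "charted (open_submfd K W)"
  by (rule charted_open_submfd[OF charted_K openin_W])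

lemma smooth_exp: "smooth_map (euclidean_open B) K E"
  using exp_diffeomorphism
  by (auto simp: diffeomorphism_def intro: smooth_map_open_submfdD(1)[OF charted_euclidean_open[OF open_hofer_ball] charted_K])

lemma smooth_lg: "smooth_map (open_submfd K W) (euclidean_open B) lg"
  using exp_diffeomorphism by (simp add: diffeomorphism_def)

lemma lg_exp: "v \<in> B \<Longrightarrow> lg (E v) = v"
  by (rule inv_into_f_f[OF inj_on_exp])

lemma exp_lg: "g \<in> W \<Longrightarrow> E (lg g) = g"
  and lg_in_B: "g \<in> W \<Longrightarrow> lg g \<in> B"
  by (simp_all only: f_inv_into_f inv_into_into)

text \<open>
  If \<open>N x = 0\<close> then all multiples of \<open>x\<close> lie in \<open>B\<close>, while by compactness some difference of two
  distinct multiples exponentiates to an element close to \<open>\<one>\<close>; continuity of \<open>lg\<close> then makes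
  that difference small.
\<close>

lemma hofer_norm_definite:
  assumes Nx: "N x = 0"
  shows "x = 0"
proof (rule ccontr)
  assume x: "x \<noteq> 0"
  have multB: "r *\<^sub>R x \<in> B" for r using Nx R_pos by (simp add: hofer_norm_scale)
  define V where "V = {g \<in> W. lg g \<in> ball 0 (norm x)}"
  have WK: "pts K \<inter> W = W" using exp_carrier pts_K by auto
  have "openin (Top (open_submfd K W)) {g \<in> pts (open_submfd K W). lg g \<in> B \<inter> ball 0 (norm x)}"
    by (rule openin_continuous_map_preimage[OF smooth_map_continuous[OF smooth_lg]])
      (simp add: openin_subtopology_Int2)
  moreover have "{g \<in> pts (open_submfd K W). lg g \<in> B \<inter> ball 0 (norm x)} = V"
    using lg_in_B by (auto simp: V_def open_submfd_def WK)
  ultimately have "openin (subtopology (Top K) W) V" by (simp add: open_submfd_def)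
  then have V: "openin (Top K) V" using openin_W openin_trans_full by blast
  have V1: "\<one> \<in> V"
    using x zero_in_B lg_exp[OF zero_in_B] exp_zero by (force simp: V_def)
  \<comment> \<open>\<open>Q\<close> is a neighbourhood of the diagonal consisting of pairs with
    quotient in \<open>V\<close>. Compactness covers \<open>K\<close> by finitely many sets whose
    squares lie in \<open>Q\<close>.\<close>
  define Q where "Q = {p \<in> topspace (prod_topology (Top K) (Top K)). fst p \<otimes> inv (snd p) \<in> V}"
  have ch: "charted (prod_mfd K K)" by (rule charted_prod[OF charted_K charted_K])
  have "continuous_map (prod_topology (Top K) (Top K)) (Top K) (\<lambda>p. fst p \<otimes> inv (snd p))"
  proof -
    have "continuous_map (prod_topology (Top K) (Top K)) (prod_topology (Top K) (Top K)) (\<lambda>p. (fst p, inv (snd p)))"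
      using continuous_map_compose[OF continuous_map_snd smooth_map_continuous[OF smooth_map_inv]]
      by (intro continuous_map_pairedI continuous_map_fst) (simp add: o_def)
    from continuous_map_compose[OF this, of "Top K" "\<lambda>(g, h). g \<otimes> h"] smooth_map_continuous[OF smooth_map_mult]
    show ?thesis by (simp add: prod_mfd_def o_def)
  qed
  then have Q: "openin (prod_topology (Top K) (Top K)) Q"
    unfolding Q_def using openin_continuous_map_preimage V by blast
  have "\<exists>A. openin (Top K) A \<and> g \<in> A \<and> A \<times> A \<subseteq> Q" if g: "g \<in> carrier G" for g
  proof -
    have "(g, g) \<in> Q" using g V1 by (simp add: Q_def pts_K)
    then obtain A A' where "openin (Top K) A" "openin (Top K) A'" "g \<in> A" "g \<in> A'" "A \<times> A' \<subseteq> Q"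
      using Q unfolding openin_prod_topology_alt by meson
    then show ?thesis by (intro exI[of _ "A \<inter> A'"]) auto
  qed
  then obtain A where A: "\<And>g. g \<in> carrier G \<Longrightarrow> openin (Top K) (A g) \<and> g \<in> A g \<and> A g \<times> A g \<subseteq> Q"
    by metis
  obtain F where F: "finite F" "F \<subseteq> A ` carrier G" "pts K \<subseteq> \<Union>F"
    using compact_K A pts_K unfolding compact_space_alt
    by (smt (verit, ccfv_threshold) UN_I imageE subsetI)
  have "\<forall>n::nat. \<exists>U\<in>F. E (real n *\<^sub>R x) \<in> U"
    using F(3) exp_carrier pts_K by blast
  then obtain u where u: "\<And>n::nat. u n \<in> F" "\<And>n::nat. E (real n *\<^sub>R x) \<in> u n"
    by metis
  \<comment> \<open>Pigeonhole: infinitely many integer multiples of \<open>x\<close> are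
    distributed over finitely many sets, so two of them have a quotient in \<open>V\<close>.\<close>
  have "\<not> inj u" using F(1) u(1) by (metis finite_subset image_subsetI finite_imageD infinite_UNIV_nat)
  then obtain m n where mn: "m \<noteq> n" "u m = u n" unfolding inj_def by blast
  obtain g where g: "g \<in> carrier G" "u m = A g" using F(2) u(1) by blast
  have "(E (real m *\<^sub>R x), E (real n *\<^sub>R x)) \<in> Q"
    using A[OF g(1)] u(2)[of m] u(2)[of n] mn(2) g(2) by auto
  then have "E (real m *\<^sub>R x) \<otimes> inv (E (real n *\<^sub>R x)) \<in> V" by (simp add: Q_def)
  moreover have "E (real m *\<^sub>R x) \<otimes> inv (E (real n *\<^sub>R x)) = E ((real m - real n) *\<^sub>R x)"
    using exp_add[of "real m" "- real n" x] by (simp add: exp_minus)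
  ultimately have "lg (E ((real m - real n) *\<^sub>R x)) \<in> ball 0 (norm x)" by (simp add: V_def)
  then have "\<bar>real m - real n\<bar> * norm x < norm x" by (simp only: lg_exp[OF multB]) simp
  then have "\<bar>real m - real n\<bar> < 1" using x by simp
  then show False using mn(1) by linarith
qed

text \<open>A vector orthogonal to everything has norm 0, hence vanishes by definiteness.\<close>

lemma ip_nondegenerate:
  assumes "\<And>w. ip v w = ip v' w"
  shows "v = v'"
proof -
  have "ip (v - v') w = 0" for w
    using assms by (simp add: linear_diff[OF linear_ip_left])
  then have 0: "ip y (v - v') = 0" for y using ip_commute by metis
  obtain p q where "maximal p (v - v')" "minimal q (v - v')" by (rule extremal_exist)
  from hofer_norm_extremal[OF this] have "N (v - v') = 0" by (simp add: 0)
  then show ?thesis using hofer_norm_definite by fastforce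
qed

text \<open>The minimum of \<open>N\<close> on the Euclidean unit sphere is positive by
  definiteness, and it bounds the Euclidean norm by a multiple of \<open>N\<close>.\<close>

lemma compact_hofer_ball: "compact {v. N v \<le> r}"
proof (rule compact_eq_bounded_closed[THEN iffD2], rule conjI)
  show "closed {v. N v \<le> r}"
    by (intro closed_Collect_le continuous_on_hofer_norm continuous_intros)
  have "sphere (0::'g) 1 \<noteq> {}" using vector_choose_size[of 1] by fastforce
  then obtain v where v: "v \<in> sphere 0 1" "\<And>w. w \<in> sphere 0 1 \<Longrightarrow> N v \<le> N w"
    using continuous_attains_inf[OF compact_sphere _ continuous_on_hofer_norm] by metis
  have pos: "N v > 0"
    using hofer_norm_definite[of v] hofer_norm_nonneg[of v] v(1) by (cases "N v = 0") auto
  have le: "N v * norm w \<le> N w" for w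
  proof (cases "w = 0")
    case False
    then have "N v \<le> N ((1 / norm w) *\<^sub>R w)" by (intro v(2)) simp
    then show ?thesis using False by (simp add: hofer_norm_scale_pos field_simps)
  qed (simp add: hofer_norm_0)
  have "norm w \<le> r / N v" if "N w \<le> r" for w
    using order_trans[OF le that] pos by (simp add: field_simps)
  then show "bounded {v. N v \<le> r}" by (intro boundedI) auto
qed

text \<open>A closed ball of smaller radius has closed image in all of \<open>K\<close>, not merely
  in \<open>W\<close>; this keeps a lifted curve from escaping through the boundary of
  \<open>W\<close>.\<close>

lemma closedin_exp_ball:
  assumes "r < R"
  shows "closedin (Top K) (E ` {v. N v \<le> r})"
proof -
  have "compactin (top_of_set B) {v. N v \<le> r}"
    using compact_hofer_ball assms by (auto simp: compactin_subtopology)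
  then have "compactin (Top K) (E ` {v. N v \<le> r})"
    using image_compactin smooth_map_continuous[OF smooth_exp] by fastforce
  moreover have "Hausdorff_space (Top K)" using smooth_K by (simp add: smooth_manifold_def)
  ultimately show ?thesis by (rule compactin_imp_closedin[rotated])
qed

text \<open>The orbit of \<open>p\<close> under \<open>E (- s w)\<close> stays in \<open>S\<close>,
  so the pairing of the moved point with \<open>u\<close> has an extremum at \<open>s = 0\<close>;
  its derivative there is \<open>ip p (bracket w u)\<close>.\<close>

lemma extremal_bracket:
  assumes "maximal p u \<or> minimal p u"
  shows "ip p (bracket u w) = 0"
proof -
  let ?f = "\<lambda>s. ip p (Ad G K (E (s *\<^sub>R w)) u)"
  have bl: "bounded_linear (ip p)" using linear_ip_right linear_conv_bounded_linear by blast
  have "(?f has_vector_derivative ip p (bracket w u)) (at 0)"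
    by (rule bounded_linear.has_vector_derivative[OF bl tangent_Ad[OF exp_tangent]])
  then have d: "DERIV ?f 0 :> ip p (bracket w u)"
    by (simp add: has_real_derivative_iff_has_vector_derivative)
  have f0: "?f 0 = ip p u" by (simp add: exp_zero Ad_one)
  have f: "?f s = ip (Ad G K (E (- s *\<^sub>R w)) p) u" for s
    using ip_Ad_left[of "inv (E (s *\<^sub>R w))" p u] exp_carrier by (simp add: exp_minus)
  have S: "p \<in> S \<Longrightarrow> Ad G K (E (- s *\<^sub>R w)) p \<in> S" for s
    by (rule Ad_S[OF exp_carrier])
  have max: "?f s \<le> ?f 0" if "maximal p u" for s
    using S[of s] that unfolding f0 f[of s] maximal_def by blast
  have min: "?f 0 \<le> ?f s" if "minimal p u" for s
    using S[of s] that unfolding f0 f[of s] minimal_def by blast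
  have "ip p (bracket w u) = 0"
    using assms
  proof
    assume "maximal p u"
    then have "\<forall>s. \<bar>0 - s\<bar> < 1 \<longrightarrow> ?f s \<le> ?f 0"
      using max by blast
    then show ?thesis by (rule DERIV_local_max[OF d zero_less_one])
  next
    assume "minimal p u"
    then have "\<forall>s. \<bar>0 - s\<bar> < 1 \<longrightarrow> ?f 0 \<le> ?f s"
      using min by blast
    then show ?thesis by (rule DERIV_local_min[OF d zero_less_one])
  qed
  then show ?thesis by (simp add: bracket_antisym[of u w] linear_neg[OF linear_ip_right])
qed

lemma extremal_mc_exp:
  assumes "maximal p u \<or> minimal p u" "u \<in> B"
  shows "ip p (mc E u w) = ip p w"
  by (rule ip_mc_exp[OF open_hofer_ball smooth_exp scaled_in_B[OF assms(2)]
        ip_Ad_exp[OF extremal_bracket[OF assms(1)]]])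

end

section \<open>Piecewise C1 curves and their lengths\<close>

lemma piecewise_C1_curve_single:
  assumes "a < b" "C1_curve M a b \<gamma>"
  shows "piecewise_C1_curve M a b \<gamma>"
  unfolding piecewise_C1_curve_def
  by (intro exI[of _ 1] exI[of _ "\<lambda>i. if i = 0 then a else b"]) (use assms in simp)

lemma piecewise_C1_curve_snoc:
  assumes "piecewise_C1_curve M a b \<gamma>" "b < c" "C1_curve M b c \<gamma>"
  shows "piecewise_C1_curve M a c \<gamma>"
proof -
  obtain n :: nat and s where s: "s 0 = a" "s n = b"
    "\<forall>i<n. s i < s (Suc i) \<and> C1_curve M (s i) (s (Suc i)) \<gamma>"
    using assms(1) unfolding piecewise_C1_curve_def by blast
  show ?thesis
    unfolding piecewise_C1_curve_def
    by (intro exI[of _ "Suc n"] exI[of _ "s(Suc n := c)"]) (use s assms(2,3) in \<open>auto simp: less_Suc_eq\<close>)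
qed

text \<open>Hides partitions: \<open>a\<close> stays fixed while the right end point advances piece
  by piece, the form in which lengths and growth estimates accumulate.\<close>

lemma piecewise_C1_curve_induct [consumes 2, case_names single snoc]:
  assumes "piecewise_C1_curve M a b \<gamma>" "a < b"
    and single: "\<And>c. a < c \<Longrightarrow> c \<le> b \<Longrightarrow> C1_curve M a c \<gamma> \<Longrightarrow> P c"
    and snoc: "\<And>c d. a < c \<Longrightarrow> c < d \<Longrightarrow> d \<le> b \<Longrightarrow> piecewise_C1_curve M a c \<gamma> \<Longrightarrow> P c \<Longrightarrow>
      C1_curve M c d \<gamma> \<Longrightarrow> P d"
  shows "P b"
proof -
  obtain n :: nat and s where s: "s 0 = a" "s n = b"
    "\<And>i. i < n \<Longrightarrow> s i < s (Suc i)" "\<And>i. i < n \<Longrightarrow> C1_curve M (s i) (s (Suc i)) \<gamma>"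
    using assms(1) unfolding piecewise_C1_curve_def by blast
  have le: "s i \<le> b" if "i \<le> n" for i
    using that
  proof (induction rule: inc_induct)
    case (step i)
    then show ?case using s(3)[of i] by linarith
  qed (simp add: s)
  have "Suc i \<le> n \<Longrightarrow> a < s (Suc i) \<and> piecewise_C1_curve M a (s (Suc i)) \<gamma> \<and> P (s (Suc i))" for i
  proof (induction i)
    case 0
    then have "a < s (Suc 0)" "C1_curve M a (s (Suc 0)) \<gamma>" using s(1) s(3,4)[of 0] by auto
    then show ?case using le[OF 0] by (auto intro: single piecewise_C1_curve_single)
  next
    case (Suc i)
    then have "s (Suc i) < s (Suc (Suc i))" "C1_curve M (s (Suc i)) (s (Suc (Suc i))) \<gamma>"
      using s(3,4)[of "Suc i"] by auto
    then show ?case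
      using Suc le[OF Suc.prems] snoc[of "s (Suc i)" "s (Suc (Suc i))"]
        piecewise_C1_curve_snoc[of M a "s (Suc i)" \<gamma> "s (Suc (Suc i))"] by auto
  qed
  moreover have "n \<noteq> 0" using s(1,2) assms(2) by (metis less_irrefl)
  ultimately show ?thesis using s(2) by (metis Suc_pred order_refl not_gr_zero)
qed

lemma piecewise_C1_curve_subinterval:
  assumes "piecewise_C1_curve M a b \<gamma>" "a \<le> c" "c < d" "d \<le> b"
  shows "piecewise_C1_curve M c d \<gamma>"
proof -
  have "a < b" using assms by simp
  with assms(1) have "\<forall>c d. a \<le> c \<and> c < d \<and> d \<le> b \<longrightarrow> piecewise_C1_curve M c d \<gamma>"
  proof (induction rule: piecewise_C1_curve_induct)
    case (snoc e f)
    show ?case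
    proof (intro allI impI)
      fix c d assume cd: "a \<le> c \<and> c < d \<and> d \<le> f"
      consider "d \<le> e" | "e \<le> c" | "c < e" "e < d" by linarith
      then show "piecewise_C1_curve M c d \<gamma>"
      proof cases
        case 3
        have "C1_curve M e d \<gamma>" by (rule C1_curve_subinterval[OF snoc(5)]) (use cd 3 in auto)
        then show ?thesis using snoc(6) cd 3 piecewise_C1_curve_snoc[of M c e \<gamma> d] by simp
      qed (use snoc cd in \<open>auto intro: piecewise_C1_curve_single C1_curve_subinterval\<close>)
    qed
  qed (use assms in \<open>auto intro: piecewise_C1_curve_single C1_curve_subinterval\<close>)
  then show ?thesis using assms by blast
qed

lemma piecewise_C1_curve_continuous:
  assumes "piecewise_C1_curve M a b \<gamma>" "a < b"
  shows "continuous_map (top_of_set {a..b}) (Top M) \<gamma>"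
  using assms
proof (induction rule: piecewise_C1_curve_induct)
  case (single c)
  then show ?case by (simp add: C1_curve_continuous)
next
  case (snoc c d)
  have 2: "continuous_map (top_of_set {c..d}) (Top M) \<gamma>" by (rule C1_curve_continuous[OF snoc(5)])
  have ad: "{a..d} = {a..c} \<union> {c..d}" using snoc by auto
  show ?case
    unfolding continuous_map_closedin
  proof (intro conjI allI impI)
    show "\<gamma> \<in> topspace (top_of_set {a..d}) \<rightarrow> topspace (Top M)"
      using continuous_map_funspace[OF snoc(6)] continuous_map_funspace[OF 2] by (auto simp: ad)
    fix C assume "closedin (Top M) C"
    then have "closedin (top_of_set {a..c}) {t \<in> {a..c}. \<gamma> t \<in> C}"
      "closedin (top_of_set {c..d}) {t \<in> {c..d}. \<gamma> t \<in> C}"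
      using snoc(6) 2 unfolding continuous_map_closedin by auto
    then have "closed ({t \<in> {a..c}. \<gamma> t \<in> C} \<union> {t \<in> {c..d}. \<gamma> t \<in> C})"
      by (meson closed_Un closed_atLeastAtMost closedin_closed_trans)
    moreover have "{t \<in> {a..c}. \<gamma> t \<in> C} \<union> {t \<in> {c..d}. \<gamma> t \<in> C} = {t \<in> {a..d}. \<gamma> t \<in> C}"
      by (auto simp: ad)
    ultimately show "closedin (top_of_set {a..d}) {t \<in> topspace (top_of_set {a..d}). \<gamma> t \<in> C}"
      by (intro closed_subset) auto
  qed
qed

lemma piecewise_C1_curve_smooth_map:
  assumes "charted M" "charted M'" "smooth_map M M' f" "piecewise_C1_curve M a b \<gamma>" "a < b"
  shows "piecewise_C1_curve M' a b (\<lambda>t. f (\<gamma> t))"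
  using assms(4,5)
  by (induction rule: piecewise_C1_curve_induct)
    (auto intro: piecewise_C1_curve_single piecewise_C1_curve_snoc C1_curve_smooth_map[OF assms(1-3)])

text \<open>Once the partition points are removed, every time is interior to a piece, where
  derivatives within \<open>{p..q}\<close> and within \<open>{a..b}\<close> coincide.\<close>

lemma piecewise_C1_curve_pieces:
  assumes "piecewise_C1_curve M a b \<gamma>" "a < b"
  shows "\<exists>F. finite F \<and> (\<forall>t\<in>{a..b} - F. \<exists>p q. a \<le> p \<and> p < t \<and> t < q \<and> q \<le> b \<and> C1_curve M p q \<gamma>)"
  using assms
proof (induction rule: piecewise_C1_curve_induct)
  case (single c)
  have "\<exists>p q. a \<le> p \<and> p < t \<and> t < q \<and> q \<le> c \<and> C1_curve M p q \<gamma>" if "t \<in> {a..c} - {a, c}" for t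
    using that single by (intro exI[of _ a] exI[of _ c]) auto
  then show ?case by (intro exI[of _ "{a, c}"]) auto
next
  case (snoc c d)
  then obtain F where F: "finite F"
    "\<And>t. t \<in> {a..c} - F \<Longrightarrow> \<exists>p q. a \<le> p \<and> p < t \<and> t < q \<and> q \<le> c \<and> C1_curve M p q \<gamma>" by blast
  have "\<exists>p q. a \<le> p \<and> p < t \<and> t < q \<and> q \<le> d \<and> C1_curve M p q \<gamma>"
    if t: "t \<in> {a..d} - (F \<union> {c, d})" for t
  proof (cases "t < c")
    case True
    then obtain p q where "a \<le> p" "p < t" "t < q" "q \<le> c" "C1_curve M p q \<gamma>"
      using F(2)[of t] t by auto
    then show ?thesis using snoc by (intro exI[of _ p] exI[of _ q]) auto
  next
    case False
    then show ?thesis using snoc t by (intro exI[of _ c] exI[of _ d]) auto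
  qed
  then show ?case using F(1) by (intro exI[of _ "F \<union> {c, d}"]) auto
qed

text \<open>Here break points are covered too, at the price that \<open>t\<close> may be an end
  point of its piece.\<close>

lemma piecewise_C1_curve_piece_at:
  assumes "piecewise_C1_curve M a b \<gamma>" "a < b"
  shows "\<forall>t\<in>{a..b}. \<exists>p q. a \<le> p \<and> p < q \<and> q \<le> b \<and> t \<in> {p..q} \<and> C1_curve M p q \<gamma>"
  using assms
proof (induction rule: piecewise_C1_curve_induct)
  case (single c)
  then show ?case by (intro ballI exI[of _ a] exI[of _ c]) auto
next
  case (snoc c d)
  show ?case
  proof
    fix t assume t: "t \<in> {a..d}"
    show "\<exists>p q. a \<le> p \<and> p < q \<and> q \<le> d \<and> t \<in> {p..q} \<and> C1_curve M p q \<gamma>"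
    proof (cases "t \<le> c")
      case True
      then obtain p q where "a \<le> p" "p < q" "q \<le> c" "t \<in> {p..q}" "C1_curve M p q \<gamma>"
        using snoc(6) t by (meson atLeastAtMost_iff)
      then show ?thesis using snoc by (intro exI[of _ p] exI[of _ q]) auto
    next
      case False
      then show ?thesis using snoc t by (intro exI[of _ c] exI[of _ d]) auto
    qed
  qed
qed

text \<open>A mean value inequality for a function that need not be differentiable. A function
  touching \<open>F\<close> from below at \<open>t\<close> bounds the increments of \<open>F\<close>
  to the left of \<open>t\<close> from above. If the bound failed, the first time at which a tilted
  \<open>F\<close> reaches its final value would be preceded by a larger value.\<close>

lemma growth_bound:
  fixes F g :: "real \<Rightarrow> real"
  assumes pq: "p < q" and F: "continuous_on {p..q} F" and g: "continuous_on {p..q} g"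
    and touch: "\<And>t. t \<in> {p..q} \<Longrightarrow> \<exists>\<phi> \<phi>'. (\<phi> has_real_derivative \<phi>') (at t within {p..q}) \<and> \<phi>' \<le> g t \<and>
      \<phi> t = F t \<and> (\<forall>s\<in>{p..q}. \<phi> s \<le> F s)"
  shows "F q - F p \<le> integral {p..q} g"
proof (rule ccontr)
  assume less: "\<not> ?thesis"
  \<comment> \<open>Half of the excess, spread over the interval: the tilt makes slopes strictly
    negative and still leaves \<open>h p < h q\<close>.\<close>
  define \<epsilon> where "\<epsilon> = (F q - F p - integral {p..q} g) / (2 * (q - p))"
  have \<epsilon>: "\<epsilon> > 0" using less pq by (simp add: \<epsilon>_def)
  define h where "h t = F t - integral {p..t} g - \<epsilon> * (t - p)" for t
  have "X / (2 * D) * D = X / 2" if "D \<noteq> 0" for X D :: real using that by simp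
  then have "\<epsilon> * (q - p) = (F q - F p - integral {p..q} g) / 2"
    unfolding \<epsilon>_def by this (use pq in simp)
  then have hpq: "h p < h q" using less by (simp add: h_def)
  have "continuous_on {p..q} h"
    unfolding h_def
    by (intro continuous_intros F indefinite_integral_continuous_1 integrable_continuous_real g)
  then have "closed {t \<in> {p..q}. h q \<le> h t}"
    by (intro continuous_on_closed_Collect_le continuous_intros closed_atLeastAtMost)
  then have "compact {t \<in> {p..q}. h q \<le> h t}"
    by (metis (no_types, lifting) bounded_closed_interval bounded_subset compact_eq_bounded_closed
        mem_Collect_eq subsetI)
  moreover have "q \<in> {t \<in> {p..q}. h q \<le> h t}" using pq by simp
  ultimately obtain t where t: "t \<in> {p..q}" "h q \<le> h t"
    and t_min: "\<And>s. s \<in> {p..q} \<Longrightarrow> h q \<le> h s \<Longrightarrow> t \<le> s"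
    using compact_attains_inf[of "{t \<in> {p..q}. h q \<le> h t}"] by blast
  have tp: "t > p" using t hpq by (cases "t = p") auto
  obtain \<phi> \<phi>' where \<phi>: "(\<phi> has_real_derivative \<phi>') (at t within {p..q})" "\<phi>' \<le> g t" "\<phi> t = F t"
    "\<And>s. s \<in> {p..q} \<Longrightarrow> \<phi> s \<le> F s"
    using touch[OF t(1)] by blast
  \<comment> \<open>\<open>k\<close> lies below \<open>h\<close>, touches it at \<open>t\<close> and
    has slope at most \<open>- \<epsilon>\<close> there, so \<open>h\<close> exceeds
    \<open>h t\<close> at some earlier time, against the minimality of \<open>t\<close>.\<close>
  define k where "k s = \<phi> s - integral {p..s} g - \<epsilon> * (s - p)" for s
  have "(k has_real_derivative \<phi>' - g t - \<epsilon>) (at t within {p..q})"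
    unfolding k_def
    by (auto intro!: derivative_eq_intros \<phi>(1) integral_has_real_derivative g t(1))
  from has_real_derivative_neg_dec_left[OF this] \<phi>(2) \<epsilon>
  obtain d where d: "d > 0" "\<And>e. e > 0 \<Longrightarrow> t - e \<in> {p..q} \<Longrightarrow> e < d \<Longrightarrow> k t < k (t - e)" by auto
  define e where "e = min (t - p) (d / 2)"
  have e: "e > 0" "e < d" "t - e \<in> {p..q}" using tp d(1) t(1) by (auto simp: e_def)
  have "h t = k t" by (simp add: h_def k_def \<phi>(3))
  also have "\<dots> < k (t - e)" by (rule d(2)[OF e(1,3,2)])
  also have "\<dots> \<le> h (t - e)" using \<phi>(4)[OF e(3)] by (simp add: h_def k_def)
  finally have "h t < h (t - e)" .
  then have "t \<le> t - e" using t(2) by (intro t_min e(3)) simp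
  then show False using e(1) by simp
qed

section \<open>Logarithmic derivatives and lengths of piecewise C1 curves\<close>

context lie_grp
begin

lemma right_log_deriv_interior:
  assumes "a \<le> p" "q \<le> b" "C1_curve K p q \<gamma>" "p < t" "t < q"
    and "continuous_map (top_of_set {a..b}) (Top K) \<gamma>"
  shows "right_log_deriv G K a b \<gamma> t = right_log_deriv G K p q \<gamma> t"
  by (rule right_log_deriv_subinterval[OF assms(1) _ assms(2,3) _ assms(6)
        curve_differentiable_interior[OF assms(1-5)]]) (use assms in auto)

text \<open>At \<open>p\<close> and \<open>q\<close> the curve may have no derivative within
  \<open>{a..b}\<close>, leaving \<open>right_log_deriv\<close> unspecified there; two points do not
  affect the integral.\<close>

lemma has_integral_right_log_deriv:
  fixes h :: "'g \<Rightarrow> 'h::banach"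
  assumes "a \<le> p" "p < q" "q \<le> b" "C1_curve K p q \<gamma>"
    and "continuous_map (top_of_set {a..b}) (Top K) \<gamma>" and h: "continuous_on UNIV h"
  shows "((\<lambda>t. h (right_log_deriv G K a b \<gamma> t)) has_integral
    integral {p..q} (\<lambda>t. h (right_log_deriv G K p q \<gamma> t))) {p..q}"
proof (rule has_integral_spike_finite[of "{p, q}"])
  have "continuous_on {p..q} (\<lambda>t. h (right_log_deriv G K p q \<gamma> t))"
    by (rule continuous_on_compose2[OF h C1_curve_rld(1)[OF assms(2,4)]]) simp
  then show "((\<lambda>t. h (right_log_deriv G K p q \<gamma> t)) has_integral
      integral {p..q} (\<lambda>t. h (right_log_deriv G K p q \<gamma> t))) {p..q}"
    by (intro integrable_integral integrable_continuous_real)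
qed (use right_log_deriv_interior[OF assms(1,3,4) _ _ assms(5)] in auto)

lemma integrable_right_log_deriv:
  fixes h :: "'g \<Rightarrow> 'h::banach"
  assumes "piecewise_C1_curve K a b \<gamma>" "a < b" "continuous_on UNIV h"
  shows "(\<lambda>t. h (right_log_deriv G K a b \<gamma> t)) integrable_on {a..b}"
proof -
  define f where "f t = h (right_log_deriv G K a b \<gamma> t)" for t
  note ct = piecewise_C1_curve_continuous[OF assms(1,2)]
  have piece: "f integrable_on {p..q}" if "a \<le> p" "p < q" "q \<le> b" "C1_curve K p q \<gamma>" for p q
    using has_integral_right_log_deriv[OF that ct assms(3)] unfolding f_def by blast
  have "f integrable_on {a..b}"
    using assms(1,2)
  proof (induction rule: piecewise_C1_curve_induct)
    case (single c)
    then show ?case by (simp add: piece)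
  next
    case (snoc c d)
    then show ?case
      using piece[of c d] by (intro Henstock_Kurzweil_Integration.integrable_combine[of a c d]) auto
  qed
  then show ?thesis by (simp add: f_def[abs_def])
qed

end

context lie_grp_set
begin

abbreviation len :: "real \<Rightarrow> real \<Rightarrow> (real \<Rightarrow> 'k) \<Rightarrow> real" where
  "len \<equiv> path_length G K S"

lemma integrable_hofer_norm:
  assumes "piecewise_C1_curve K a b \<gamma>" "a < b"
  shows "(\<lambda>t. N (right_log_deriv G K a b \<gamma> t)) integrable_on {a..b}"
  by (rule integrable_right_log_deriv[OF assms continuous_on_hofer_norm])

text \<open>The definition of length on \<open>{c..d}\<close> uses derivatives within that interval,
  so the two integrands may differ, but only at finitely many times.\<close>

lemma len_subinterval:
  assumes \<gamma>: "piecewise_C1_curve K a b \<gamma>" and ab: "a \<le> c" "c < d" "d \<le> b"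
  shows "len c d \<gamma> = integral {c..d} (\<lambda>t. N (right_log_deriv G K a b \<gamma> t))"
proof -
  have cd: "piecewise_C1_curve K c d \<gamma>" by (rule piecewise_C1_curve_subinterval[OF \<gamma> ab])
  have ct: "continuous_map (top_of_set {a..b}) (Top K) \<gamma>"
    by (rule piecewise_C1_curve_continuous[OF \<gamma>]) (use ab in simp)
  obtain F where F: "finite F"
    "\<And>t. t \<in> {c..d} - F \<Longrightarrow> \<exists>p q. c \<le> p \<and> p < t \<and> t < q \<and> q \<le> d \<and> C1_curve K p q \<gamma>"
    using piecewise_C1_curve_pieces[OF cd ab(2)] by blast
  have "right_log_deriv G K a b \<gamma> t = right_log_deriv G K c d \<gamma> t" if t: "t \<in> {c..d} - F" for t
  proof -
    obtain p q where pq: "c \<le> p" "p < t" "t < q" "q \<le> d" "C1_curve K p q \<gamma>" using F(2)[OF t] by blast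
    then show ?thesis
      using right_log_deriv_interior[of a p q b \<gamma> t] right_log_deriv_interior[of c p q d \<gamma> t] ab ct
        piecewise_C1_curve_continuous[OF cd ab(2)] by simp
  qed
  then show ?thesis
    unfolding path_length_def
    by (intro integral_spike[OF negligible_finite[OF F(1)]]) simp
qed

lemma len_nonneg:
  assumes "piecewise_C1_curve K a b \<gamma>" "a < b"
  shows "0 \<le> len a b \<gamma>"
  unfolding path_length_def
  by (rule integral_nonneg[OF integrable_hofer_norm[OF assms]]) (rule hofer_norm_nonneg)

lemma len_split:
  assumes \<gamma>: "piecewise_C1_curve K a b \<gamma>" and c: "a < c" "c < b"
  shows "len a c \<gamma> + len c b \<gamma> = len a b \<gamma>"
proof -
  have ab: "a < b" using c by simp
  show ?thesis
    using len_subinterval[OF \<gamma>, of a c] len_subinterval[OF \<gamma>, of c b] c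
      Henstock_Kurzweil_Integration.integral_combine[OF _ _ integrable_hofer_norm[OF \<gamma> ab], of c]
    by (simp add: path_length_def[of G K S a b])
qed

lemma len_mono:
  assumes \<gamma>: "piecewise_C1_curve K a b \<gamma>" and c: "a < c" "c \<le> b"
  shows "len a c \<gamma> \<le> len a b \<gamma>"
proof (cases "c = b")
  case False
  then have "0 \<le> len c b \<gamma>"
    using c by (intro len_nonneg piecewise_C1_curve_subinterval[OF \<gamma>]) auto
  then show ?thesis using len_split[OF \<gamma>, of c] c False by simp
qed simp

lemma len_cong:
  assumes \<gamma>: "piecewise_C1_curve K a b \<gamma>" and \<eta>: "piecewise_C1_curve K a b \<eta>" and ab: "a < b"
    and eq: "\<And>p q t. a \<le> p \<Longrightarrow> q \<le> b \<Longrightarrow> p < q \<Longrightarrow> t \<in> {p..q} \<Longrightarrow> C1_curve K p q \<gamma> \<Longrightarrow>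
      C1_curve K p q \<eta> \<and> N (right_log_deriv G K p q \<eta> t) = N (right_log_deriv G K p q \<gamma> t)"
  shows "len a b \<eta> = len a b \<gamma>"
proof -
  obtain F where F: "finite F"
    "\<And>t. t \<in> {a..b} - F \<Longrightarrow> \<exists>p q. a \<le> p \<and> p < t \<and> t < q \<and> q \<le> b \<and> C1_curve K p q \<gamma>"
    using piecewise_C1_curve_pieces[OF \<gamma> ab] by blast
  have "N (right_log_deriv G K a b \<gamma> t) = N (right_log_deriv G K a b \<eta> t)" if t: "t \<in> {a..b} - F" for t
  proof -
    obtain p q where pq: "a \<le> p" "p < t" "t < q" "q \<le> b" "C1_curve K p q \<gamma>" using F(2)[OF t] by blast
    then show ?thesis
      using right_log_deriv_interior[of a p q b \<gamma> t] right_log_deriv_interior[of a p q b \<eta> t] eq[of p q t]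
        piecewise_C1_curve_continuous[OF \<gamma> ab] piecewise_C1_curve_continuous[OF \<eta> ab] by simp
  qed
  then show ?thesis
    unfolding path_length_def by (intro integral_spike[OF negligible_finite[OF F(1)]]) simp
qed

end

section \<open>Lifting short curves through the exponential map\<close>

context hofer_grp
begin

text \<open>The curve is \<open>E\<close> applied to its logarithm, so \<open>mc E\<close>, the
  right-trivialised differential of the exponential map, turns the derivative of the logarithm into
  the logarithmic derivative.\<close>

lemma log_curve:
  assumes "p < q" and \<eta>: "C1_curve K p q \<eta>" and W: "\<And>t. t \<in> {p..q} \<Longrightarrow> \<eta> t \<in> W"
  obtains D where "\<And>t. t \<in> {p..q} \<Longrightarrow> ((\<lambda>s. lg (\<eta> s)) has_vector_derivative D t) (at t within {p..q})"
    "\<And>t. t \<in> {p..q} \<Longrightarrow> right_log_deriv G K p q \<eta> t = mc E (lg (\<eta> t)) (D t)"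
proof -
  have "C1_curve (euclidean_open B) p q (\<lambda>s. lg (\<eta> s))"
    by (rule C1_curve_smooth_map[OF charted_W charted_euclidean_open[OF open_hofer_ball] smooth_lg
          C1_curve_open_submfd[OF \<eta> W] assms(1)])
  then obtain D where D: "\<And>t. t \<in> {p..q} \<Longrightarrow> ((\<lambda>s. lg (\<eta> s)) has_vector_derivative D t) (at t within {p..q})"
    by (rule C1_curve_euclidean_openD) blast
  have "right_log_deriv G K p q \<eta> t = mc E (lg (\<eta> t)) (D t)" if t: "t \<in> {p..q}" for t
  proof (rule right_log_deriv_eqI[OF assms(1) \<eta>])
    have "has_rld (\<lambda>s. E (lg (\<eta> s))) (mc E (lg (\<eta> t)) (D t)) t {p..q}"
      by (rule has_rld_mc[OF open_hofer_ball smooth_exp D[OF t] t]) (use lg_in_B W in blast)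
    then show "has_rld \<eta> (mc E (lg (\<eta> t)) (D t)) t {p..q}"
      by (rule has_rld_cong) (use exp_lg W in blast)
  qed
  then show thesis using D that by blast
qed

text \<open>For \<open>y\<close>, \<open>z\<close> extremal for the logarithm at time
  \<open>t\<close>, the functional \<open>ip y - ip z\<close> along the logarithm touches its norm
  from below at \<open>t\<close>. Its derivative equals \<open>ip y ?x - ip z ?x\<close>, since
  extremal points do not see \<open>mc E\<close>, and this is at most \<open>N ?x\<close>.\<close>

lemma log_growth_C1:
  assumes pq: "p < q" and \<eta>: "C1_curve K p q \<eta>" and W: "\<And>t. t \<in> {p..q} \<Longrightarrow> \<eta> t \<in> W"
  shows "N (lg (\<eta> q)) - N (lg (\<eta> p)) \<le> len p q \<eta>"
  unfolding path_length_def
proof (rule growth_bound[OF pq, where F="\<lambda>t. N (lg (\<eta> t))"])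
  obtain D where D: "\<And>t. t \<in> {p..q} \<Longrightarrow> ((\<lambda>s. lg (\<eta> s)) has_vector_derivative D t) (at t within {p..q})"
    and x: "\<And>t. t \<in> {p..q} \<Longrightarrow> right_log_deriv G K p q \<eta> t = mc E (lg (\<eta> t)) (D t)"
    using log_curve[OF assms] by metis
  have "continuous_on {p..q} (\<lambda>t. lg (\<eta> t))"
    using D has_vector_derivative_continuous continuous_on_eq_continuous_within by blast
  then show "continuous_on {p..q} (\<lambda>t. N (lg (\<eta> t)))"
    using continuous_on_compose2[OF continuous_on_hofer_norm[of UNIV]] by blast
  show "continuous_on {p..q} (\<lambda>t. N (right_log_deriv G K p q \<eta> t))"
    using continuous_on_compose2[OF continuous_on_hofer_norm[of UNIV] C1_curve_rld(1)[OF pq \<eta>]] by blast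
  fix t assume t: "t \<in> {p..q}"
  let ?u = "\<lambda>s. lg (\<eta> s)" and ?x = "right_log_deriv G K p q \<eta> t"
  obtain y z where yz: "maximal y (?u t)" "minimal z (?u t)" by (rule extremal_exist)
  then have S: "y \<in> S" "z \<in> S" by (auto simp: maximal_def minimal_def)
  have B: "?u t \<in> B" by (rule lg_in_B[OF W[OF t]])
  have bl: "bounded_linear (\<lambda>v. ip y v - ip z v)"
    by (intro bounded_linear_sub) (use linear_ip_right linear_conv_bounded_linear in blast)+
  have "((\<lambda>s. ip y (?u s) - ip z (?u s)) has_real_derivative ip y (D t) - ip z (D t)) (at t within {p..q})"
    unfolding has_real_derivative_iff_has_vector_derivative
    by (rule bounded_linear.has_vector_derivative[OF bl D[OF t]])
  moreover have "ip y (D t) - ip z (D t) = ip y ?x - ip z ?x"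
    using extremal_mc_exp[OF _ B] yz by (simp add: x[OF t])
  ultimately show "\<exists>\<phi> \<phi>'. (\<phi> has_real_derivative \<phi>') (at t within {p..q}) \<and> \<phi>' \<le> N ?x \<and>
      \<phi> t = N (?u t) \<and> (\<forall>s\<in>{p..q}. \<phi> s \<le> N (?u s))"
    using hofer_norm_ge[OF S] hofer_norm_extremal[OF yz]
    by (intro exI[of _ "\<lambda>s. ip y (?u s) - ip z (?u s)"] exI[of _ "ip y (D t) - ip z (D t)"]) simp
qed

lemma log_growth:
  assumes "piecewise_C1_curve K a b \<eta>" "a < b" "\<And>t. t \<in> {a..b} \<Longrightarrow> \<eta> t \<in> W"
  shows "N (lg (\<eta> b)) - N (lg (\<eta> a)) \<le> len a b \<eta>"
proof -
  have "(\<forall>t\<in>{a..b}. \<eta> t \<in> W) \<longrightarrow> N (lg (\<eta> b)) - N (lg (\<eta> a)) \<le> len a b \<eta>"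
    using assms(1,2)
  proof (induction rule: piecewise_C1_curve_induct)
    case (single c)
    then show ?case using log_growth_C1[of a c \<eta>] by auto
  next
    case (snoc c d)
    have ad: "piecewise_C1_curve K a d \<eta>"
      by (rule piecewise_C1_curve_snoc[of K a c \<eta> d]) (use snoc in auto)
    show ?case
    proof
      assume W: "\<forall>t\<in>{a..d}. \<eta> t \<in> W"
      have "N (lg (\<eta> d)) - N (lg (\<eta> c)) \<le> len c d \<eta>"
        by (rule log_growth_C1) (use snoc W in auto)
      moreover have "N (lg (\<eta> c)) - N (lg (\<eta> a)) \<le> len a c \<eta>" using snoc W by auto
      ultimately show "N (lg (\<eta> d)) - N (lg (\<eta> a)) \<le> len a d \<eta>"
        using len_split[OF ad snoc(1,2)] by linarith
    qed
  qed
  then show ?thesis using assms(3) by blast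
qed

text \<open>Up to a first exit from \<open>W\<close> the growth estimate confines the curve to the
  closed set \<open>C\<close>, which lies inside \<open>W\<close>; so the exit point would belong to
  \<open>W\<close>. Starting at \<open>E z\<close> instead of \<one> is needed for attaching an end
  piece to another curve.\<close>

lemma lift_curve:
  assumes \<eta>: "piecewise_C1_curve K a b \<eta>" and ab: "a < b"
    and z: "\<eta> a = E z" "N z + len a b \<eta> < R"
  shows "\<forall>t\<in>{a..b}. \<eta> t \<in> W" "N (lg (\<eta> b)) \<le> N z + len a b \<eta>"
proof -
  define r where "r = N z + len a b \<eta>"
  have l0: "0 \<le> len a b \<eta>" by (rule len_nonneg[OF \<eta> ab])
  have zB: "z \<in> B" using z(2) l0 by simp
  have aW: "\<eta> a \<in> W" using zB z(1) by blast
  have lga: "lg (\<eta> a) = z" using z(1) lg_exp[OF zB] by simp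
  have ct: "continuous_map (top_of_set {a..b}) (Top K) \<eta>" by (rule piecewise_C1_curve_continuous[OF \<eta> ab])
  define C where "C = E ` {v. N v \<le> r}"
  have C: "closedin (Top K) C" "C \<subseteq> W"
    using closedin_exp_ball[of r] z(2) by (auto simp: C_def r_def)
  have closed_pre: "closed {t \<in> {a..b}. \<eta> t \<in> D}" if "closedin (Top K) D" for D
    using closedin_continuous_map_preimage[OF ct that] closedin_closed_trans[of "{a..b}"] by simp
  show W: "\<forall>t\<in>{a..b}. \<eta> t \<in> W"
  proof (rule ccontr)
    assume neg: "\<not> ?thesis"
    have carr: "\<eta> t \<in> carrier G" if "t \<in> {a..b}" for t by (rule curve_carrier[OF ct that])
    let ?bad = "{t \<in> {a..b}. \<eta> t \<in> pts K - W}"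
    have "closed ?bad" by (rule closed_pre) (simp add: closedin_diff openin_W)
    moreover have "bounded ?bad" by (rule bounded_subset[OF bounded_closed_interval[of a b]]) auto
    moreover have "?bad \<noteq> {}" using neg carr pts_K by blast
    ultimately obtain \<sigma> where \<sigma>: "\<sigma> \<in> ?bad" "\<And>s. s \<in> ?bad \<Longrightarrow> \<sigma> \<le> s"
      using compact_attains_inf[of ?bad] compact_eq_bounded_closed[of ?bad] by blast
    have below: "\<eta> s \<in> W" if "s \<in> {a..<\<sigma>}" for s
      using \<sigma>(2)[of s] that \<sigma>(1) carr[of s] pts_K by auto
    have a\<sigma>: "a < \<sigma>" using \<sigma>(1) aW by (cases "\<sigma> = a") auto
    have "\<eta> s \<in> C" if s: "s \<in> {a<..<\<sigma>}" for s
    proof -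
      have sb: "a < s" "s < b" using s \<sigma>(1) by auto
      have "N (lg (\<eta> s)) - N (lg (\<eta> a)) \<le> len a s \<eta>"
        by (rule log_growth[OF piecewise_C1_curve_subinterval[OF \<eta>]]) (use sb s below in auto)
      also have "\<dots> \<le> len a b \<eta>" using len_mono[OF \<eta>, of s] sb by simp
      finally have "N (lg (\<eta> s)) \<le> r" by (simp add: lga r_def)
      then show ?thesis unfolding C_def using exp_lg[OF below[of s]] s by (intro image_eqI[of _ _ "lg (\<eta> s)"]) auto
    qed
    then have "{a<..<\<sigma>} \<subseteq> {t \<in> {a..b}. \<eta> t \<in> C}" using \<sigma>(1) by auto
    then have "closure {a<..<\<sigma>} \<subseteq> {t \<in> {a..b}. \<eta> t \<in> C}"
      by (rule closure_minimal[OF _ closed_pre[OF C(1)]])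
    moreover have "\<sigma> \<in> closure {a<..<\<sigma>}" using a\<sigma> by simp
    ultimately have "\<eta> \<sigma> \<in> C" by blast
    then show False using C(2) \<sigma>(1) by blast
  qed
  show "N (lg (\<eta> b)) \<le> N z + len a b \<eta>"
    using log_growth[OF \<eta> ab] W lga by fastforce
qed

end

section \<open>Quasi-autonomous curves are locally short\<close>

context hofer_grp
begin

lemma C1_curve_right:
  assumes "p < q" "C1_curve K p q \<gamma>" "g \<in> carrier G"
  shows "C1_curve K p q (\<lambda>t. \<gamma> t \<otimes> g)"
    and "t \<in> {p..q} \<Longrightarrow> right_log_deriv G K p q (\<lambda>t. \<gamma> t \<otimes> g) t = right_log_deriv G K p q \<gamma> t"
proof -
  show c: "C1_curve K p q (\<lambda>t. \<gamma> t \<otimes> g)"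
    by (rule C1_curve_smooth_map[OF charted_K charted_K _ assms(2,1)])
      (intro smooth_mult smooth_id smooth_const charted_K assms(3))
  show "right_log_deriv G K p q (\<lambda>t. \<gamma> t \<otimes> g) t = right_log_deriv G K p q \<gamma> t" if "t \<in> {p..q}"
    by (rule right_log_deriv_eqI[OF assms(1) c has_rld_right[OF C1_curve_rld(2)[OF assms(1,2) that] assms(3)]])
qed

lemma piecewise_C1_curve_right:
  assumes "piecewise_C1_curve K a b \<gamma>" "a < b" "g \<in> carrier G"
  shows "piecewise_C1_curve K a b (\<lambda>t. \<gamma> t \<otimes> g)"
  by (rule piecewise_C1_curve_smooth_map[OF charted_K charted_K _ assms(1,2)])
    (intro smooth_mult smooth_id smooth_const charted_K assms(3))

lemma len_right:
  assumes "piecewise_C1_curve K a b \<gamma>" "a < b" "g \<in> carrier G"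
  shows "len a b (\<lambda>t. \<gamma> t \<otimes> g) = len a b \<gamma>"
  by (rule len_cong[OF assms(1) piecewise_C1_curve_right[OF assms] assms(2)])
    (simp add: C1_curve_right assms(3))

text \<open>If \<open>E u\<close> fixes \<open>y\<close>, it commutes with every
  \<open>E (r y)\<close>; hence \<open>Ad (E (r y)) u\<close> has the same exponential as
  \<open>u\<close>. It also has the same norm, so injectivity on \<open>B\<close> makes it equal to
  \<open>u\<close>, and all \<open>E (s u)\<close> commute with \<open>E (r y)\<close>.\<close>

lemma Ad_exp_fixed:
  assumes u: "u \<in> B" and y: "Ad G K (E u) y = y"
  shows "Ad G K (E (s *\<^sub>R u)) y = y"
proof (rule Ad_fixedI[OF exp_carrier])
  fix r
  have swap: "g \<otimes> h \<otimes> inv g = h \<longleftrightarrow> h \<otimes> g \<otimes> inv h = g" if "g \<in> carrier G" "h \<in> carrier G" for g h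
    using that by (metis inv_solve_right' m_closed)
  have "E u \<otimes> E (r *\<^sub>R y) \<otimes> inv (E u) = E (r *\<^sub>R y)"
    by (simp add: exp_conj exp_carrier linear_scale[OF linear_Ad] y)
  then have "E (r *\<^sub>R y) \<otimes> E u \<otimes> inv (E (r *\<^sub>R y)) = E u"
    using swap exp_carrier by blast
  then have "E (Ad G K (E (r *\<^sub>R y)) u) = E u"
    by (simp add: exp_conj exp_carrier)
  moreover have "Ad G K (E (r *\<^sub>R y)) u \<in> B"
    using u by (simp add: hofer_norm_Ad exp_carrier)
  ultimately have "Ad G K (E (r *\<^sub>R y)) u = u"
    using inj_on_exp u by (meson inj_onD)
  then have "E (r *\<^sub>R y) \<otimes> E (s *\<^sub>R u) \<otimes> inv (E (r *\<^sub>R y)) = E (s *\<^sub>R u)"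
    by (simp add: exp_conj exp_carrier linear_scale[OF linear_Ad])
  then show "E (s *\<^sub>R u) \<otimes> E (r *\<^sub>R y) \<otimes> inv (E (s *\<^sub>R u)) = E (r *\<^sub>R y)"
    using swap exp_carrier by blast
qed

text \<open>Counterpart of \<open>extremal_mc_exp\<close> for a point that is not known to be
  extremal for the logarithm \<open>u\<close>, but is fixed by \<open>E u\<close>.\<close>

lemma ip_mc_exp_fixed:
  assumes u: "u \<in> B" and y: "Ad G K (E u) y = y"
  shows "ip y (mc E u w) = ip y w"
proof (rule ip_mc_exp[OF open_hofer_ball smooth_exp scaled_in_B[OF u]])
  fix s w
  have "Ad G K (inv (E (s *\<^sub>R u))) y = y"
    using Ad_exp_fixed[OF assms, of "- s"] by (simp add: exp_minus)
  then show "ip y (Ad G K (E (s *\<^sub>R u)) w) = ip y w"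
    using ip_Ad_left[of "inv (E (s *\<^sub>R u))" y w] exp_carrier by simp
qed auto

text \<open>Since \<open>y\<close> is orthogonal to all brackets with the logarithmic derivative,
  \<open>ip y (Ad (\<delta> t) w)\<close> keeps its initial value \<open>ip y w\<close>;
  nondegeneracy turns this into invariance of \<open>y\<close>.\<close>

lemma curve_fixes:
  assumes \<delta>: "piecewise_C1_curve K c d \<delta>" "c < d" "\<delta> c = \<one>"
    and y: "\<And>p q t w. c \<le> p \<Longrightarrow> p < q \<Longrightarrow> q \<le> d \<Longrightarrow> C1_curve K p q \<delta> \<Longrightarrow> t \<in> {p..q} \<Longrightarrow>
      ip y (bracket (right_log_deriv G K p q \<delta> t) w) = 0"
    and t: "t \<in> {c..d}"
  shows "Ad G K (\<delta> t) y = y"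
proof -
  have piece: "ip y (Ad G K (\<delta> t) w) = ip y (Ad G K (\<delta> s) w)"
    if "c \<le> p" "p < q" "q \<le> d" "C1_curve K p q \<delta>" "t \<in> {p..q}" "s \<in> {p..q}" for p q t s w
    by (rule ip_Ad_constant[OF convex_real_interval(5) that(5,6), where X="right_log_deriv G K p q \<delta>"])
      (use C1_curve_rld(2)[OF that(2,4)] y[OF that(1-4)] in auto)
  have "\<forall>t\<in>{c..d}. \<forall>w. ip y (Ad G K (\<delta> t) w) = ip y w"
    using \<delta>(1,2)
  proof (induction rule: piecewise_C1_curve_induct)
    case (single e)
    then show ?case
      using piece[of c e _ c] by (auto simp: \<delta>(3) Ad_one)
  next
    case (snoc e f)
    show ?case
    proof (intro ballI allI)
      fix t w assume t: "t \<in> {c..f}"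
      show "ip y (Ad G K (\<delta> t) w) = ip y w"
      proof (cases "t \<le> e")
        case True
        then show ?thesis using snoc.IH t by auto
      next
        case False
        then have "ip y (Ad G K (\<delta> t) w) = ip y (Ad G K (\<delta> e) w)"
          using snoc t by (intro piece[of e f]) auto
        also have "\<dots> = ip y w" using snoc.IH snoc.hyps by auto
        finally show ?thesis .
      qed
    qed
  qed
  then have 1: "ip y (Ad G K (\<delta> t) w) = ip y w" for w using t by blast
  have g: "\<delta> t \<in> carrier G"
    by (rule curve_carrier[OF piecewise_C1_curve_continuous[OF \<delta>(1,2)] t])
  have "Ad G K (inv (\<delta> t)) y = y"
    by (rule ip_nondegenerate) (use 1 g ip_Ad_left[of "inv (\<delta> t)" y] in simp)
  then show ?thesis using Ad_inv_right[OF g, of y] by simp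
qed

text \<open>As \<open>\<delta> t\<close> fixes \<open>y\<close> and \<open>z\<close>, the integrand
  \<open>N\<close> of the logarithmic derivative equals the derivative of \<open>ip y - ip z\<close>
  along the logarithm. Integration gives the value of this functional at the final logarithm, and
  the functional lies below \<open>N\<close>.\<close>

lemma steady_length:
  assumes \<delta>: "piecewise_C1_curve K c d \<delta>" "c < d" "\<delta> c = \<one>" "\<And>t. t \<in> {c..d} \<Longrightarrow> \<delta> t \<in> W"
    and yz: "\<And>p q t. c \<le> p \<Longrightarrow> p < q \<Longrightarrow> q \<le> d \<Longrightarrow> C1_curve K p q \<delta> \<Longrightarrow> t \<in> {p..q} \<Longrightarrow>
      maximal y (right_log_deriv G K p q \<delta> t) \<and> minimal z (right_log_deriv G K p q \<delta> t)"
  shows "len c d \<delta> \<le> N (lg (\<delta> d))"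
proof -
  have Ady: "Ad G K (\<delta> t) y = y" "Ad G K (\<delta> t) z = z" if "t \<in> {c..d}" for t
    by (rule curve_fixes[OF \<delta>(1-3) _ that]; rule extremal_bracket; use yz in blast)+
  have piece: "len p q \<delta> = (ip y (lg (\<delta> q)) - ip z (lg (\<delta> q))) - (ip y (lg (\<delta> p)) - ip z (lg (\<delta> p)))"
    if pq: "c \<le> p" "p < q" "q \<le> d" "C1_curve K p q \<delta>" for p q
  proof -
    have sub: "t \<in> {c..d}" if "t \<in> {p..q}" for t using that pq by auto
    have W: "\<delta> t \<in> W" if "t \<in> {p..q}" for t using sub[OF that] by (rule \<delta>(4))
    obtain D where D: "\<And>t. t \<in> {p..q} \<Longrightarrow> ((\<lambda>s. lg (\<delta> s)) has_vector_derivative D t) (at t within {p..q})"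
      and x: "\<And>t. t \<in> {p..q} \<Longrightarrow> right_log_deriv G K p q \<delta> t = mc E (lg (\<delta> t)) (D t)"
      using log_curve[OF pq(2,4) W] by metis
    have bl: "bounded_linear (\<lambda>v. ip y v - ip z v)"
      by (intro bounded_linear_sub) (use linear_ip_right linear_conv_bounded_linear in blast)+
    have N: "N (right_log_deriv G K p q \<delta> t) = ip y (D t) - ip z (D t)" if t: "t \<in> {p..q}" for t
    proof -
      note B = lg_in_B[OF W[OF t]]
      have "ip y (mc E (lg (\<delta> t)) (D t)) = ip y (D t)" "ip z (mc E (lg (\<delta> t)) (D t)) = ip z (D t)"
        by (rule ip_mc_exp_fixed[OF B]; use Ady[OF sub[OF t]] exp_lg[OF W[OF t]] in simp)+
      then show ?thesis
        using hofer_norm_extremal[of y "right_log_deriv G K p q \<delta> t" z] yz[OF pq t] x[OF t] by simp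
    qed
    have "((\<lambda>t. ip y (D t) - ip z (D t)) has_integral
        (ip y (lg (\<delta> q)) - ip z (lg (\<delta> q))) - (ip y (lg (\<delta> p)) - ip z (lg (\<delta> p)))) {p..q}"
      by (rule fundamental_theorem_of_calculus[of p q "\<lambda>t. ip y (lg (\<delta> t)) - ip z (lg (\<delta> t))"])
        (use pq D in \<open>auto intro: bounded_linear.has_vector_derivative[OF bl]\<close>)
    then have "((\<lambda>t. N (right_log_deriv G K p q \<delta> t)) has_integral
        (ip y (lg (\<delta> q)) - ip z (lg (\<delta> q))) - (ip y (lg (\<delta> p)) - ip z (lg (\<delta> p)))) {p..q}"
      by (rule has_integral_eq[rotated]) (simp add: N)
    then show ?thesis unfolding path_length_def by (rule integral_unique)
  qed
  have lg1: "lg (\<delta> c) = 0" using lg_exp[OF zero_in_B] by (simp add: \<delta>(3) exp_zero)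
  have "len c d \<delta> = ip y (lg (\<delta> d)) - ip z (lg (\<delta> d))"
    using \<delta>(1,2)
  proof (induction rule: piecewise_C1_curve_induct)
    case (single e)
    then show ?case
      using piece[of c e] by (simp add: lg1 linear_0[OF linear_ip_right])
  next
    case (snoc e f)
    have "piecewise_C1_curve K c f \<delta>"
      by (rule piecewise_C1_curve_snoc[of K c e \<delta> f]) (use snoc in auto)
    from len_split[OF this snoc.hyps(1,2)] show ?case
      using piece[of e f] snoc by simp
  qed
  moreover have "y \<in> S" "z \<in> S"
  proof -
    obtain p q where "c \<le> p" "p < q" "q \<le> d" "C1_curve K p q \<delta>" "c \<in> {p..q}"
      using piecewise_C1_curve_piece_at[OF \<delta>(1,2)] \<delta>(2) by (meson atLeastAtMost_iff less_imp_le order_refl)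
    then show "y \<in> S" "z \<in> S" using yz[of p q c] by (auto simp: maximal_def minimal_def)
  qed
  ultimately show ?thesis using hofer_norm_ge by simp
qed

text \<open>
  A hypothetical shorter competitor \<open>\<eta>\<close> is followed by the inverse of an end piece of \<open>\<gamma>\<close>; the
  result leads to an intermediate point of \<open>\<gamma>\<close> at a length strictly below \<open>R\<close>.
\<close>

lemma steady_short:
  assumes \<gamma>: "piecewise_C1_curve K c d \<gamma>" and cd: "c < d" and L: "len c d \<gamma> \<le> R"
    and yz: "\<And>p q t. c \<le> p \<Longrightarrow> p < q \<Longrightarrow> q \<le> d \<Longrightarrow> C1_curve K p q \<gamma> \<Longrightarrow> t \<in> {p..q} \<Longrightarrow>
      maximal y (right_log_deriv G K p q \<gamma> t) \<and> minimal z (right_log_deriv G K p q \<gamma> t)"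
  shows "short_path G K S c d \<gamma>"
  unfolding short_path_def
proof (intro allI impI)
  fix c' d' \<eta>
  assume "c' < d' \<and> piecewise_C1_curve K c' d' \<eta> \<and> \<eta> c' = \<gamma> c \<and> \<eta> d' = \<gamma> d"
  then have cd': "c' < d'" and \<eta>: "piecewise_C1_curve K c' d' \<eta>" "\<eta> c' = \<gamma> c" "\<eta> d' = \<gamma> d" by auto
  show "len c d \<gamma> \<le> len c' d' \<eta>"
  proof (rule ccontr)
    define L' where "L' = len c d \<gamma>"
    define r where "r = len c' d' \<eta>"
    assume "\<not> ?thesis"
    then have rL': "r < L'" by (simp add: r_def L'_def)
    have r0: "0 \<le> r" unfolding r_def by (rule len_nonneg[OF \<eta>(1) cd'])
    \<comment> \<open>Right translation moves the start to \<one> without changing logarithmic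
      derivatives.\<close>
    define \<delta> where "\<delta> t = \<gamma> t \<otimes> inv (\<gamma> c)" for t
    have carr: "\<gamma> t \<in> carrier G" if "t \<in> {c..d}" for t
      by (rule curve_carrier[OF piecewise_C1_curve_continuous[OF \<gamma> cd] that])
    have gc: "inv (\<gamma> c) \<in> carrier G" using carr[of c] cd by simp
    have \<delta>: "piecewise_C1_curve K c d \<delta>" "\<delta> c = \<one>"
      unfolding \<delta>_def using piecewise_C1_curve_right[OF \<gamma> cd gc] carr[of c] cd by simp_all
    have \<delta>carr: "\<delta> t \<in> carrier G" if "t \<in> {c..d}" for t
      using carr[OF that] gc by (simp add: \<delta>_def)
    have \<gamma>\<delta>: "\<gamma> t = \<delta> t \<otimes> \<gamma> c" if "t \<in> {c..d}" for t
      using carr[OF that] carr[of c] cd by (simp add: \<delta>_def m_assoc)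
    have C1_back: "C1_curve K p q \<gamma> \<and> right_log_deriv G K p q \<delta> t = right_log_deriv G K p q \<gamma> t"
      if pq: "c \<le> p" "p < q" "q \<le> d" "C1_curve K p q \<delta>" "t \<in> {p..q}" for p q t
    proof -
      have "C1_curve K p q (\<lambda>t. \<delta> t \<otimes> \<gamma> c)" by (rule C1_curve_right[OF pq(2,4)]) (use carr cd in simp)
      then have C: "C1_curve K p q \<gamma>" by (rule C1_curve_cong) (rule \<gamma>\<delta>[symmetric], use pq in auto)
      then show ?thesis using C1_curve_right(2)[OF pq(2) C gc pq(5)] by (simp add: \<delta>_def[abs_def])
    qed
    have yz': "maximal y (right_log_deriv G K p q \<delta> t) \<and> minimal z (right_log_deriv G K p q \<delta> t)"
      if "c \<le> p" "p < q" "q \<le> d" "C1_curve K p q \<delta>" "t \<in> {p..q}" for p q t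
      using C1_back[OF that] yz[OF that(1-3) _ that(5)] by simp
    have len\<delta>: "len c d \<delta> = L'" unfolding \<delta>_def L'_def by (rule len_right[OF \<gamma> cd gc])

    define f where "f t = integral {c..t} (\<lambda>t. N (right_log_deriv G K c d \<delta> t))" for t
    have f: "f t = len c t \<delta>" if "c < t" "t \<le> d" for t
      unfolding f_def using len_subinterval[OF \<delta>(1), of c t] that by simp
    have "continuous_on {c..d} f"
      unfolding f_def by (rule indefinite_integral_continuous_1[OF integrable_hofer_norm[OF \<delta>(1) cd]])
    moreover have "f c = 0" by (simp add: f_def)
    moreover have "f d = L'" using f[of d] cd len\<delta> by simp
    \<comment> \<open>The intermediate length must lie strictly between \<open>(r + L') / 2\<close>
      and \<open>L'\<close>; this value is the midpoint. Below \<open>L'\<close> the initial piece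
      has length less than \<open>R\<close>; above the average, the detour through the competitor,
      of length \<open>r\<close> plus the remainder of the curve, is shorter than the initial
      piece.\<close>
    ultimately obtain t where t: "c \<le> t" "t \<le> d" "f t = (r + 3 * L') / 4"
      using IVT'[of f c "(r + 3 * L') / 4" d] rL' r0 cd by auto
    define v where "v = (r + 3 * L') / 4"
    have "4 * v = r + 3 * L'" by (simp add: v_def)
    then have v: "r < v" "v < L'" "r + L' - v < v" using rL' by simp_all
    have t': "c < t" "t < d"
      using t \<open>f c = 0\<close> \<open>f d = L'\<close> v r0 by (auto simp: v_def order.order_iff_strict)
    have lt: "len c t \<delta> = v" using f[of t] t t' by (simp add: v_def)
    have ct: "piecewise_C1_curve K c t \<delta>"
      by (rule piecewise_C1_curve_subinterval[OF \<delta>(1)]) (use t t' in auto)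
    have td: "piecewise_C1_curve K t d \<delta>"
      by (rule piecewise_C1_curve_subinterval[OF \<delta>(1)]) (use t t' in auto)
    have "\<forall>s\<in>{c..t}. \<delta> s \<in> W"
      by (rule lift_curve(1)[OF ct t'(1), of 0]) (use \<delta>(2) lt v L in \<open>auto simp: exp_zero hofer_norm_0 L'_def\<close>)
    then have low: "v \<le> N (lg (\<delta> t))"
      using steady_length[OF ct t'(1) \<delta>(2), of y z] yz' t t' lt by auto

    have pe: "piecewise_C1_curve K c' d' (\<lambda>s. \<eta> s \<otimes> inv (\<gamma> c))"
      by (rule piecewise_C1_curve_right[OF \<eta>(1) cd' gc])
    have le: "len c' d' (\<lambda>s. \<eta> s \<otimes> inv (\<gamma> c)) = r"
      unfolding r_def by (rule len_right[OF \<eta>(1) cd' gc])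
    have rR: "r < R" using rL' L by (simp add: L'_def)
    have e0: "\<eta> c' \<otimes> inv (\<gamma> c) = E 0" using \<eta>(2) carr[of c] cd by (simp add: exp_zero)
    note lift = lift_curve[OF pe cd' e0, unfolded le hofer_norm_0]
    have \<eta>d: "\<eta> d' \<otimes> inv (\<gamma> c) = \<delta> d" by (simp add: \<eta>(3) \<delta>_def)
    have "\<forall>s\<in>{c'..d'}. \<eta> s \<otimes> inv (\<gamma> c) \<in> W" by (rule lift(1)) (use rR in simp)
    from bspec[OF this, of d'] have dW: "\<delta> d \<in> W" unfolding \<eta>d using cd' by simp
    have Nd: "N (lg (\<delta> d)) \<le> r" using lift(2) rR \<eta>d by simp

    \<comment> \<open>With \<open>s\<close> running from \<open>t\<close> to \<open>d\<close>, the
      curve \<open>h (\<delta> s)\<close> runs from \<open>\<delta> d\<close> back to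
      \<open>\<delta> t\<close>: inversion traverses the end piece backwards without reversing time,
      and only changes the logarithmic derivative by a sign and \<open>Ad\<close>.\<close>
    define h where "h g = \<delta> d \<otimes> inv g \<otimes> \<delta> t" for g
    have dd: "\<delta> d \<in> carrier G" "\<delta> t \<in> carrier G" using \<delta>carr t' by auto
    have sh: "smooth_map K K h"
      unfolding h_def by (intro smooth_mult smooth_inv smooth_id smooth_const charted_K dd)
    have \<rho>: "piecewise_C1_curve K t d (\<lambda>s. h (\<delta> s))"
      by (rule piecewise_C1_curve_smooth_map[OF charted_K charted_K sh td t'(2)])
    have "len t d (\<lambda>s. h (\<delta> s)) = len t d \<delta>"
    proof (rule len_cong[OF td \<rho> t'(2)])
      fix p q s assume pq: "t \<le> p" "q \<le> d" "p < q" "s \<in> {p..q}" "C1_curve K p q \<delta>"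
      let ?x = "right_log_deriv G K p q \<delta> s"
      have C: "C1_curve K p q (\<lambda>s. h (\<delta> s))"
        by (rule C1_curve_smooth_map[OF charted_K charted_K sh pq(5,3)])
      have rld: "has_rld \<delta> ?x s {p..q}" by (rule C1_curve_rld(2)[OF pq(3,5,4)])
      have ds: "\<delta> s \<in> carrier G" by (rule has_rld_carrier[OF rld pq(4)])
      have "has_rld (\<lambda>s. h (\<delta> s)) (Ad G K (\<delta> d) (- Ad G K (inv (\<delta> s)) ?x)) s {p..q}"
        unfolding h_def by (rule has_rld_right[OF has_rld_left[OF has_rld_inv[OF rld] dd(1)] dd(2)])
      then have "right_log_deriv G K p q (\<lambda>s. h (\<delta> s)) s = Ad G K (\<delta> d) (- Ad G K (inv (\<delta> s)) ?x)"
        by (rule right_log_deriv_eqI[OF pq(3) C])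
      then show "C1_curve K p q (\<lambda>s. h (\<delta> s)) \<and>
          N (right_log_deriv G K p q (\<lambda>s. h (\<delta> s)) s) = N (right_log_deriv G K p q \<delta> s)"
        using C ds dd by (simp add: hofer_norm_Ad hofer_norm_minus)
    qed
    also have "\<dots> = L' - v" using len_split[OF \<delta>(1) t'] lt len\<delta> by simp
    finally have len\<rho>: "len t d (\<lambda>s. h (\<delta> s)) = L' - v" .
    have "h (\<delta> t) = E (lg (\<delta> d))" using dd exp_lg[OF dW] by (simp add: h_def m_assoc)
    moreover have "N (lg (\<delta> d)) + (L' - v) < R" using Nd v L by (simp add: L'_def)
    ultimately have "N (lg (h (\<delta> d))) \<le> N (lg (\<delta> d)) + (L' - v)"
      using lift_curve(2)[OF \<rho> t'(2), of "lg (\<delta> d)"] len\<rho> by simp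
    moreover have "h (\<delta> d) = \<delta> t" using dd by (simp add: h_def)
    ultimately have "N (lg (\<delta> t)) < v" using Nd v by simp
    then show False using low by simp
  qed
qed

end

section \<open>Short curves are quasi-autonomous\<close>

context hofer_grp
begin

lemma hofer_norm_sum: "finite I \<Longrightarrow> N (\<Sum>i\<in>I. f i) \<le> (\<Sum>i\<in>I. N (f i))"
proof (induction I rule: finite_induct)
  case (insert i I)
  then show ?case using hofer_norm_triangle[of "f i" "\<Sum>i\<in>I. f i"] by simp
qed (simp add: hofer_norm_0)

text \<open>\<open>mc E 0\<close> is the identity and \<open>mc E z\<close> is continuous in
  \<open>z\<close>; controlling it on the finitely many basis vectors makes the estimate uniform in
  \<open>v\<close>.\<close>

lemma mc_exp_near_identity:
  assumes "\<epsilon> > 0"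
  shows "\<exists>\<delta>>0. \<forall>z. norm z < \<delta> \<longrightarrow> z \<in> B \<and> (\<forall>v. N (v - mc E z v) \<le> \<epsilon> * norm v)"
proof -
  define \<Phi> where "\<Phi> z = (\<Sum>b\<in>Basis. N (b - mc E z b))" for z
  have "continuous_on B (\<lambda>z. N (b - mc E z b))" for b
    by (rule continuous_on_compose2[OF continuous_on_hofer_norm[of UNIV]],
        intro continuous_on_diff continuous_on_const
          continuous_on_mc[OF open_hofer_ball smooth_exp, where z="\<lambda>z. z"] continuous_on_id) auto
  then have "continuous_on B \<Phi>" unfolding \<Phi>_def by (intro continuous_on_sum)
  then have "isCont \<Phi> 0" using continuous_on_eq_continuous_at[OF open_hofer_ball] zero_in_B by blast
  moreover have "\<Phi> 0 = 0"
    by (simp add: \<Phi>_def mc_exp_zero[OF open_hofer_ball smooth_exp zero_in_B] hofer_norm_0)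
  ultimately obtain \<delta>1 where \<delta>1: "\<delta>1 > 0" "\<And>z. norm z < \<delta>1 \<Longrightarrow> \<bar>\<Phi> z\<bar> < \<epsilon>"
    using assms unfolding continuous_at_eps_delta by (metis dist_0_norm dist_commute dist_real_def diff_zero)
  obtain \<delta>2 where \<delta>2: "\<delta>2 > 0" "ball 0 \<delta>2 \<subseteq> B"
    using open_hofer_ball zero_in_B open_contains_ball by blast
  have "N (v - mc E z v) \<le> \<epsilon> * norm v" if z: "norm z < \<delta>1" "z \<in> B" for z v
  proof -
    have l: "linear (\<lambda>v. v - mc E z v)"
      by (intro linear_compose_sub linear_id[unfolded id_def] linear_mc[OF open_hofer_ball smooth_exp z(2)])
    have "N (v - mc E z v) = N (\<Sum>b\<in>Basis. (v \<bullet> b) *\<^sub>R (b - mc E z b))"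
      using linear_Basis_expansion[OF l, of v] by simp
    also have "\<dots> \<le> (\<Sum>b\<in>Basis. N ((v \<bullet> b) *\<^sub>R (b - mc E z b)))"
      by (rule hofer_norm_sum[OF finite_Basis])
    also have "\<dots> \<le> (\<Sum>b\<in>Basis. norm v * N (b - mc E z b))"
      by (intro sum_mono) (simp add: hofer_norm_scale Basis_le_norm mult_right_mono hofer_norm_nonneg)
    also have "\<dots> = norm v * \<Phi> z" by (simp add: \<Phi>_def sum_distrib_left)
    also have "\<dots> \<le> norm v * \<epsilon>" using \<delta>1(2)[OF z(1)] by (intro mult_left_mono) auto
    finally show ?thesis by (simp add: mult.commute)
  qed
  then show ?thesis
    using \<delta>1(1) \<delta>2 by (intro exI[of _ "min \<delta>1 \<delta>2"]) (auto simp: subset_eq)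
qed

text \<open>
  With \<open>w\<close> the primitive of \<open>x\<^sub>t - m\<close>, where \<open>m\<close> is the mean of \<open>x\<close>, the competitor
  \<open>(E (s w\<^sub>t))\<inverse> \<gamma>\<^sub>t\<close> has the same end points as \<open>\<gamma>\<close>, and the norm of its logarithmic derivative is that of
  \<open>x\<^sub>t - s (x\<^sub>t - m)\<close> up to an error of lower order in \<open>s\<close>.
\<close>

lemma short_path_average:
  assumes \<gamma>: "piecewise_C1_curve K a b \<gamma>" and ab: "a < b" and short: "short_path G K S a b \<gamma>"
  shows "len a b \<gamma> \<le> N (integral {a..b} (right_log_deriv G K a b \<gamma>))"
proof -
  let ?X = "right_log_deriv G K a b \<gamma>"
  define I where "I = integral {a..b} ?X"
  define m where "m = (1 / (b - a)) *\<^sub>R I"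
  define w where "w t = integral {a..t} (\<lambda>t. ?X t - m)" for t
  define c where "c = integral {a..b} (\<lambda>t. norm (?X t - m))"
  have ct: "continuous_map (top_of_set {a..b}) (Top K) \<gamma>" by (rule piecewise_C1_curve_continuous[OF \<gamma> ab])
  have Xi: "?X integrable_on {a..b}"
    using integrable_right_log_deriv[OF \<gamma> ab continuous_on_id] .
  have Xmi: "(\<lambda>t. ?X t - m) integrable_on {a..b}" by (intro integrable_diff Xi integrable_const_ivl)
  have normi: "(\<lambda>t. norm (?X t - m)) integrable_on {a..b}"
    by (rule integrable_right_log_deriv[OF \<gamma> ab]) (intro continuous_intros)
  have w0: "w a = 0" by (simp add: w_def)
  have wb: "w b = 0"
    using ab by (simp add: w_def integral_diff[OF Xi integrable_const_ivl] I_def[symmetric] m_def)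
  have mN: "N m * (b - a) = N I" using ab by (simp add: m_def hofer_norm_scale_pos)
  have w_cont: "continuous_on {a..b} w"
    unfolding w_def by (rule indefinite_integral_continuous_1[OF Xmi])
  then have "bounded (w ` {a..b})" by (intro compact_imp_bounded compact_continuous_image compact_Icc)
  then obtain C where C: "C > 0" "\<And>t. t \<in> {a..b} \<Longrightarrow> norm (w t) \<le> C"
    unfolding bounded_pos by blast
  have w_der: "(w has_vector_derivative right_log_deriv G K p q \<gamma> t - m) (at t within {p..q})"
    if pq: "a \<le> p" "p < q" "q \<le> b" "C1_curve K p q \<gamma>" and t: "t \<in> {p..q}" for p q t
  proof -
    let ?x = "right_log_deriv G K p q \<gamma>"
    \<comment> \<open>On a piece the integrand of \<open>w\<close> is replaced by a continuous one,
      so \<open>w\<close> is differentiable up to and including the ends of the piece.\<close>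
    have eq: "w p + integral {p..s} (\<lambda>t. ?x t - m) = w s" if s: "s \<in> {p..q}" for s
    proof -
      have "(\<lambda>t. ?X t - m) integrable_on {a..s}"
        by (rule integrable_on_subinterval[OF Xmi]) (use pq s in auto)
      then have "w s = w p + integral {p..s} (\<lambda>t. ?X t - m)"
        unfolding w_def using Henstock_Kurzweil_Integration.integral_combine[of a p s "\<lambda>t. ?X t - m"] pq s by simp
      also have "integral {p..s} (\<lambda>t. ?X t - m) = integral {p..s} (\<lambda>t. ?x t - m)"
        by (rule integral_spike[of "{p, q}"])
          (use pq s right_log_deriv_interior[OF pq(1,3,4) _ _ ct] in auto)
      finally show ?thesis by simp
    qed
    have "continuous_on {p..q} (\<lambda>t. ?x t - m)" by (intro continuous_intros C1_curve_rld(1)[OF pq(2,4)])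
    from integral_has_vector_derivative[OF this t]
    have "((\<lambda>s. w p + integral {p..s} (\<lambda>t. ?x t - m)) has_vector_derivative ?x t - m) (at t within {p..q})"
      by (auto intro: derivative_eq_intros)
    then show ?thesis by (rule has_vector_derivative_transform[OF t, rotated]) (simp add: eq)
  qed
  have bound: "len a b \<gamma> \<le> N I + \<epsilon> * c" if \<epsilon>: "\<epsilon> > 0" for \<epsilon>
  proof -
    obtain \<delta> where \<delta>: "\<delta> > 0" "\<And>z. norm z < \<delta> \<Longrightarrow> z \<in> B"
      "\<And>z v. norm z < \<delta> \<Longrightarrow> N (v - mc E z v) \<le> \<epsilon> * norm v"
      using mc_exp_near_identity[OF \<epsilon>] by blast
    \<comment> \<open>\<open>1\<close> keeps \<open>1 - s\<close> nonnegative; since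
      \<open>C\<close> bounds \<open>w\<close>, the other term keeps \<open>s *\<^sub>R w t\<close>
      strictly within \<open>\<delta>\<close> of 0 for all \<open>t\<close>.\<close>
    define s where "s = min 1 (\<delta> / (2 * C))"
    have s: "0 < s" "s \<le> 1" using \<delta>(1) C(1) by (auto simp: s_def)
    have sw: "norm (s *\<^sub>R w t) < \<delta>" if "t \<in> {a..b}" for t
    proof -
      have "norm (s *\<^sub>R w t) = s * norm (w t)" using s(1) by simp
      also have "\<dots> \<le> (\<delta> / (2 * C)) * C"
        by (rule mult_mono) (use C(1) C(2)[OF that] \<delta>(1) in \<open>simp_all add: s_def\<close>)
      also have "\<dots> < \<delta>" using C(1) \<delta>(1) by simp
      finally show ?thesis .
    qed
    define \<eta> where "\<eta> t = inv (E (s *\<^sub>R w t)) \<otimes> \<gamma> t" for t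
    have piece: "C1_curve K p q \<eta> \<and> N (right_log_deriv G K p q \<eta> t)
        \<le> (1 - s) * N (right_log_deriv G K p q \<gamma> t) + s * N m + s * (\<epsilon> * norm (right_log_deriv G K p q \<gamma> t - m))"
      if pq: "a \<le> p" "p < q" "q \<le> b" "C1_curve K p q \<gamma>" "t \<in> {p..q}" for p q t
    proof -
      let ?x = "right_log_deriv G K p q \<gamma>"
      let ?v = "?x t - m"
      have sub: "{p..q} \<subseteq> {a..b}" using pq by auto
      have B: "s *\<^sub>R w t \<in> B" if "t \<in> {p..q}" for t using \<delta>(2)[OF sw] that sub by blast
      have zd: "((\<lambda>t. s *\<^sub>R w t) has_vector_derivative s *\<^sub>R (?x t - m)) (at t within {p..q})"
        if "t \<in> {p..q}" for t
        by (rule bounded_linear.has_vector_derivative[OF bounded_linear_scaleR_right w_der[OF pq(1-4) that]])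
      have "C1_curve (euclidean_open B) p q (\<lambda>t. s *\<^sub>R w t)"
      proof (rule C1_curve_euclidean_open)
        show "continuous_on {p..q} (\<lambda>t. s *\<^sub>R (?x t - m))"
          by (intro continuous_intros C1_curve_rld(1)[OF pq(2,4)])
      qed (use zd B in blast)+
      from C1_curve_smooth_map[OF charted_euclidean_open[OF open_hofer_ball] charted_K smooth_exp this pq(2)]
      have "C1_curve K p q (\<lambda>t. inv (E (s *\<^sub>R w t)))"
        by (rule C1_curve_smooth_map[OF charted_K charted_K smooth_map_inv _ pq(2)])
      from C1_curve_smooth_map[OF charted_prod[OF charted_K charted_K] charted_K smooth_map_mult
          C1_curve_pair[OF this pq(4)] pq(2)]
      have \<eta>C: "C1_curve K p q \<eta>" by (simp add: \<eta>_def[abs_def])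
      let ?k = "E (s *\<^sub>R w t)" and ?y = "mc E (s *\<^sub>R w t) (s *\<^sub>R ?v)"
      have rk: "has_rld (\<lambda>t. E (s *\<^sub>R w t)) ?y t {p..q}"
        by (rule has_rld_mc[OF open_hofer_ball smooth_exp zd[OF pq(5)] pq(5)]) (use B in blast)
      have "has_rld \<eta> (- Ad G K (inv ?k) ?y + Ad G K (inv ?k) (?x t)) t {p..q}"
        unfolding \<eta>_def by (rule has_rld_mult[OF has_rld_inv[OF rk] C1_curve_rld(2)[OF pq(2,4,5)]])
      then have "right_log_deriv G K p q \<eta> t = - Ad G K (inv ?k) ?y + Ad G K (inv ?k) (?x t)"
        by (rule right_log_deriv_eqI[OF pq(2) \<eta>C])
      also have "\<dots> = Ad G K (inv ?k) (?x t - ?y)"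
        by (simp add: linear_diff[OF linear_Ad] exp_carrier)
      finally have "N (right_log_deriv G K p q \<eta> t) = N (?x t - ?y)"
        by (simp add: hofer_norm_Ad exp_carrier)
      also have "?y = s *\<^sub>R mc E (s *\<^sub>R w t) ?v"
        by (rule linear_scale[OF linear_mc[OF open_hofer_ball smooth_exp B[OF pq(5)]]])
      \<comment> \<open>If the differential were the identity, only the convex combination of
        \<open>?x t\<close> and \<open>m\<close> would remain; the last summand is the error, small
        by the choice of \<open>\<delta>\<close>.\<close>
      also have "?x t - s *\<^sub>R mc E (s *\<^sub>R w t) ?v
          = ((1 - s) *\<^sub>R ?x t + s *\<^sub>R m) + s *\<^sub>R (?v - mc E (s *\<^sub>R w t) ?v)"
        by (simp add: algebra_simps)
      also have "N \<dots> \<le> N ((1 - s) *\<^sub>R ?x t) + N (s *\<^sub>R m) + N (s *\<^sub>R (?v - mc E (s *\<^sub>R w t) ?v))"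
        using hofer_norm_triangle[of "(1 - s) *\<^sub>R ?x t + s *\<^sub>R m" "s *\<^sub>R (?v - mc E (s *\<^sub>R w t) ?v)"]
          hofer_norm_triangle[of "(1 - s) *\<^sub>R ?x t" "s *\<^sub>R m"] by linarith
      also have "\<dots> \<le> (1 - s) * N (?x t) + s * N m + s * (\<epsilon> * norm ?v)"
        using s \<delta>(3)[OF sw[of t], of ?v] pq(5) sub by (auto simp: hofer_norm_scale_pos)
      finally show ?thesis using \<eta>C by blast
    qed
    have \<eta>pw: "piecewise_C1_curve K a b \<eta>"
      using \<gamma> ab
    proof (induction rule: piecewise_C1_curve_induct)
      case (single e)
      then show ?case using piece[of a e a] by (intro piecewise_C1_curve_single) auto
    next
      case (snoc e f)
      then show ?case using piece[of e f e] piecewise_C1_curve_snoc[of K a e \<eta> f] by auto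
    qed
    have carr: "\<gamma> t \<in> carrier G" if "t \<in> {a..b}" for t by (rule curve_carrier[OF ct that])
    have "\<eta> a = \<gamma> a" "\<eta> b = \<gamma> b" using carr[of a] carr[of b] ab by (simp_all add: \<eta>_def w0 wb exp_zero)
    then have "len a b \<gamma> \<le> len a b \<eta>" using short ab \<eta>pw unfolding short_path_def by blast
    also have "\<dots> \<le> integral {a..b} (\<lambda>t. (1 - s) * N (?X t) + s * N m + s * (\<epsilon> * norm (?X t - m)))"
    proof -
      let ?g = "\<lambda>t. (1 - s) * N (?X t) + s * N m + s * (\<epsilon> * norm (?X t - m))"
      obtain F where F: "finite F"
        "\<And>t. t \<in> {a..b} - F \<Longrightarrow> \<exists>p q. a \<le> p \<and> p < t \<and> t < q \<and> q \<le> b \<and> C1_curve K p q \<gamma>"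
        using piecewise_C1_curve_pieces[OF \<gamma> ab] by blast
      \<comment> \<open>At the exceptional times the logarithmic derivative of the competitor is not
        controlled; the value 0 makes the comparison hold everywhere without changing the
        integral.\<close>
      define f where "f t = (if t \<in> F then 0 else N (right_log_deriv G K a b \<eta> t))" for t
      have "f integrable_on {a..b}"
        by (rule integrable_spike_finite[OF F(1) _ integrable_hofer_norm[OF \<eta>pw ab]]) (simp add: f_def)
      moreover have "?g integrable_on {a..b}"
        by (intro integrable_add integrable_on_cmult_left integrable_on_mult_right integrable_const_ivl
            integrable_hofer_norm[OF \<gamma> ab] normi)
      moreover have "f t \<le> ?g t" if t: "t \<in> {a..b}" for t
      proof (cases "t \<in> F")
        case True
        then show ?thesis using s \<epsilon> by (simp add: f_def hofer_norm_nonneg)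
      next
        case False
        then obtain p q where pq: "a \<le> p" "p < t" "t < q" "q \<le> b" "C1_curve K p q \<gamma>" using F(2)[of t] t by blast
        then have "C1_curve K p q \<eta>" using piece[of p q t] by simp
        then have "right_log_deriv G K a b \<eta> t = right_log_deriv G K p q \<eta> t"
          "?X t = right_log_deriv G K p q \<gamma> t"
          using pq right_log_deriv_interior[OF pq(1,4) _ pq(2,3)] ct piecewise_C1_curve_continuous[OF \<eta>pw ab]
          by auto
        then show ?thesis using piece[of p q t] pq False by (simp add: f_def)
      qed
      ultimately have "integral {a..b} f \<le> integral {a..b} ?g" by (rule integral_le)
      moreover have "integral {a..b} f = len a b \<eta>"
        unfolding path_length_def by (rule integral_spike[OF negligible_finite[OF F(1)]]) (simp add: f_def)
      ultimately show ?thesis by simp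
    qed
    also have "\<dots> = (1 - s) * len a b \<gamma> + s * N m * (b - a) + s * (\<epsilon> * c)"
    proof (rule integral_unique)
      have "((\<lambda>t. N (?X t)) has_integral len a b \<gamma>) {a..b}"
        unfolding path_length_def by (rule integrable_integral[OF integrable_hofer_norm[OF \<gamma> ab]])
      moreover have "((\<lambda>t. norm (?X t - m)) has_integral c) {a..b}"
        unfolding c_def by (rule integrable_integral[OF normi])
      moreover have "((\<lambda>t. s * N m) has_integral s * N m * (b - a)) {a..b}"
        using has_integral_const_real[of "s * N m" a b] ab by (simp add: mult.commute)
      ultimately show "((\<lambda>t. (1 - s) * N (?X t) + s * N m + s * (\<epsilon> * norm (?X t - m))) has_integral
          (1 - s) * len a b \<gamma> + s * N m * (b - a) + s * (\<epsilon> * c)) {a..b}"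
        by (intro has_integral_add has_integral_mult_right)
    qed
    \<comment> \<open>The zeroth-order term \<open>len a b \<gamma>\<close> has cancelled, so
      dividing by \<open>s\<close> leaves the first-order inequality with error
      \<open>\<epsilon> * c\<close>, where \<open>c\<close> does not depend on
      \<open>\<epsilon>\<close>.\<close>
    finally have "s * len a b \<gamma> \<le> s * (N m * (b - a) + \<epsilon> * c)" by (simp add: algebra_simps)
    then show ?thesis using s(1) mN by simp
  qed
  have "((\<lambda>n. N I + inverse (real (Suc n)) * c) \<longlongrightarrow> N I + 0 * c) sequentially"
    by (intro tendsto_intros LIMSEQ_inverse_real_of_nat)
  then have "len a b \<gamma> \<le> N I + 0 * c"
    by (rule tendsto_lowerbound) (use bound in auto)
  then show ?thesis by (simp add: I_def)
qed

text \<open>For an extremal pair of the integral, the gap between \<open>N\<close> and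
  \<open>h\<close> is nonnegative along the curve and has integral
  \<open>len a b \<gamma> - N\<close> of that integral, hence at most 0. On each piece it is
  continuous, so it vanishes at every time, including the ends.\<close>

lemma short_path_steady:
  assumes \<gamma>: "piecewise_C1_curve K a b \<gamma>" and ab: "a < b" and short: "short_path G K S a b \<gamma>"
  obtains y z where "y \<in> S" "z \<in> S"
    "\<And>p q t. a \<le> p \<Longrightarrow> p < q \<Longrightarrow> q \<le> b \<Longrightarrow> C1_curve K p q \<gamma> \<Longrightarrow> t \<in> {p..q} \<Longrightarrow>
      maximal y (right_log_deriv G K p q \<gamma> t) \<and> minimal z (right_log_deriv G K p q \<gamma> t)"
proof -
  let ?X = "right_log_deriv G K a b \<gamma>"
  obtain y z where yz: "maximal y (integral {a..b} ?X)" "minimal z (integral {a..b} ?X)"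
    by (rule extremal_exist)
  then have S: "y \<in> S" "z \<in> S" by (auto simp: maximal_def minimal_def)
  define h where "h v = ip y v - ip z v" for v
  have bl: "bounded_linear h"
    unfolding h_def by (intro bounded_linear_sub) (use linear_ip_right linear_conv_bounded_linear in blast)+
  have hN: "h v \<le> N v" for v unfolding h_def by (rule hofer_norm_ge[OF S])
  have ct: "continuous_map (top_of_set {a..b}) (Top K) \<gamma>" by (rule piecewise_C1_curve_continuous[OF \<gamma> ab])
  have Xi: "?X integrable_on {a..b}"
    using integrable_right_log_deriv[OF \<gamma> ab continuous_on_id] .
  have gap_cont: "continuous_on UNIV (\<lambda>v. N v - h v)"
    by (intro continuous_on_diff continuous_on_hofer_norm linear_continuous_on bl)
  have gap_int: "(\<lambda>t. N (?X t) - h (?X t)) integrable_on {a..b}"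
    by (rule integrable_right_log_deriv[OF \<gamma> ab gap_cont])
  have hi: "integral {a..b} (\<lambda>t. h (?X t)) = h (integral {a..b} ?X)" "(\<lambda>t. h (?X t)) integrable_on {a..b}"
    using integral_linear[OF Xi bl] integrable_linear[OF Xi bl] by (simp_all add: o_def)
  have "integral {a..b} (\<lambda>t. N (?X t) - h (?X t)) = len a b \<gamma> - h (integral {a..b} ?X)"
    unfolding path_length_def
    using integral_diff[OF integrable_hofer_norm[OF \<gamma> ab] hi(2)] hi(1) by simp
  also have "\<dots> \<le> 0"
    using short_path_average[OF assms] hofer_norm_extremal[OF yz] by (simp add: h_def)
  finally have gap: "integral {a..b} (\<lambda>t. N (?X t) - h (?X t)) \<le> 0" .
  have "maximal y (right_log_deriv G K p q \<gamma> t) \<and> minimal z (right_log_deriv G K p q \<gamma> t)"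
    if pq: "a \<le> p" "p < q" "q \<le> b" "C1_curve K p q \<gamma>" and t: "t \<in> {p..q}" for p q t
  proof -
    let ?x = "right_log_deriv G K p q \<gamma>"
    have hs: "((\<lambda>t. N (?X t) - h (?X t)) has_integral integral {p..q} (\<lambda>t. N (?x t) - h (?x t))) {p..q}"
      by (rule has_integral_right_log_deriv[OF pq ct gap_cont])
    have "integral {p..q} (\<lambda>t. N (?x t) - h (?x t)) \<le> integral {a..b} (\<lambda>t. N (?X t) - h (?X t))"
      using hs gap_int pq hN
      by (subst integral_unique[OF hs, symmetric]) (intro integral_subset_le, auto)
    moreover have c: "continuous_on {p..q} (\<lambda>t. N (?x t) - h (?x t))"
      by (rule continuous_on_compose2[OF gap_cont C1_curve_rld(1)[OF pq(2,4)]]) simp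
    moreover have "0 \<le> integral {p..q} (\<lambda>t. N (?x t) - h (?x t))"
      using hN by (intro integral_nonneg integrable_continuous_real c) simp
    ultimately have "integral {p..q} (\<lambda>t. N (?x t) - h (?x t)) = 0" using gap by simp
    then have eq: "N (?x t) = ip y (?x t) - ip z (?x t)"
      using integral_eq_0_iff[OF c pq(2)] hN t by (auto simp: h_def)
    \<comment> \<open>Replacing either point of the pair by \<open>y'\<close> cannot exceed
      \<open>N (?x t)\<close>, which the pair attains; so each of the two is extremal
      separately.\<close>
    have "ip y' (?x t) \<le> ip y (?x t)" "ip z (?x t) \<le> ip y' (?x t)" if "y' \<in> S" for y'
      using hofer_norm_ge[OF that S(2), of "?x t"] hofer_norm_ge[OF S(1) that, of "?x t"] eq by simp_all
    then show ?thesis using S by (auto simp: maximal_def minimal_def)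
  qed
  then show thesis using that S by blast
qed

text \<open>Extremality is a family of weak inequalities between continuous functions of
  \<open>t\<close>, so it passes from the open interval to its end points.\<close>

lemma steady_closure:
  assumes pq: "p < q" and \<gamma>: "C1_curve K p q \<gamma>" and t: "t \<in> {p..q}"
    and yz: "\<And>t. p < t \<Longrightarrow> t < q \<Longrightarrow>
      maximal y (right_log_deriv G K p q \<gamma> t) \<and> minimal z (right_log_deriv G K p q \<gamma> t)"
  shows "maximal y (right_log_deriv G K p q \<gamma> t) \<and> minimal z (right_log_deriv G K p q \<gamma> t)"
proof -
  let ?x = "right_log_deriv G K p q \<gamma>"
  have c: "continuous_on {p..q} (\<lambda>t. ip y' (?x t))" for y'
    by (rule bounded_linear.continuous_on[OF _ C1_curve_rld(1)[OF pq \<gamma>]])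
      (use linear_ip_right linear_conv_bounded_linear in blast)
  have le: "ip u (?x t) \<le> ip v (?x t)" if "\<And>t. p < t \<Longrightarrow> t < q \<Longrightarrow> ip u (?x t) \<le> ip v (?x t)" for u v
  proof -
    have "closed {t \<in> {p..q}. ip u (?x t) \<le> ip v (?x t)}"
      by (intro continuous_on_closed_Collect_le c closed_atLeastAtMost)
    moreover have "{p<..<q} \<subseteq> {t \<in> {p..q}. ip u (?x t) \<le> ip v (?x t)}" using that by auto
    ultimately have "closure {p<..<q} \<subseteq> {t \<in> {p..q}. ip u (?x t) \<le> ip v (?x t)}"
      by (rule closure_minimal[rotated])
    then show ?thesis using pq t by auto
  qed
  have S: "y \<in> S" "z \<in> S"
    using yz[of "(p + q) / 2"] pq by (auto simp: maximal_def minimal_def)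
  then show ?thesis
    using le yz by (auto simp: maximal_def minimal_def)
qed

end

text \<open>On an empty space every group element acts trivially, so a discrete kernel would make
  \<open>K\<close> discrete and a singleton open in the model space, which has positive dimension.
  This secures a nonempty image of the moment map.\<close>

lemma act_space_nonempty:
  fixes K :: "('k, 'g::euclidean_space) mfd"
  assumes "lie_group G K" "connected_space (Top K)" "group_action G (pts M) act" "almost_effective G K M act"
  shows "pts M \<noteq> {}"
proof
  assume M: "pts M = {}"
  interpret lie_grp G K by unfold_locales (rule assms(1))
  interpret act: group_hom G "BijGroup (pts M)" act using assms(3) by (simp add: group_action_def)
  have "act g = \<one>\<^bsub>BijGroup (pts M)\<^esub>" if "g \<in> carrier G" for g
    using act.hom_closed[OF that] by (auto simp: BijGroup_def Bij_def M extensional_def)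
  then have "kernel G (BijGroup (pts M)) act = carrier G" by (auto simp: kernel_def)
  then have "Top K = discrete_topology (pts K)"
    using assms(4) pts_K by (simp add: almost_effective_def Let_def) (metis subtopology_topspace)
  then have "openin (Top K) {\<one>\<^bsub>G\<^esub>}"
    using pts_K by (metis openin_discrete_topology one_closed empty_subsetI insert_subset)
  then have "open (snd c1 ` {\<one>\<^bsub>G\<^esub>})"
    using c1 by (intro charted_open_image[OF charted_K c1(1)]) auto
  then show False using not_open_singleton by auto
qed

theorem theoremB:
  fixes G :: "'k monoid" and K :: "('k, 'g::euclidean_space) mfd"
    and M :: "('m, 'e::euclidean_space) mfd" and \<omega> :: "'m \<Rightarrow> 'e \<Rightarrow> 'e \<Rightarrow> real"
    and act :: "'k \<Rightarrow> 'm \<Rightarrow> 'm" and \<mu> :: "'m \<Rightarrow> 'g"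
    and R a b :: real and \<gamma> :: "real \<Rightarrow> 'k"
  assumes K: "lie_group G K" "compact_space (Top K)" "connected_space (Top K)" "semisimple G K"
    and M: "smooth_manifold M" "compact_space (Top M)" "connected_space (Top M)"
    and \<omega>: "symplectic_form M \<omega>"
    and action: "smooth_action G K M act" "symplectic_action G M \<omega> act"
      "almost_effective G K M act"
    and \<mu>: "moment_map G K M \<omega> act \<mu>"
    and R: "injectivity_radius G K (\<mu> ` pts M) R"
    and \<gamma>: "a < b" "piecewise_C1_curve K a b \<gamma>"
  defines "T \<equiv> {t \<in> {a..b}. curve_differentiable_at K {a..b} \<gamma> t}"
    and "H \<equiv> \<lambda>t. moment_component G K \<mu> (right_log_deriv G K a b \<gamma> t)"
  shows "(short_path G K (\<mu> ` pts M) a b \<gamma> \<longrightarrow> quasi_autonomous (pts M) T H) \<and>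
         (quasi_autonomous (pts M) T H \<longrightarrow> locally_short G K (\<mu> ` pts M) R a b \<gamma>)"
proof -
  let ?S = "\<mu> ` pts M"
  have act: "group_action G (pts M) act" using action(1) by (simp add: smooth_action_def)
  have "continuous_map (Top M) euclidean \<mu>"
    using \<mu> by (simp add: moment_map_def smooth_map_def euclidean_mfd_def)
  then have "compactin euclidean ?S"
    using image_compactin M(2) unfolding compact_space_def by blast
  then have S: "compact ?S" by simp
  have AdS: "Ad G K g y \<in> ?S" if g: "g \<in> carrier G" and y: "y \<in> ?S" for g y
  proof -
    obtain x where x: "x \<in> pts M" "y = \<mu> x" using y by blast
    have "act g x \<in> pts M" using group_action.element_image[OF act g x(1) refl] .
    moreover have "Ad G K g y = \<mu> (act g x)" using \<mu> g x by (simp add: moment_map_def)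
    ultimately show ?thesis by blast
  qed
  interpret hofer_grp G K ?S R
    by unfold_locales
      (use K(1,2) S AdS R act_space_nonempty[OF K(1,3) act action(3)] in auto)
  note ct = piecewise_C1_curve_continuous[OF \<gamma>(2,1)]
  \<comment> \<open>Whether a point of \<open>M\<close> is extremal for \<open>H t\<close> depends
    only on its image under \<open>\<mu>\<close>, so the common points in \<open>M\<close> can be
    traded for common points \<open>z\<close>, \<open>y\<close> of \<open>?S\<close>.\<close>
  have quasi: "quasi_autonomous (pts M) T H \<longleftrightarrow>
      (\<exists>z\<in>?S. \<exists>y\<in>?S. \<forall>t\<in>T. maximal y (right_log_deriv G K a b \<gamma> t) \<and> minimal z (right_log_deriv G K a b \<gamma> t))"
    unfolding quasi_autonomous_def H_def moment_component_def maximal_def minimal_def by auto blast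
  show ?thesis
  proof (intro conjI impI)
    assume "short_path G K ?S a b \<gamma>"
    then obtain y z where S: "y \<in> ?S" "z \<in> ?S" and
      yz: "\<And>p q t. a \<le> p \<Longrightarrow> p < q \<Longrightarrow> q \<le> b \<Longrightarrow> C1_curve K p q \<gamma> \<Longrightarrow> t \<in> {p..q} \<Longrightarrow>
        maximal y (right_log_deriv G K p q \<gamma> t) \<and> minimal z (right_log_deriv G K p q \<gamma> t)"
      using short_path_steady[OF \<gamma>(2,1)] by metis
    have "maximal y (right_log_deriv G K a b \<gamma> t) \<and> minimal z (right_log_deriv G K a b \<gamma> t)" if t: "t \<in> T" for t
    proof -
      \<comment> \<open>\<open>t\<close> may be a break point at which the curve is differentiable;
        either adjacent piece then has the same logarithmic derivative there.\<close>
      obtain p q where pq: "a \<le> p" "p < q" "q \<le> b" "t \<in> {p..q}" "C1_curve K p q \<gamma>"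
        using piecewise_C1_curve_piece_at[OF \<gamma>(2,1)] t unfolding T_def by blast
      have "right_log_deriv G K a b \<gamma> t = right_log_deriv G K p q \<gamma> t"
        by (rule right_log_deriv_subinterval[OF pq(1-3,5,4) ct]) (use t in \<open>simp add: T_def\<close>)
      then show ?thesis using yz[OF pq(1-3,5,4)] by simp
    qed
    then show "quasi_autonomous (pts M) T H" unfolding quasi using S by blast
  next
    assume "quasi_autonomous (pts M) T H"
    then obtain y z where yz: "\<And>t. t \<in> T \<Longrightarrow>
        maximal y (right_log_deriv G K a b \<gamma> t) \<and> minimal z (right_log_deriv G K a b \<gamma> t)"
      unfolding quasi by blast
    show "locally_short G K ?S R a b \<gamma>"
      unfolding locally_short_def
    proof (intro allI impI)
      fix c d assume cd: "a \<le> c \<and> c < d \<and> d \<le> b \<and> path_length G K ?S c d \<gamma> \<le> R"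
      \<comment> \<open>\<open>T\<close> may omit the ends of a piece, so the hypothesis is used in
        the interior only and extended by continuity.\<close>
      have "maximal y (right_log_deriv G K p q \<gamma> t) \<and> minimal z (right_log_deriv G K p q \<gamma> t)"
        if pq: "c \<le> p" "p < q" "q \<le> d" "C1_curve K p q \<gamma>" and t: "t \<in> {p..q}" for p q t
      proof (rule steady_closure[OF pq(2,4) t])
        fix s assume s: "p < s" "s < q"
        have ab: "a \<le> p" "q \<le> b" using cd pq by auto
        have "s \<in> T" using curve_differentiable_interior[OF ab pq(4) s] ab s by (simp add: T_def)
        then show "maximal y (right_log_deriv G K p q \<gamma> s) \<and> minimal z (right_log_deriv G K p q \<gamma> s)"
          using yz[of s] right_log_deriv_interior[OF ab pq(4) s ct] by simp
      qed
      then show "short_path G K ?S c d \<gamma>"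
        using cd by (intro steady_short[of c d \<gamma> y z] piecewise_C1_curve_subinterval[OF \<gamma>(2)]) auto
    qed
  qed
qed

end
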